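(* Let $\alpha$ and $\beta$ be cocycle conjugate $E_0$-semigroups on $\mathrm{II}_1$ factors. Then their $C^*$-semiflows are conjugate: there is a $*$-isomorphism $\gamma:\mathcal{A}_\alpha\to\mathcal{A}_\beta$ with $\gamma\circ\alpha_t|_{\mathcal{A}_\alpha}=\beta_t|_{\mathcal{A}_\beta}\circ\gamma$ for all $t\ge0$. Moreover, the intertwining $*$-isomorphism $\gamma$ is implemented by a unitary $U_\gamma:L^2(\mathcal{A}_\alpha,\tau_\alpha)\to L^2(\mathcal{A}_\beta,\tau_\beta)$ between the corresponding GNS spaces.
   Context: An $E_0$-semigroup on a von Neumann algebra $\mathrm{M}$ is a semigroup $(\alpha_t)_{t\ge 0}$ of normal unital $*$-endomorphisms of $\mathrm{M}$ with $\alpha_0=\mathrm{id}$, $\alpha_t(\mathrm{M})\ne \mathrm{M}$ for all $t>0$, and $t\mapsto\rho(\alpha_t(x))$ continuous for all $x\in\mathrm{M}$, $\rho\in\mathrm{M}_*$. A cocycle for $\alpha$ is a strongly continuous family of unitaries $(U_t)_{t\ge0}$ in $\mathrm{M}$ with $U_s\alpha_s(U_t)=U_{s+t}$ for all $s,t\ge 0$; then $\alpha^U_t(x)=U_t\alpha_t(x)U_t^*$ is an $E_0$-semigroup. $\alpha$ on $\mathrm{M}$ and $\beta$ on $\mathrm{N}$ are conjugate if there is a $*$-isomorphism $\theta:\mathrm{M}\to\mathrm{N}$ with $\beta_t=\theta\circ\alpha_t\circ\theta^{-1}$ for all $t$, and cocycle conjugate if $\beta$ is conjugate to $\alpha^U$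 for some cocycle $U$ for $\alpha$. For an $E_0$-semigroup $\alpha$ on a $\mathrm{II}_1$ factor $\mathrm{M}$ with trace $\tau$, let $\mathcal{A}_\alpha(t)=\alpha_t(\mathrm{M})'\cap\mathrm{M}$, an increasing family in $t$, and let $\mathcal{A}_\alpha$ be the norm closure of $\bigcup_{t\ge0}\mathcal{A}_\alpha(t)$. The $C^*$-semiflow of $\alpha$ is $\mathcal{A}_\alpha$ together with the semigroup of $*$-endomorphisms $\alpha_t|_{\mathcal{A}_\alpha}$. The trace $\tau_\alpha$ is the restriction of $\tau$ to $\mathcal{A}_\alpha$, and $L^2(\mathcal{A}_\alpha,\tau_\alpha)$ is its GNS space. "$\gamma$ is implemented by $U_\gamma$" means that $U_\gamma\pi_\alpha(a)U_\gamma^*=\pi_\beta(\gamma(a))$ for all $a\in\mathcal{A}_\alpha$, where $\pi_\alpha,\pi_\beta$ are the GNS representations of $\tau_\alpha,\tau_\beta$. *)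

theory Defs
  imports "HOL-Analysis.Analysis"
begin

section \<open>Complex Hilbert spaces and bounded operators\<close>

text \<open>
  A complex Hilbert space is a real Hilbert space with a compatible complex scalar multiplication
  and a sesquilinear inner product, linear in the first argument, whose real part is the
  real inner product. Norm and topology are those of the real Hilbert space.
\<close>

class chilbert_space = real_inner + complete_space +
  fixes scaleC :: "complex \<Rightarrow> 'a \<Rightarrow> 'a" (infixr "*\<^sub>C" 75)
    and cinner :: "'a \<Rightarrow> 'a \<Rightarrow> complex"
  assumes scaleC_add_right: "c *\<^sub>C (x + y) = c *\<^sub>C x + c *\<^sub>C y"
    and scaleC_add_left: "(c + d) *\<^sub>C x = c *\<^sub>C x + d *\<^sub>C x"
    and scaleC_scaleC: "c *\<^sub>C (d *\<^sub>C x) = (c * d) *\<^sub>C x"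
    and scaleC_of_real: "complex_of_real r *\<^sub>C x = r *\<^sub>R x"
    and cinner_add_left: "cinner (x + y) z = cinner x z + cinner y z"
    and cinner_scaleC_left: "cinner (c *\<^sub>C x) y = c * cinner x y"
    and cinner_commute: "cinner y x = cnj (cinner x y)"
    and Re_cinner: "Re (cinner x y) = inner x y"

text \<open>
  Operators are real-bounded-linear maps (so that the library's operator norm and norm
  topology apply); \<open>bounded_ops\<close> is the subset of complex-linear ones, i.e. \<open>B(H)\<close>.
\<close>

type_synonym 'h op = "'h \<Rightarrow>\<^sub>L 'h"

definition bounded_ops :: "'h::chilbert_space op set" where
  "bounded_ops = {x. \<forall>c v. blinfun_apply x (c *\<^sub>C v) = c *\<^sub>C blinfun_apply x v}"

definition scalar_op :: "complex \<Rightarrow> 'h::chilbert_space op" where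
  "scalar_op c = Blinfun (\<lambda>v. c *\<^sub>C v)"

definition adj :: "'h::chilbert_space op \<Rightarrow> 'h op" where
  "adj x = (THE y. \<forall>v w. cinner (blinfun_apply x v) w = cinner v (blinfun_apply y w))"

section \<open>Von Neumann algebras\<close>

definition commutant :: "'h::chilbert_space op set \<Rightarrow> 'h op set" where
  "commutant S = {x \<in> bounded_ops. \<forall>s\<in>S. x o\<^sub>L s = s o\<^sub>L x}"

definition von_neumann_algebra :: "'h::chilbert_space op set \<Rightarrow> bool" where
  "von_neumann_algebra M \<longleftrightarrow>
     M \<subseteq> bounded_ops \<and> (\<forall>x\<in>M. adj x \<in> M) \<and> commutant (commutant M) = M"

definition factor :: "'h::chilbert_space op set \<Rightarrow> bool" where
  "factor M \<longleftrightarrow> von_neumann_algebra M \<and> M \<inter> commutant M = range scalar_op"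

text \<open>
  The predual \<open>M\<^sub>*\<close>: the normal (\<open>\<sigma>\<close>-weakly continuous) functionals on \<open>M\<close>. Functionals and maps
  are total functions of which only the values on \<open>M\<close> matter.
\<close>

definition predual :: "'h::chilbert_space op set \<Rightarrow> ('h op \<Rightarrow> complex) set" where
  "predual M = {\<rho>. \<exists>\<xi> \<eta> :: nat \<Rightarrow> 'h.
      summable (\<lambda>n. (norm (\<xi> n))\<^sup>2) \<and> summable (\<lambda>n. (norm (\<eta> n))\<^sup>2) \<and>
      (\<forall>x\<in>M. \<rho> x = (\<Sum>n. cinner (blinfun_apply x (\<xi> n)) (\<eta> n)))}"

definition faithful_normal_tracial_state ::
    "'h::chilbert_space op set \<Rightarrow> ('h op \<Rightarrow> complex) \<Rightarrow> bool" where
  "faithful_normal_tracial_state M \<tau> \<longleftrightarrow>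
     (\<forall>x\<in>M. \<forall>y\<in>M. \<tau> (x + y) = \<tau> x + \<tau> y) \<and>
     (\<forall>c. \<forall>x\<in>M. \<tau> (scalar_op c o\<^sub>L x) = c * \<tau> x) \<and>
     (\<forall>x\<in>M. \<tau> (adj x o\<^sub>L x) \<in> \<real>\<^sub>\<ge>\<^sub>0) \<and>
     \<tau> id_blinfun = 1 \<and>
     (\<forall>x\<in>M. \<forall>y\<in>M. \<tau> (x o\<^sub>L y) = \<tau> (y o\<^sub>L x)) \<and>
     (\<forall>x\<in>M. \<tau> (adj x o\<^sub>L x) = 0 \<longrightarrow> x = 0) \<and>
     \<tau> \<in> predual M"

text \<open>
  A \<open>II\<^sub>1\<close> factor is an infinite-dimensional factor with a faithful normal tracial state
  (which is then unique on \<open>M\<close>). The library's \<open>span\<close> is the real span; finite dimension over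
  the reals and over the complex numbers are equivalent.
\<close>

definition II1_factor :: "'h::chilbert_space op set \<Rightarrow> bool" where
  "II1_factor M \<longleftrightarrow> factor M \<and> \<not> (\<exists>B. finite B \<and> M \<subseteq> span B) \<and>
     (\<exists>\<tau>. faithful_normal_tracial_state M \<tau>)"

definition star_hom ::
    "'h::chilbert_space op set \<Rightarrow> 'k::chilbert_space op set \<Rightarrow> ('h op \<Rightarrow> 'k op) \<Rightarrow> bool" where
  "star_hom A B f \<longleftrightarrow>
     (\<forall>x\<in>A. f x \<in> B) \<and>
     (\<forall>x\<in>A. \<forall>y\<in>A. f (x + y) = f x + f y) \<and>
     (\<forall>c. \<forall>x\<in>A. f (scalar_op c o\<^sub>L x) = scalar_op c o\<^sub>L f x) \<and>
     (\<forall>x\<in>A. \<forall>y\<in>A. f (x o\<^sub>L y) = f x o\<^sub>L f y) \<and>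
     (\<forall>x\<in>A. f (adj x) = adj (f x))"

definition star_iso ::
    "'h::chilbert_space op set \<Rightarrow> 'k::chilbert_space op set \<Rightarrow> ('h op \<Rightarrow> 'k op) \<Rightarrow> bool" where
  "star_iso A B f \<longleftrightarrow> star_hom A B f \<and> bij_betw f A B"

section \<open>\<open>E\<^sub>0\<close>-semigroups and cocycle conjugacy\<close>

definition normal_unital_endo :: "'h::chilbert_space op set \<Rightarrow> ('h op \<Rightarrow> 'h op) \<Rightarrow> bool" where
  "normal_unital_endo M f \<longleftrightarrow>
     star_hom M M f \<and> f id_blinfun = id_blinfun \<and> (\<forall>\<rho>\<in>predual M. (\<lambda>x. \<rho> (f x)) \<in> predual M)"

definition E0_semigroup ::
    "'h::chilbert_space op set \<Rightarrow> (real \<Rightarrow> 'h op \<Rightarrow> 'h op) \<Rightarrow> bool" where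
  "E0_semigroup M \<alpha> \<longleftrightarrow>
     (\<forall>t\<ge>0. normal_unital_endo M (\<alpha> t)) \<and>
     (\<forall>x\<in>M. \<alpha> 0 x = x) \<and>
     (\<forall>s\<ge>0. \<forall>t\<ge>0. \<forall>x\<in>M. \<alpha> s (\<alpha> t x) = \<alpha> (s + t) x) \<and>
     (\<forall>t>0. \<alpha> t ` M \<noteq> M) \<and>
     (\<forall>x\<in>M. \<forall>\<rho>\<in>predual M. continuous_on {0..} (\<lambda>t. \<rho> (\<alpha> t x)))"

definition unitary_in :: "'h::chilbert_space op set \<Rightarrow> 'h op \<Rightarrow> bool" where
  "unitary_in M u \<longleftrightarrow> u \<in> M \<and> adj u o\<^sub>L u = id_blinfun \<and> u o\<^sub>L adj u = id_blinfun"

definition cocycle ::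
    "'h::chilbert_space op set \<Rightarrow> (real \<Rightarrow> 'h op \<Rightarrow> 'h op) \<Rightarrow> (real \<Rightarrow> 'h op) \<Rightarrow> bool" where
  "cocycle M \<alpha> U \<longleftrightarrow>
     (\<forall>t\<ge>0. unitary_in M (U t)) \<and>
     (\<forall>v. continuous_on {0..} (\<lambda>t. blinfun_apply (U t) v)) \<and>
     (\<forall>s\<ge>0. \<forall>t\<ge>0. U s o\<^sub>L \<alpha> s (U t) = U (s + t))"

definition perturb ::
    "(real \<Rightarrow> 'h::chilbert_space op \<Rightarrow> 'h op) \<Rightarrow> (real \<Rightarrow> 'h op) \<Rightarrow> real \<Rightarrow> 'h op \<Rightarrow> 'h op" where
  "perturb \<alpha> U t x = U t o\<^sub>L \<alpha> t x o\<^sub>L adj (U t)"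

definition conjugate ::
    "'h::chilbert_space op set \<Rightarrow> (real \<Rightarrow> 'h op \<Rightarrow> 'h op) \<Rightarrow>
     'k::chilbert_space op set \<Rightarrow> (real \<Rightarrow> 'k op \<Rightarrow> 'k op) \<Rightarrow> bool" where
  "conjugate M \<alpha> N \<beta> \<longleftrightarrow>
     (\<exists>\<theta>. star_iso M N \<theta> \<and> (\<forall>t\<ge>0. \<forall>y\<in>N. \<beta> t y = \<theta> (\<alpha> t (inv_into M \<theta> y))))"

definition cocycle_conjugate ::
    "'h::chilbert_space op set \<Rightarrow> (real \<Rightarrow> 'h op \<Rightarrow> 'h op) \<Rightarrow>
     'k::chilbert_space op set \<Rightarrow> (real \<Rightarrow> 'k op \<Rightarrow> 'k op) \<Rightarrow> bool" where
  "cocycle_conjugate M \<alpha> N \<beta> \<longleftrightarrow> (\<exists>U. cocycle M \<alpha> U \<and> conjugate M (perturb \<alpha> U) N \<beta>)"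

section \<open>The \<open>C\<^sup>*\<close>-semiflow\<close>

definition relative_commutant ::
    "'h::chilbert_space op set \<Rightarrow> (real \<Rightarrow> 'h op \<Rightarrow> 'h op) \<Rightarrow> real \<Rightarrow> 'h op set" where
  "relative_commutant M \<alpha> t = commutant (\<alpha> t ` M) \<inter> M"

definition semiflow_algebra ::
    "'h::chilbert_space op set \<Rightarrow> (real \<Rightarrow> 'h op \<Rightarrow> 'h op) \<Rightarrow> 'h op set" where
  "semiflow_algebra M \<alpha> = closure (\<Union>t\<in>{0..}. relative_commutant M \<alpha> t)"

definition semiflow_conjugacy ::
    "'h::chilbert_space op set \<Rightarrow> (real \<Rightarrow> 'h op \<Rightarrow> 'h op) \<Rightarrow>
     'k::chilbert_space op set \<Rightarrow> (real \<Rightarrow> 'k op \<Rightarrow> 'k op) \<Rightarrow> ('h op \<Rightarrow> 'k op) \<Rightarrow> bool" where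
  "semiflow_conjugacy A \<alpha> B \<beta> \<gamma> \<longleftrightarrow>
     star_iso A B \<gamma> \<and> (\<forall>t\<ge>0. \<forall>a\<in>A. \<gamma> (\<alpha> t a) = \<beta> t (\<gamma> a))"

section \<open>The GNS space of a trace\<close>

text \<open>
  \<open>L\<^sup>2(A, \<tau>)\<close> is the completion of \<open>A\<close> for the inner product \<open>\<langle>a, b\<rangle> = \<tau>(b\<^sup>* a)\<close>: classes of
  Cauchy sequences in \<open>A\<close> for the seminorm \<open>gns_norm \<tau>\<close>, modulo sequences tending to zero.
  The operations on classes are given by arbitrary representatives; they do not depend on the
  choice. Only the values of \<open>\<tau>\<close> on \<open>A\<close> enter, so \<open>\<tau>\<close> stands for its own restriction to \<open>A\<close>.
\<close>

definition gns_norm :: "('h::chilbert_space op \<Rightarrow> complex) \<Rightarrow> 'h op \<Rightarrow> real" where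
  "gns_norm \<tau> a = sqrt (Re (\<tau> (adj a o\<^sub>L a)))"

definition gns_Cauchy ::
    "'h::chilbert_space op set \<Rightarrow> ('h op \<Rightarrow> complex) \<Rightarrow> (nat \<Rightarrow> 'h op) set" where
  "gns_Cauchy A \<tau> = {X. (\<forall>n. X n \<in> A) \<and>
     (\<forall>e>0. \<exists>n0. \<forall>m\<ge>n0. \<forall>n\<ge>n0. gns_norm \<tau> (X m - X n) < e)}"

definition gns_rel ::
    "'h::chilbert_space op set \<Rightarrow> ('h op \<Rightarrow> complex) \<Rightarrow> (nat \<Rightarrow> 'h op) rel" where
  "gns_rel A \<tau> = {(X, Y). X \<in> gns_Cauchy A \<tau> \<and> Y \<in> gns_Cauchy A \<tau> \<and>
     (\<lambda>n. gns_norm \<tau> (X n - Y n)) \<longlonglongrightarrow> 0}"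

type_synonym 'h gns_vector = "(nat \<Rightarrow> 'h op) set"

definition gns_space ::
    "'h::chilbert_space op set \<Rightarrow> ('h op \<Rightarrow> complex) \<Rightarrow> 'h gns_vector set" where
  "gns_space A \<tau> = gns_Cauchy A \<tau> // gns_rel A \<tau>"

definition gns_class ::
    "'h::chilbert_space op set \<Rightarrow> ('h op \<Rightarrow> complex) \<Rightarrow> (nat \<Rightarrow> 'h op) \<Rightarrow> 'h gns_vector" where
  "gns_class A \<tau> X = gns_rel A \<tau> `` {X}"

definition repr :: "'h::chilbert_space gns_vector \<Rightarrow> nat \<Rightarrow> 'h op" where
  "repr \<xi> = (SOME X. X \<in> \<xi>)"

definition gns_add ::
    "'h::chilbert_space op set \<Rightarrow> ('h op \<Rightarrow> complex) \<Rightarrow>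
     'h gns_vector \<Rightarrow> 'h gns_vector \<Rightarrow> 'h gns_vector" where
  "gns_add A \<tau> \<xi> \<eta> = gns_class A \<tau> (\<lambda>n. repr \<xi> n + repr \<eta> n)"

definition gns_scale ::
    "'h::chilbert_space op set \<Rightarrow> ('h op \<Rightarrow> complex) \<Rightarrow>
     complex \<Rightarrow> 'h gns_vector \<Rightarrow> 'h gns_vector" where
  "gns_scale A \<tau> c \<xi> = gns_class A \<tau> (\<lambda>n. scalar_op c o\<^sub>L repr \<xi> n)"

definition gns_inner ::
    "('h::chilbert_space op \<Rightarrow> complex) \<Rightarrow> 'h gns_vector \<Rightarrow> 'h gns_vector \<Rightarrow> complex" where
  "gns_inner \<tau> \<xi> \<eta> = lim (\<lambda>n. \<tau> (adj (repr \<eta> n) o\<^sub>L repr \<xi> n))"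

text \<open>The GNS representation: the continuous extension of left multiplication by \<open>a\<close>.\<close>

definition gns_rep ::
    "'h::chilbert_space op set \<Rightarrow> ('h op \<Rightarrow> complex) \<Rightarrow>
     'h op \<Rightarrow> 'h gns_vector \<Rightarrow> 'h gns_vector" where
  "gns_rep A \<tau> a \<xi> = gns_class A \<tau> (\<lambda>n. a o\<^sub>L repr \<xi> n)"

definition gns_unitary ::
    "'h::chilbert_space op set \<Rightarrow> ('h op \<Rightarrow> complex) \<Rightarrow>
     'k::chilbert_space op set \<Rightarrow> ('k op \<Rightarrow> complex) \<Rightarrow>
     ('h gns_vector \<Rightarrow> 'k gns_vector) \<Rightarrow> bool" where
  "gns_unitary A \<tau> B \<sigma> W \<longleftrightarrow>
     bij_betw W (gns_space A \<tau>) (gns_space B \<sigma>) \<and>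
     (\<forall>\<xi>\<in>gns_space A \<tau>. \<forall>\<eta>\<in>gns_space A \<tau>. W (gns_add A \<tau> \<xi> \<eta>) = gns_add B \<sigma> (W \<xi>) (W \<eta>)) \<and>
     (\<forall>c. \<forall>\<xi>\<in>gns_space A \<tau>. W (gns_scale A \<tau> c \<xi>) = gns_scale B \<sigma> c (W \<xi>)) \<and>
     (\<forall>\<xi>\<in>gns_space A \<tau>. \<forall>\<eta>\<in>gns_space A \<tau>. gns_inner \<sigma> (W \<xi>) (W \<eta>) = gns_inner \<tau> \<xi> \<eta>)"

text \<open>\<open>W \<pi>\<^sub>A(a) W\<^sup>* = \<pi>\<^sub>B(\<gamma>(a))\<close>, the adjoint of the unitary \<open>W\<close> being its inverse.\<close>

definition implemented_by ::
    "'h::chilbert_space op set \<Rightarrow> ('h op \<Rightarrow> complex) \<Rightarrow>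
     'k::chilbert_space op set \<Rightarrow> ('k op \<Rightarrow> complex) \<Rightarrow>
     ('h op \<Rightarrow> 'k op) \<Rightarrow> ('h gns_vector \<Rightarrow> 'k gns_vector) \<Rightarrow> bool" where
  "implemented_by A \<tau> B \<sigma> \<gamma> W \<longleftrightarrow>
     (\<forall>a\<in>A. \<forall>\<eta>\<in>gns_space B \<sigma>.
        W (gns_rep A \<tau> a (inv_into (gns_space A \<tau>) W \<eta>)) = gns_rep B \<sigma> (\<gamma> a) \<eta>)"

end

theory Submission
  imports Defs
begin

text \<open>
  For a cocycle \<open>U\<close> the maps \<open>Ad U\<^sub>t\<close> carry \<open>\<alpha>\<^sub>t(M)' \<inter> M\<close> onto the relative commutant of the perturbed
  semigroup, and they agree on \<open>\<alpha>\<^sub>s(M)' \<inter> M\<close> for all \<open>t \<ge> s\<close>, because \<open>U\<^sub>t = U\<^sub>s \<alpha>\<^sub>s(U\<^bsub>t-s\<^esub>)\<close>.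
  Following them by the conjugacy \<open>\<theta>\<close> and passing to the norm limit gives \<open>\<gamma>\<close>; all maps involved are
  isometric. The unitary \<open>U\<^sub>\<gamma>\<close> exists because \<open>\<gamma>\<close> preserves the traces, which reduces to the
  uniqueness of the trace: \<open>\<tau>\<^sub>N \<circ> \<theta> = \<tau>\<^sub>M\<close>.

  Uniqueness is proved without projections and without normality of \<open>\<theta>\<close>. By weak compactness, the
  bounded parts of \<open>M\<close> and \<open>N\<close> are complete in the trace norms, so the convex hull of the unitary
  conjugates of \<open>x\<close> approximates an element of minimal norm, which is central, hence the scalar
  \<open>\<tau>(x)\<close>. If two traces differed at \<open>x\<close>, the same averages would approximate two different scalars
  in the two norms; products of contractions built from them then produce a nonzero operator that
  one of the traces, faithful though it is, cannot see.
\<close>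

section \<open>Complex Hilbert spaces and adjoints\<close>

text \<open>Nothing in \<open>star_iso\<close> gives weak continuity of \<theta>, so
  \<open>\<tau>\<^sub>N \<circ> \<theta>\<close> is at first only a faithful tracial state on M: its
  values cannot be followed along weak limits, and bounded sets are not known to be complete for its
  norm. Hence the two traces play different roles in the uniqueness argument. Limits are taken for
  the normal trace alone; the averaging property of the pulled-back trace is transported from N,
  where the trace is normal, because unitaries of N lift to unitaries of M.

  One average of x separates the traces only approximately: it gives a positive operator that is
  small for one trace, not zero. An infinite product makes this exact: the errors are summable for
  the normal trace, so the product stays away from 0, whereas each factor shrinks the other norm by
  a fixed proportion, up to small errors.

  Square roots near the identity, found by a fixed point iteration, take the place of functional
  calculus: in the contractivity of homomorphisms, in the bounds for the trace norm, and in passing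
  from unitaries to all of M.\<close>

instance chilbert_space \<subseteq> banach ..

lemma Im_cinner: "Im (cinner x y) = inner x (\<i> *\<^sub>C y)"
proof -
  have "cinner x (\<i> *\<^sub>C y) = cnj (\<i> * cinner y x)"
    by (metis cinner_commute cinner_scaleC_left)
  also have "\<dots> = - \<i> * cinner x y"
    by (metis cinner_commute complex_cnj_mult complex_cnj_i mult_minus_left)
  finally show ?thesis
    by (simp flip: Re_cinner)
qed

text \<open>Reduces complex identities to real ones for \<open>inner\<close>, so that the Riesz
  theorem and weak limits are needed only over the reals.\<close>

lemma cinner_eq_Complex: "cinner x y = Complex (inner x y) (inner x (\<i> *\<^sub>C y))"
  by (simp add: complex_eq_iff Im_cinner Re_cinner)

lemma inner_scaleC_i: "inner (\<i> *\<^sub>C x) y = - inner x (\<i> *\<^sub>C y)"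
proof -
  have "inner (\<i> *\<^sub>C x) y = Re (\<i> * cinner x y)"
    by (metis Re_cinner cinner_scaleC_left)
  then show ?thesis
    by (simp add: Im_cinner)
qed

lemma scaleC_1 [simp]: "1 *\<^sub>C x = (x::'a::chilbert_space)"
  using scaleC_of_real[of 1 x] by simp

lemma scaleC_Complex: "c *\<^sub>C x = Re c *\<^sub>R x + Im c *\<^sub>R (\<i> *\<^sub>C x)"
proof -
  have "c *\<^sub>C x = (complex_of_real (Re c) + complex_of_real (Im c) * \<i>) *\<^sub>C x"
    by (metis complex_eq mult.commute)
  then show ?thesis
    by (simp only: scaleC_add_left scaleC_of_real flip: scaleC_scaleC)
qed

lemma inner_scaleC_left: "inner (c *\<^sub>C x) y = inner x (cnj c *\<^sub>C y)"
  by (subst (1 2) scaleC_Complex)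
    (simp add: inner_add_left inner_diff_right inner_scaleC_i)

lemma norm_scaleC: "norm (c *\<^sub>C x) = cmod c * norm (x::'a::chilbert_space)"
proof -
  have "(norm (c *\<^sub>C x))\<^sup>2 = inner x ((cnj c * c) *\<^sub>C x)"
    by (simp add: dot_square_norm[symmetric] inner_scaleC_left scaleC_scaleC)
  also have "cnj c * c = complex_of_real ((cmod c)\<^sup>2)"
    by (metis complex_norm_square mult.commute)
  finally have "(norm (c *\<^sub>C x))\<^sup>2 = (cmod c * norm x)\<^sup>2"
    by (simp only: scaleC_of_real) (simp add: dot_square_norm power_mult_distrib)
  then show ?thesis
    by simp
qed

lemma bounded_linear_scaleC: "bounded_linear (\<lambda>v::'a::chilbert_space. c *\<^sub>C v)"
proof
  show "c *\<^sub>C (r *\<^sub>R x) = r *\<^sub>R (c *\<^sub>C x)" for r and x :: 'a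
    by (metis scaleC_of_real scaleC_scaleC mult.commute)
  show "\<exists>K. \<forall>x::'a. norm (c *\<^sub>C x) \<le> norm x * K"
    by (rule exI[of _ "cmod c"]) (simp add: norm_scaleC mult.commute)
qed (rule scaleC_add_right)

lemma scalar_op_apply [simp]: "blinfun_apply (scalar_op c) v = c *\<^sub>C v"
  by (simp add: scalar_op_def bounded_linear_Blinfun_apply bounded_linear_scaleC)

lemma scalar_op_of_real: "scalar_op (complex_of_real r) o\<^sub>L x = r *\<^sub>R x"
  by (rule blinfun_eqI) (simp add: scaleC_of_real scaleR_blinfun.rep_eq)

lemma scalar_op_1 [simp]: "scalar_op 1 = id_blinfun"
  by (rule blinfun_eqI) simp

lemma scalar_op_minus: "scalar_op (- c) = - scalar_op c"
proof (rule blinfun_eqI)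
  fix v :: 'a
  have "(- c) *\<^sub>C v = complex_of_real (-1) *\<^sub>C (c *\<^sub>C v)"
    by (simp add: scaleC_scaleC)
  then show "blinfun_apply (scalar_op (- c)) v = blinfun_apply (- scalar_op c) v"
    by (simp only: scaleC_of_real) (simp add: uminus_blinfun.rep_eq)
qed

text \<open>The Hilbert space projection argument in abstract form: near-minimizers of
  \<open>J\<close> are close because their midpoint \<open>c\<close> cannot beat the infimum
  \<open>m\<close>. It serves both for Riesz vectors and for averages over unitaries. Closeness is
  asserted for all competitors \<open>a\<close>, \<open>b\<close> at least as good as terms of the
  sequence, since the averaging argument compares a term with its unitary conjugates.\<close>

lemma minimizing_Cauchy_sequence:
  fixes J :: "'a \<Rightarrow> real" and D :: "'a \<Rightarrow> 'a \<Rightarrow> real"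
  assumes S: "S \<noteq> {}" and bdd: "bdd_below (J ` S)"
    and mid: "\<And>a b. a \<in> S \<Longrightarrow> b \<in> S \<Longrightarrow> \<exists>c\<in>S. (D a b)\<^sup>2 \<le> 2 * J a + 2 * J b - 4 * J c"
  obtains Y m where "\<And>n. Y n \<in> S" "\<And>a. a \<in> S \<Longrightarrow> m \<le> J a" "\<And>n. J (Y n) < m + 1 / real (Suc n)"
    "\<And>e. 0 < e \<Longrightarrow> \<exists>n0. \<forall>k\<ge>n0. \<forall>l\<ge>n0. \<forall>a\<in>S. \<forall>b\<in>S.
      J a \<le> J (Y k) \<longrightarrow> J b \<le> J (Y l) \<longrightarrow> D a b < e"
proof -
  define m where "m = Inf (J ` S)"
  have m_le: "m \<le> J a" if "a \<in> S" for a
    unfolding m_def by (rule cInf_lower[OF _ bdd]) (use that in simp)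
  have "\<exists>y. y \<in> S \<and> J y < m + 1 / real (Suc n)" for n
    using cInf_lessD[of "J ` S" "m + 1 / real (Suc n)"] S by (auto simp: m_def)
  then obtain Y where Y: "\<And>n. Y n \<in> S \<and> J (Y n) < m + 1 / real (Suc n)"
    by metis
  have "\<exists>n0. \<forall>k\<ge>n0. \<forall>l\<ge>n0. \<forall>a\<in>S. \<forall>b\<in>S. J a \<le> J (Y k) \<longrightarrow> J b \<le> J (Y l) \<longrightarrow> D a b < e"
    if "0 < e" for e
  proof -
    \<comment> \<open>\<open>J a\<close> and \<open>J b\<close> each exceed \<open>m\<close> by less
      than 1/(n0 + 1), and \<open>mid\<close> doubles their sum; hence the 4.\<close>
    obtain n0 where n0: "4 / real (Suc n0) < e\<^sup>2"
      using reals_Archimedean[of "e\<^sup>2 / 4"] \<open>0 < e\<close> by (auto simp: field_simps)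
    have "D a b < e" if kl: "n0 \<le> k" "n0 \<le> l" and ab: "a \<in> S" "b \<in> S" "J a \<le> J (Y k)" "J b \<le> J (Y l)"
      for k l a b
    proof -
      have "1 / real (Suc k) \<le> 1 / real (Suc n0)" "1 / real (Suc l) \<le> 1 / real (Suc n0)"
        using kl by (auto intro!: divide_left_mono)
      moreover obtain c where "c \<in> S" "(D a b)\<^sup>2 \<le> 2 * J a + 2 * J b - 4 * J c"
        using mid ab by blast
      ultimately have "(D a b)\<^sup>2 < 4 / real (Suc n0)"
        using m_le[of c] Y[of k] Y[of l] ab by linarith
      with n0 have "(D a b)\<^sup>2 < e\<^sup>2" by linarith
      then show ?thesis
        using \<open>0 < e\<close> by (meson less_eq_real_def power_less_imp_less_base)
    qed
    then show ?thesis by blast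
  qed
  with that[of Y m] Y m_le show thesis by blast
qed

text \<open>The Riesz vector of \<open>f\<close> minimizes \<open>\<bar>y\<bar>\<^sup>2 - 2 f y\<close>; minimizing sequences are Cauchy
  by the parallelogram law.\<close>

lemma riesz_representation:
  fixes f :: "'a::{real_inner,complete_space} \<Rightarrow> real"
  assumes "bounded_linear f"
  shows "\<exists>y. \<forall>x. f x = inner y x"
proof -
  interpret f: bounded_linear f by fact
  define J where "J y = inner y y - 2 * f y" for y
  obtain K where K: "\<And>x. \<bar>f x\<bar> \<le> norm x * K"
    using f.bounded by auto
  have low: "- K\<^sup>2 \<le> J y" for y
  proof -
    have "0 \<le> (norm y - K)\<^sup>2" by simp
    moreover have "f y \<le> norm y * K" using K[of y] by simp
    ultimately show ?thesis
      by (simp add: J_def dot_square_norm power2_eq_square algebra_simps)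
  qed
  \<comment> \<open>The linear terms cancel at the midpoint, which leaves the parallelogram
    law.\<close>
  have mid: "(norm (a - b))\<^sup>2 = 2 * J a + 2 * J b - 4 * J ((1/2) *\<^sub>R (a + b))" for a b
    by (simp add: J_def dot_square_norm[symmetric] f.add f.scaleR inner_commute algebra_simps)
  obtain Y m where Y: "\<And>n. J (Y n) < m + 1 / real (Suc n)" and m_le: "\<And>y. m \<le> J y"
    and close: "\<And>e. 0 < e \<Longrightarrow> \<exists>n0. \<forall>k\<ge>n0. \<forall>l\<ge>n0. \<forall>a\<in>UNIV. \<forall>b\<in>UNIV.
      J a \<le> J (Y k) \<longrightarrow> J b \<le> J (Y l) \<longrightarrow> norm (a - b) < e"
  proof (rule minimizing_Cauchy_sequence[of UNIV J "\<lambda>a b. norm (a - b)"])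
    show "bdd_below (range J)" using low by (auto simp: bdd_below_def)
    show "\<exists>c\<in>UNIV. (norm (a - b))\<^sup>2 \<le> 2 * J a + 2 * J b - 4 * J c" for a b
      using mid[of a b] by auto
  qed (simp, blast)
  have "Cauchy Y"
  proof (rule CauchyI)
    fix e :: real assume "0 < e"
    then obtain n0 where "\<forall>k\<ge>n0. \<forall>l\<ge>n0. \<forall>a\<in>UNIV. \<forall>b\<in>UNIV.
        J a \<le> J (Y k) \<longrightarrow> J b \<le> J (Y l) \<longrightarrow> norm (a - b) < e"
      by (rule exE[OF close])
    then have "\<forall>m\<ge>n0. \<forall>n\<ge>n0. norm (Y m - Y n) < e" by simp
    then show "\<exists>n0. \<forall>m\<ge>n0. \<forall>n\<ge>n0. norm (Y m - Y n) < e" by (rule exI)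
  qed
  then obtain y where y: "Y \<longlonglongrightarrow> y"
    using Cauchy_convergent convergent_def by blast
  have "(\<lambda>n. J (Y n)) \<longlonglongrightarrow> J y"
    unfolding J_def by (intro tendsto_intros y f.tendsto)
  moreover have "(\<lambda>n. m + 1 / real (Suc n)) \<longlonglongrightarrow> m"
    using LIMSEQ_inverse_real_of_nat_add[of m] by (simp add: inverse_eq_divide)
  ultimately have Jy: "J y \<le> m"
    by (rule LIMSEQ_le) (use Y less_imp_le in blast)
  have "f x = inner y x" for x
  proof (rule ccontr)
    assume ne: "f x \<noteq> inner y x"
    define d where "d = f x - inner y x"
    have expand: "J (y + t *\<^sub>R x) = J y - 2 * t * d + t\<^sup>2 * inner x x" for t
      by (simp add: J_def d_def f.add f.scaleR inner_commute power2_eq_square algebra_simps)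
    have *: "2 * t * d \<le> t\<^sup>2 * inner x x" for t
      using expand[of t] m_le[of "y + t *\<^sub>R x"] Jy by linarith
    have "x \<noteq> 0" using ne by auto
    then have pos: "0 < inner x x" by simp
    \<comment> \<open>The value t = d / |x|^2 minimizes the quadratic in \<open>expand\<close>;
      there the minimality of y reads 2 d^2 <= d^2, up to a positive factor.\<close>
    have "d\<^sup>2 \<le> 0"
      using *[of "d / inner x x"] pos by (simp add: field_simps power2_eq_square)
    with ne show False by (simp add: d_def)
  qed
  then show ?thesis by blast
qed

section \<open>Adjoints of complex-linear operators\<close>

lemma bounded_ops_iff_i:
  "x \<in> bounded_ops \<longleftrightarrow> (\<forall>v. blinfun_apply x (\<i> *\<^sub>C v) = \<i> *\<^sub>C blinfun_apply x v)"
proof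
  assume i: "\<forall>v. blinfun_apply x (\<i> *\<^sub>C v) = \<i> *\<^sub>C blinfun_apply x v"
  have "blinfun_apply x (c *\<^sub>C v) = c *\<^sub>C blinfun_apply x v" for c v
  proof -
    have "blinfun_apply x (c *\<^sub>C v) = blinfun_apply x (Re c *\<^sub>R v + Im c *\<^sub>R (\<i> *\<^sub>C v))"
      using scaleC_Complex[of c v] by simp
    also have "\<dots> = Re c *\<^sub>R blinfun_apply x v + Im c *\<^sub>R (\<i> *\<^sub>C blinfun_apply x v)"
      by (simp only: blinfun.add_right blinfun.scaleR_right i[rule_format])
    also have "\<dots> = c *\<^sub>C blinfun_apply x v"
      using scaleC_Complex[of c "blinfun_apply x v"] by simp
    finally show ?thesis .
  qed
  then show "x \<in> bounded_ops"
    unfolding bounded_ops_def by blast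
qed (auto simp: bounded_ops_def)

lemma bounded_ops_scaleC: "x \<in> bounded_ops \<Longrightarrow> blinfun_apply x (c *\<^sub>C v) = c *\<^sub>C blinfun_apply x v"
  by (simp add: bounded_ops_def)

text \<open>The Riesz theorem for \<open>inner\<close> yields a real adjoint \<open>g\<close>. It
  commutes with multiplication by i because that is skew for \<open>inner\<close>, and then the
  imaginary parts of the \<open>cinner\<close> identity follow.\<close>

lemma adj_exists:
  fixes x :: "'h::chilbert_space op"
  assumes x: "x \<in> bounded_ops"
  shows "\<exists>y. y \<in> bounded_ops \<and> (\<forall>v w. cinner (blinfun_apply x v) w = cinner v (blinfun_apply y w))"
proof -
  have "\<forall>w. \<exists>z. \<forall>v. inner (blinfun_apply x v) w = inner z v"
    by (intro allI riesz_representation bounded_linear_intros)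
  from choice[OF this] obtain g where g0: "\<forall>w v. inner (blinfun_apply x v) w = inner (g w) v"
    by (rule exE)
  have g: "inner (blinfun_apply x v) w = inner (g w) v" for v w
    by (rule g0[rule_format])
  have uniq: "a = b" if "\<And>v. inner a v = inner b v" for a b :: 'h
  proof -
    have "inner (a - b) (a - b) = 0"
      by (simp add: inner_diff_left that)
    then show ?thesis by simp
  qed
  have "bounded_linear g"
  proof
    show "g (a + b) = g a + g b" for a b
      by (rule uniq) (simp add: inner_add_left inner_add_right flip: g)
    show "g (r *\<^sub>R a) = r *\<^sub>R g a" for r a
      by (rule uniq) (simp flip: g)
    show "\<exists>K. \<forall>w. norm (g w) \<le> norm w * K"
    proof (intro exI allI)
      fix w
      have "(norm (g w))\<^sup>2 = inner (blinfun_apply x (g w)) w"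
        by (simp add: g dot_square_norm)
      also have "\<dots> \<le> norm (blinfun_apply x (g w)) * norm w"
        by (rule norm_cauchy_schwarz)
      also have "\<dots> \<le> (norm x * norm (g w)) * norm w"
        by (intro mult_right_mono norm_blinfun) simp
      finally show "norm (g w) \<le> norm w * norm x"
        by (cases "norm (g w) = 0") (auto simp: power2_eq_square ac_simps)
    qed
  qed
  then have app: "blinfun_apply (Blinfun g) = g"
    by (rule bounded_linear_Blinfun_apply)
  have gi: "g (\<i> *\<^sub>C w) = \<i> *\<^sub>C g w" for w
  proof (rule uniq)
    fix v
    have "inner (g (\<i> *\<^sub>C w)) v = inner (blinfun_apply x v) (\<i> *\<^sub>C w)" by (simp add: g)
    also have "\<dots> = - inner (blinfun_apply x (\<i> *\<^sub>C v)) w"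
      by (simp add: inner_scaleC_i bounded_ops_scaleC[OF x])
    also have "\<dots> = - inner (g w) (\<i> *\<^sub>C v)" by (simp add: g)
    finally show "inner (g (\<i> *\<^sub>C w)) v = inner (\<i> *\<^sub>C g w) v" by (simp add: inner_scaleC_i)
  qed
  have "cinner (blinfun_apply x v) w = cinner v (g w)" for v w
    by (simp add: cinner_eq_Complex g gi inner_commute[of _ v])
  with app gi show ?thesis
    by (intro exI[of _ "Blinfun g"]) (simp add: bounded_ops_iff_i)
qed

text \<open>Discharges the definite description in \<open>adj\<close>; uniqueness is tested on the
  difference of two candidate values. Outside \<open>bounded_ops\<close> nothing guarantees that the
  description denotes, which explains the membership premises from here on.\<close>

lemma adj_props:
  fixes x :: "'h::chilbert_space op"
  assumes "x \<in> bounded_ops"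
  shows "adj x \<in> bounded_ops"
    and "cinner (blinfun_apply x v) w = cinner v (blinfun_apply (adj x) w)"
proof -
  obtain y where y: "y \<in> bounded_ops"
    "\<And>v w. cinner (blinfun_apply x v) w = cinner v (blinfun_apply y w)"
    using adj_exists[OF assms] by blast
  have "adj x = y"
    unfolding adj_def
  proof (rule the_equality)
    fix z assume z: "\<forall>v w. cinner (blinfun_apply x v) w = cinner v (blinfun_apply z w)"
    show "z = y"
    proof (rule blinfun_eqI)
      fix w
      have "inner v (blinfun_apply z w) = inner v (blinfun_apply y w)" for v
        using z y(2) by (metis Re_cinner)
      from this[of "blinfun_apply z w - blinfun_apply y w"]
      show "blinfun_apply z w = blinfun_apply y w"
        by (metis inner_diff_right inner_eq_zero_iff right_minus_eq)
    qed
  qed (use y in blast)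
  with y show "adj x \<in> bounded_ops"
    and "cinner (blinfun_apply x v) w = cinner v (blinfun_apply (adj x) w)" by auto
qed

lemmas adj_bounded_ops [simp, intro] = adj_props(1)

lemma inner_adj:
  "x \<in> bounded_ops \<Longrightarrow> inner (blinfun_apply x v) w = inner v (blinfun_apply (adj x) w)"
  by (metis Re_cinner adj_props(2))

lemma adj_eqI:
  fixes x y :: "'h::chilbert_space op"
  assumes "x \<in> bounded_ops"
    and "\<And>v w. inner (blinfun_apply x v) w = inner v (blinfun_apply y w)"
  shows "adj x = y"
proof (rule blinfun_eqI)
  fix w
  have "inner v (blinfun_apply (adj x) w) = inner v (blinfun_apply y w)" for v
    by (simp flip: assms(2) inner_adj[OF assms(1)])
  from this[of "blinfun_apply (adj x) w - blinfun_apply y w"]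
  show "blinfun_apply (adj x) w = blinfun_apply y w"
    by (metis inner_diff_right inner_eq_zero_iff right_minus_eq)
qed

lemma bounded_ops_add [simp, intro]: "x \<in> bounded_ops \<Longrightarrow> y \<in> bounded_ops \<Longrightarrow> x + y \<in> bounded_ops"
  by (simp add: bounded_ops_def plus_blinfun.rep_eq scaleC_add_right)

lemma bounded_ops_compose [simp, intro]:
  "x \<in> bounded_ops \<Longrightarrow> y \<in> bounded_ops \<Longrightarrow> x o\<^sub>L y \<in> bounded_ops"
  by (simp add: bounded_ops_def)

lemma bounded_ops_scalar_op [simp, intro]: "scalar_op c \<in> bounded_ops"
  by (simp add: bounded_ops_def scaleC_scaleC mult.commute)

lemma bounded_ops_scaleR [simp, intro]: "x \<in> bounded_ops \<Longrightarrow> r *\<^sub>R x \<in> bounded_ops"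
  by (metis bounded_ops_compose bounded_ops_scalar_op scalar_op_of_real)

lemma bounded_ops_id [simp, intro]: "id_blinfun \<in> bounded_ops"
  by (simp add: bounded_ops_def)

lemma bounded_ops_diff [simp, intro]: "x \<in> bounded_ops \<Longrightarrow> y \<in> bounded_ops \<Longrightarrow> x - y \<in> bounded_ops"
  using bounded_ops_add[of x "(-1) *\<^sub>R y"] bounded_ops_scaleR[of y "-1"] by simp

lemma adj_adj [simp]: "x \<in> bounded_ops \<Longrightarrow> adj (adj x) = x"
proof (rule adj_eqI)
  assume x: "x \<in> bounded_ops"
  then show "adj x \<in> bounded_ops" by simp
  show "inner (blinfun_apply (adj x) v) w = inner v (blinfun_apply x w)" for v w
    using inner_adj[OF x, of w v] by (simp add: inner_commute)
qed

lemma adj_add: "x \<in> bounded_ops \<Longrightarrow> y \<in> bounded_ops \<Longrightarrow> adj (x + y) = adj x + adj y"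
  by (rule adj_eqI, simp)
    (simp only: plus_blinfun.rep_eq inner_add_left inner_add_right inner_adj)

lemma adj_diff: "x \<in> bounded_ops \<Longrightarrow> y \<in> bounded_ops \<Longrightarrow> adj (x - y) = adj x - adj y"
  by (rule adj_eqI, simp)
    (simp only: minus_blinfun.rep_eq inner_diff_left inner_diff_right inner_adj)

lemma adj_compose: "x \<in> bounded_ops \<Longrightarrow> y \<in> bounded_ops \<Longrightarrow> adj (x o\<^sub>L y) = adj y o\<^sub>L adj x"
  by (rule adj_eqI) (auto simp: inner_adj)

lemma adj_scaleR: "x \<in> bounded_ops \<Longrightarrow> adj (r *\<^sub>R x) = r *\<^sub>R adj x"
  by (rule adj_eqI) (auto simp: scaleR_blinfun.rep_eq inner_adj)

lemma adj_id [simp]: "adj id_blinfun = id_blinfun"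
  by (rule adj_eqI) auto

lemma adj_scalar_op [simp]: "adj (scalar_op c) = scalar_op (cnj c)"
  by (rule adj_eqI) (auto simp: inner_scaleC_left)

lemma scalar_op_commute: "x \<in> bounded_ops \<Longrightarrow> scalar_op c o\<^sub>L x = x o\<^sub>L scalar_op c"
  by (rule blinfun_eqI) (simp add: bounded_ops_scaleC)

lemma scalar_op_mult: "scalar_op (c * d) = scalar_op c o\<^sub>L scalar_op d"
  by (rule blinfun_eqI) (simp add: scaleC_scaleC)

lemma norm_adj [simp]:
  assumes "x \<in> bounded_ops" shows "norm (adj x) = norm x"
proof -
  have *: "norm (adj x) \<le> norm x" if x: "x \<in> bounded_ops" for x :: "'a op"
  proof (rule norm_blinfun_bound)
    fix w
    define z where "z = blinfun_apply (adj x) w"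
    have "(norm z)\<^sup>2 = inner (blinfun_apply x z) w"
      by (simp add: inner_adj[OF x] z_def dot_square_norm)
    also have "\<dots> \<le> norm (blinfun_apply x z) * norm w"
      by (rule norm_cauchy_schwarz)
    also have "\<dots> \<le> (norm x * norm z) * norm w"
      by (intro mult_right_mono norm_blinfun) simp
    finally show "norm (blinfun_apply (adj x) w) \<le> norm x * norm w"
      by (cases "norm z = 0") (auto simp: z_def power2_eq_square ac_simps)
  qed simp
  from *[OF assms] *[of "adj x"] assms show ?thesis by simp
qed

lemma norm_apply_square:
  "x \<in> bounded_ops \<Longrightarrow> (norm (blinfun_apply x v))\<^sup>2 = inner (blinfun_apply (adj x o\<^sub>L x) v) v"
  by (simp add: inner_adj dot_square_norm[symmetric])

interpretation blinfun_compose: bounded_bilinear "(o\<^sub>L)"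
  by (rule bounded_bilinear_blinfun_compose)

lemmas compose_bilinear =
  blinfun_compose.add_left blinfun_compose.add_right blinfun_compose.diff_left
  blinfun_compose.diff_right blinfun_compose.scaleR_left blinfun_compose.scaleR_right
  blinfun_compose.minus_left blinfun_compose.minus_right

lemma compose_assoc: "(x o\<^sub>L y) o\<^sub>L z = x o\<^sub>L (y o\<^sub>L z)"
  by (rule blinfun_eqI) simp

lemma compose_id [simp]: "x o\<^sub>L id_blinfun = x" "id_blinfun o\<^sub>L x = x"
  by (rule blinfun_eqI; simp)+

lemma compose_cancel: "a o\<^sub>L b = id_blinfun \<Longrightarrow> a o\<^sub>L (b o\<^sub>L z) = z"
  by (metis compose_assoc compose_id(2))

lemma norm_compose_le_one: "norm a \<le> 1 \<Longrightarrow> norm b \<le> 1 \<Longrightarrow> norm (a o\<^sub>L b) \<le> 1"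
  using norm_blinfun_compose[of a b] mult_le_one[of "norm a" "norm b"] by simp

section \<open>Von Neumann algebras and square roots\<close>

lemma tendsto_adj:
  assumes "X \<longlonglongrightarrow> x" "\<And>n. X n \<in> bounded_ops" "x \<in> bounded_ops"
  shows "(\<lambda>n. adj (X n)) \<longlonglongrightarrow> adj x"
proof -
  have eq: "norm (adj (X n) - adj x) = norm (X n - x)" for n
    using assms by (metis adj_diff bounded_ops_diff norm_adj)
  have "(\<lambda>n. norm (adj (X n) - adj x)) \<longlonglongrightarrow> 0"
    unfolding eq by (rule tendsto_norm_zero[OF LIM_zero[OF assms(1)]])
  then show ?thesis
    by (rule LIM_zero_cancel[OF tendsto_norm_zero_cancel])
qed

lemmas tendsto_compose_op [tendsto_intros] = blinfun_compose.tendsto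

lemma closed_bounded_ops: "closed bounded_ops"
proof -
  have *: "bounded_ops = (\<Inter>v. {x::'a op. blinfun_apply x (\<i> *\<^sub>C v) = \<i> *\<^sub>C blinfun_apply x v})"
    by (auto simp: bounded_ops_iff_i)
  show ?thesis
    unfolding * by (intro closed_INT ballI closed_Collect_eq continuous_intros
        bounded_linear.continuous_on[OF bounded_linear_scaleC])
qed

lemma closed_commutant: "closed (commutant S)"
proof -
  have *: "commutant S = bounded_ops \<inter> (\<Inter>s\<in>S. {x. x o\<^sub>L s = s o\<^sub>L x})"
    by (auto simp: commutant_def)
  show ?thesis
    unfolding * by (intro closed_Int closed_INT closed_bounded_ops ballI closed_Collect_eq
        blinfun_compose.continuous_on continuous_intros)
qed

lemma commutantD: "x \<in> commutant S \<Longrightarrow> s \<in> S \<Longrightarrow> x o\<^sub>L s = s o\<^sub>L x"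
  by (simp add: commutant_def)

lemma commutant_bounded_ops: "x \<in> commutant S \<Longrightarrow> x \<in> bounded_ops"
  by (simp add: commutant_def)

lemma commutant_add: "x \<in> commutant S \<Longrightarrow> y \<in> commutant S \<Longrightarrow> x + y \<in> commutant S"
  by (simp add: commutant_def compose_bilinear)

lemma commutant_compose: "x \<in> commutant S \<Longrightarrow> y \<in> commutant S \<Longrightarrow> x o\<^sub>L y \<in> commutant S"
  by (auto simp: commutant_def) (metis compose_assoc)

lemma commutant_scalar_op: "S \<subseteq> bounded_ops \<Longrightarrow> scalar_op c \<in> commutant S"
  by (auto simp: commutant_def scalar_op_commute)

lemma commutant_adj:
  assumes "x \<in> commutant S" "S \<subseteq> bounded_ops" "\<And>s. s \<in> S \<Longrightarrow> adj s \<in> S"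
  shows "adj x \<in> commutant S"
proof -
  have "adj x o\<^sub>L s = s o\<^sub>L adj x" if "s \<in> S" for s
  proof -
    have s: "s \<in> bounded_ops" "x \<in> bounded_ops"
      using assms that by (auto simp: commutant_def)
    have "adj (adj s o\<^sub>L x) = adj (x o\<^sub>L adj s)"
      using commutantD[OF assms(1) assms(3)[OF that]] by simp
    then show ?thesis
      using s by (simp add: adj_compose)
  qed
  then show ?thesis
    using assms(1) by (simp add: commutant_def)
qed

locale vn_algebra =
  fixes M :: "'h::chilbert_space op set"
  assumes vn: "von_neumann_algebra M"
begin

text \<open>\<open>von_neumann_algebra\<close> does not mention sums, products, scalars or
  closedness; all of them are read off from the fact that M is itself a commutant.\<close>

lemma bicommutant: "commutant (commutant M) = M"
  using vn by (simp add: von_neumann_algebra_def)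

lemma bdd [simp, intro]: "x \<in> M \<Longrightarrow> x \<in> bounded_ops"
  using vn by (auto simp: von_neumann_algebra_def)

lemma adj_mem [simp, intro]: "x \<in> M \<Longrightarrow> adj x \<in> M"
  using vn by (simp add: von_neumann_algebra_def)

lemma add_mem [simp, intro]: "x \<in> M \<Longrightarrow> y \<in> M \<Longrightarrow> x + y \<in> M"
  using commutant_add bicommutant by metis

lemma compose_mem [simp, intro]: "x \<in> M \<Longrightarrow> y \<in> M \<Longrightarrow> x o\<^sub>L y \<in> M"
  using commutant_compose bicommutant by metis

lemma scalar_mem [simp, intro]: "scalar_op c \<in> M"
  using commutant_scalar_op[of "commutant M"] bicommutant commutant_bounded_ops by blast

lemma id_mem [simp, intro]: "id_blinfun \<in> M"
  using scalar_mem[of 1] by simp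

lemma scaleR_mem [simp, intro]: "x \<in> M \<Longrightarrow> r *\<^sub>R x \<in> M"
  by (metis compose_mem scalar_mem scalar_op_of_real)

lemma diff_mem [simp, intro]: "x \<in> M \<Longrightarrow> y \<in> M \<Longrightarrow> x - y \<in> M"
  using add_mem[of x "(-1) *\<^sub>R y"] scaleR_mem[of y "-1"] by simp

lemma uminus_mem [simp, intro]: "x \<in> M \<Longrightarrow> - x \<in> M"
  using scaleR_mem[of x "-1"] by simp

lemma zero_mem [simp, intro]: "0 \<in> M"
  using diff_mem[of id_blinfun id_blinfun] by simp

lemma closed_algebra: "closed M"
  by (metis bicommutant closed_commutant)

text \<open>Put s = 1 - y, where y is the fixed point of y = (b + y^2)/2, a contraction on a ball of
  radius below 1: then (1 - y)^2 = 1 - b. Membership, selfadjointness and commutation are carried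
  along in the closed set \<open>S\<close> on which the iteration runs.\<close>

lemma sqrt_exists:
  assumes b: "b \<in> M" "adj b = b" "norm b < 1"
  shows "\<exists>s\<in>M. adj s = s \<and> s o\<^sub>L s = id_blinfun - b \<and>
    (\<forall>c. c o\<^sub>L b = b o\<^sub>L c \<longrightarrow> c o\<^sub>L s = s o\<^sub>L c)"
proof -
  \<comment> \<open>The radius must be below 1 for a contraction, and satisfy (norm b + \<rho>^2)/2
    <= \<rho> for invariance of the ball; the midpoint between norm b and 1 does both.\<close>
  define \<rho> where "\<rho> = (1 + norm b) / 2"
  have \<rho>: "0 \<le> \<rho>" "\<rho> < 1" using b by (auto simp: \<rho>_def)
  have \<rho>2: "(norm b + \<rho> * \<rho>) / 2 \<le> \<rho>"
  proof -
    have "(1 - norm b) * (1 - norm b) \<le> (1 - norm b) * 4"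
      using b(3) norm_ge_zero[of b] by (intro mult_left_mono) linarith+
    then show ?thesis
      by (simp add: \<rho>_def field_simps)
  qed
  define S where "S = {y \<in> M. adj y = y \<and> norm y \<le> \<rho> \<and>
    (\<forall>c. c o\<^sub>L b = b o\<^sub>L c \<longrightarrow> c o\<^sub>L y = y o\<^sub>L c)}"
  define f where "f y = (1/2) *\<^sub>R (b + (y o\<^sub>L y))" for y
  have "closed S"
    unfolding closed_sequential_limits
  proof safe
    fix Y l assume Y: "\<forall>n. Y n \<in> S" and lim: "Y \<longlonglongrightarrow> l"
    have l: "l \<in> M"
      using closed_algebra Y lim unfolding closed_sequential_limits S_def by blast
    have "(\<lambda>n. adj (Y n)) \<longlonglongrightarrow> adj l"
      using Y l by (intro tendsto_adj lim) (auto simp: S_def)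
    moreover have "(\<lambda>n. adj (Y n)) = Y" using Y by (auto simp: S_def)
    ultimately have "adj l = l" using lim LIMSEQ_unique by metis
    moreover have "norm l \<le> \<rho>"
      using Y by (intro LIMSEQ_le_const2[OF tendsto_norm[OF lim]]) (auto simp: S_def)
    moreover have "c o\<^sub>L l = l o\<^sub>L c" if "c o\<^sub>L b = b o\<^sub>L c" for c
    proof (rule LIMSEQ_unique)
      show "(\<lambda>n. c o\<^sub>L Y n) \<longlonglongrightarrow> (c o\<^sub>L l)" by (intro tendsto_intros lim)
      have "(\<lambda>n. Y n o\<^sub>L c) \<longlonglongrightarrow> (l o\<^sub>L c)" by (intro tendsto_intros lim)
      moreover have "(\<lambda>n. Y n o\<^sub>L c) = (\<lambda>n. c o\<^sub>L Y n)"
        using Y that by (auto simp: S_def)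
      ultimately show "(\<lambda>n. c o\<^sub>L Y n) \<longlonglongrightarrow> (l o\<^sub>L c)" by simp
    qed
    ultimately show "l \<in> S" using l by (simp add: S_def)
  qed
  have "\<exists>!y\<in>S. f y = y"
  proof (rule Banach_fix)
    show "complete S" using \<open>closed S\<close> by (simp add: complete_eq_closed)
    have "0 \<in> S" using \<rho> b by (auto simp: S_def intro!: adj_eqI)
    then show "S \<noteq> {}" by blast
    show "f ` S \<subseteq> S"
    proof safe
      fix y assume y: "y \<in> S"
      have "norm (y o\<^sub>L y) \<le> \<rho> * \<rho>"
        using y \<rho> by (intro order_trans[OF norm_blinfun_compose] mult_mono) (auto simp: S_def)
      then have "norm (b + (y o\<^sub>L y)) \<le> norm b + \<rho> * \<rho>"
        using norm_triangle_ineq[of b "y o\<^sub>L y"] by linarith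
      then have "norm (f y) \<le> \<rho>"
        using \<rho>2 by (simp add: f_def)
      moreover have "c o\<^sub>L f y = f y o\<^sub>L c" if cb: "c o\<^sub>L b = b o\<^sub>L c" for c
      proof -
        have cy: "c o\<^sub>L y = y o\<^sub>L c" using y cb unfolding S_def by blast
        have "c o\<^sub>L (y o\<^sub>L y) = (c o\<^sub>L y) o\<^sub>L y" by (rule compose_assoc[symmetric])
        also have "\<dots> = (y o\<^sub>L y) o\<^sub>L c" by (simp only: cy compose_assoc)
        finally show ?thesis
          unfolding f_def compose_bilinear cb by (rule arg_cong)
      qed
      moreover have "y \<in> M" "adj y = y" using y unfolding S_def by blast+
      then have "f y \<in> M" "adj (f y) = f y"
        using b unfolding f_def by (auto simp: adj_scaleR adj_add adj_compose)
      ultimately show "f y \<in> S"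
        unfolding S_def by blast
    qed
    fix x y assume xy: "x \<in> S" "y \<in> S"
    \<comment> \<open>This splitting is valid without commutation of x and y; each product
      contributes \<rho>/2 to the Lipschitz constant.\<close>
    have "f x - f y = (1/2) *\<^sub>R ((x o\<^sub>L (x - y)) + ((x - y) o\<^sub>L y))"
      by (simp add: f_def compose_bilinear algebra_simps)
    also have "norm \<dots> \<le> (1/2) * (norm (x o\<^sub>L (x - y)) + norm ((x - y) o\<^sub>L y))"
      by (simp add: norm_triangle_ineq)
    also have "\<dots> \<le> (1/2) * (\<rho> * norm (x - y) + norm (x - y) * \<rho>)"
      using xy by (intro mult_left_mono add_mono order_trans[OF norm_blinfun_compose] mult_right_mono)
        (auto simp: S_def)
    finally show "dist (f x) (f y) \<le> \<rho> * dist x y"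
      by (simp add: dist_norm mult.commute)
  qed (use \<rho> in auto)
  then obtain y where y: "y \<in> S" "f y = y" by blast
  have "2 *\<^sub>R y = b + (y o\<^sub>L y)"
    by (subst y(2)[symmetric]) (simp add: f_def)
  then have "(id_blinfun - y) o\<^sub>L (id_blinfun - y) = id_blinfun - b"
    by (simp add: compose_bilinear scaleR_2 algebra_simps)
  moreover have yM: "y \<in> M" "adj y = y" using y(1) unfolding S_def by blast+
  then have "id_blinfun - y \<in> M" "adj (id_blinfun - y) = id_blinfun - y"
    by (simp_all add: adj_diff)
  moreover have "c o\<^sub>L (id_blinfun - y) = (id_blinfun - y) o\<^sub>L c" if "c o\<^sub>L b = b o\<^sub>L c" for c
  proof -
    have "c o\<^sub>L y = y o\<^sub>L c" using y(1) that unfolding S_def by blast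
    then show ?thesis unfolding compose_bilinear compose_id by (rule arg_cong)
  qed
  ultimately show ?thesis by blast
qed

lemma star_hom_simps:
  assumes "star_hom M N f" "x \<in> M" "y \<in> M"
  shows "f (x + y) = f x + f y" "f (x o\<^sub>L y) = f x o\<^sub>L f y" "f (adj x) = adj (f x)"
    "f (r *\<^sub>R x) = r *\<^sub>R f x" "f (x - y) = f x - f y" "f x \<in> N"
proof -
  have R: "f (r *\<^sub>R x) = r *\<^sub>R f x" if "x \<in> M" for x r
    using assms(1) that unfolding star_hom_def by (metis scalar_op_of_real)
  show "f (x + y) = f x + f y" "f (x o\<^sub>L y) = f x o\<^sub>L f y" "f (adj x) = adj (f x)"
    "f (r *\<^sub>R x) = r *\<^sub>R f x" "f x \<in> N"
    using assms R by (auto simp: star_hom_def)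
  have "f (x + (-1) *\<^sub>R y) = f x + (-1) *\<^sub>R f y"
    using assms R[of y] scaleR_mem unfolding star_hom_def by metis
  then show "f (x - y) = f x - f y" by simp
qed

text \<open>Square roots replace the usual spectral argument: for k > norm x, the operator 1 -
  (1/k^2) \<open>adj x o\<^sub>L x\<close> is the square of a selfadjoint s, and f maps this
  relation to one that shows |f(x) v| <= k |v|. Choosing k strictly between the norms keeps
  \<open>b\<close> strictly inside the unit ball, as \<open>sqrt_exists\<close> requires.\<close>

lemma star_hom_contractive:
  assumes f: "star_hom M N f" "f id_blinfun = id_blinfun" and N: "N \<subseteq> bounded_ops" and x: "x \<in> M"
  shows "norm (f x) \<le> norm x"
proof (rule ccontr)
  assume "\<not> ?thesis"
  then obtain k where k: "norm x < k" "k < norm (f x)" using dense not_le by blast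
  have k0: "0 < k" using k norm_ge_zero[of x] by linarith
  define b where "b = (1 / k\<^sup>2) *\<^sub>R (adj x o\<^sub>L x)"
  have b: "b \<in> M" "adj b = b"
    using x by (auto simp: b_def adj_scaleR adj_compose)
  have "norm (adj x o\<^sub>L x) \<le> (norm x)\<^sup>2"
    using norm_blinfun_compose[of "adj x" x] x by (simp add: power2_eq_square)
  also have "\<dots> < k\<^sup>2" using k by (intro power_strict_mono) auto
  finally have "norm b < 1" using k0 by (simp add: b_def)
  with b obtain s where s: "s \<in> M" "adj s = s" "s o\<^sub>L s = id_blinfun - b"
    using sqrt_exists by blast
  have fs: "f s \<in> bounded_ops" "adj (f s) = f s" "f x \<in> bounded_ops"
    using star_hom_simps[OF f(1)] s x N by (metis subsetD)+
  have eq: "f s o\<^sub>L f s = id_blinfun - (1 / k\<^sup>2) *\<^sub>R (adj (f x) o\<^sub>L f x)"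
    using star_hom_simps[OF f(1)] s b x f(2) by (metis b_def adj_mem compose_mem id_mem)
  have "norm (f x) \<le> k"
  proof (rule norm_blinfun_bound)
    fix v
    have "0 \<le> (norm (blinfun_apply (f s) v))\<^sup>2" by simp
    also have "\<dots> = inner (blinfun_apply (f s o\<^sub>L f s) v) v"
      using fs by (simp only: norm_apply_square)
    also have "\<dots> = (norm v)\<^sup>2 - (norm (blinfun_apply (f x) v))\<^sup>2 / k\<^sup>2"
      unfolding eq
      by (simp add: minus_blinfun.rep_eq scaleR_blinfun.rep_eq inner_diff_left dot_square_norm
          norm_apply_square[OF fs(3)])
    finally have "(norm (blinfun_apply (f x) v))\<^sup>2 \<le> (k * norm v)\<^sup>2"
      using k0 by (simp add: field_simps power_mult_distrib)
    then show "norm (blinfun_apply (f x) v) \<le> k * norm v"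
      using k0 by (simp add: power2_le_iff_abs_le abs_le_square_iff)
  qed (use k0 in simp)
  with k show False by simp
qed

end

section \<open>Faithful tracial states\<close>

text \<open>Polarization: <b v, w> is a quarter of the difference of the quadratic form at v + w and
  at v - w, and positivity drops the second term.\<close>

lemma norm_le_one_of_positive:
  assumes b: "b \<in> bounded_ops" "adj b = b"
    and pos: "\<And>v. 0 \<le> inner (blinfun_apply b v) v"
    and le: "\<And>v. inner (blinfun_apply b v) v \<le> (norm v)\<^sup>2"
  shows "norm b \<le> 1"
proof (rule norm_blinfun_bound)
  fix v
  show "norm (blinfun_apply b v) \<le> 1 * norm v"
  proof (cases "blinfun_apply b v = 0")
    case False
    \<comment> \<open>Rescaling b v to the length of v gives |v + w| <= 2 |v|, which makes the
      constant come out as 1.\<close>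
    define w where "w = (norm v / norm (blinfun_apply b v)) *\<^sub>R blinfun_apply b v"
    have nw: "norm w = norm v" using False by (simp add: w_def)
    have bvw: "inner (blinfun_apply b v) w = norm v * norm (blinfun_apply b v)"
      using False by (simp add: w_def dot_square_norm power2_eq_square)
    have bwv: "inner (blinfun_apply b w) v = inner (blinfun_apply b v) w"
      using inner_adj[OF b(1), of w v] b(2) by (simp add: inner_commute)
    have "4 * inner (blinfun_apply b v) w =
        inner (blinfun_apply b (v + w)) (v + w) - inner (blinfun_apply b (v - w)) (v - w)"
      by (simp add: blinfun.add_right blinfun.diff_right inner_add_left inner_add_right
          inner_diff_left inner_diff_right bwv)
    also have "\<dots> \<le> (norm (v + w))\<^sup>2"
      using le[of "v + w"] pos[of "v - w"] by linarith
    also have "\<dots> \<le> (2 * norm v)\<^sup>2"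
      using norm_triangle_ineq[of v w] nw by (intro power_mono) auto
    finally have "norm v * norm (blinfun_apply b v) \<le> norm v * norm v"
      by (simp add: bvw power2_eq_square)
    then show ?thesis using False by (cases "v = 0") auto
  qed simp
qed simp

text \<open>Normality is split off on purpose: a trace pulled back along an isomorphism is seen to
  satisfy these axioms before anything is known about its continuity.\<close>

locale tracial_state = vn_algebra M for M :: "'h::chilbert_space op set" +
  fixes \<phi> :: "'h op \<Rightarrow> complex"
  assumes phi_add: "x \<in> M \<Longrightarrow> y \<in> M \<Longrightarrow> \<phi> (x + y) = \<phi> x + \<phi> y"
    and phi_scalar: "x \<in> M \<Longrightarrow> \<phi> (scalar_op c o\<^sub>L x) = c * \<phi> x"
    and phi_pos: "x \<in> M \<Longrightarrow> \<phi> (adj x o\<^sub>L x) \<in> \<real>\<^sub>\<ge>\<^sub>0"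
    and phi_id [simp]: "\<phi> id_blinfun = 1"
    and phi_commute: "x \<in> M \<Longrightarrow> y \<in> M \<Longrightarrow> \<phi> (x o\<^sub>L y) = \<phi> (y o\<^sub>L x)"
    and phi_faithful: "x \<in> M \<Longrightarrow> \<phi> (adj x o\<^sub>L x) = 0 \<Longrightarrow> x = 0"
begin

lemma phi_scaleR: "x \<in> M \<Longrightarrow> \<phi> (r *\<^sub>R x) = complex_of_real r * \<phi> x"
  by (metis phi_scalar scalar_op_of_real)

lemma phi_diff: "x \<in> M \<Longrightarrow> y \<in> M \<Longrightarrow> \<phi> (x - y) = \<phi> x - \<phi> y"
  using phi_add[of x "(-1) *\<^sub>R y"] phi_scaleR[of y "-1"] by simp

lemma phi_scalar_op: "\<phi> (scalar_op c) = c"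
  using phi_scalar[of id_blinfun c] by simp

text \<open>The value at \<open>adj (id_blinfun + x) o\<^sub>L (id_blinfun + x)\<close> is a
  nonnegative real; expanding it shows that \<phi> x + \<phi> (adj x) is real. The same for i x
  settles the real parts.\<close>

lemma phi_adj:
  assumes "x \<in> M" shows "\<phi> (adj x) = cnj (\<phi> x)"
proof -
  have *: "Im (\<phi> (adj x)) = - Im (\<phi> x)" if x: "x \<in> M" for x
  proof -
    have "adj (id_blinfun + x) o\<^sub>L (id_blinfun + x) = (id_blinfun + x) + (adj x + (adj x o\<^sub>L x))"
      using x by (simp add: adj_add compose_bilinear)
    then have "\<phi> (adj (id_blinfun + x) o\<^sub>L (id_blinfun + x)) = 1 + \<phi> x + (\<phi> (adj x) + \<phi> (adj x o\<^sub>L x))"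
      using x by (simp add: phi_add)
    moreover have "Im (\<phi> (adj (id_blinfun + x) o\<^sub>L (id_blinfun + x))) = 0"
      using x by (intro complex_is_Real_iff[THEN iffD1] nonneg_Reals_subset_Reals[THEN subsetD]) (auto intro: phi_pos)
    moreover have "Im (\<phi> (adj x o\<^sub>L x)) = 0"
      using x by (intro complex_is_Real_iff[THEN iffD1] nonneg_Reals_subset_Reals[THEN subsetD]) (auto intro: phi_pos)
    ultimately show ?thesis by simp
  qed
  have "adj (scalar_op \<i> o\<^sub>L x) = scalar_op (-\<i>) o\<^sub>L adj x"
    using assms by (simp add: adj_compose scalar_op_commute)
  then have "Re (\<phi> (adj x)) = Re (\<phi> x)"
    using *[of "scalar_op \<i> o\<^sub>L x"] assms by (simp add: phi_scalar)
  with *[OF assms] show ?thesis by (simp add: complex_eq_iff)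
qed

lemma Re_phi_pos: "x \<in> M \<Longrightarrow> 0 \<le> Re (\<phi> (adj x o\<^sub>L x))"
  using phi_pos[of x] by (auto simp: complex_nonneg_Reals_iff)

lemma Im_phi_pos: "x \<in> M \<Longrightarrow> Im (\<phi> (adj x o\<^sub>L x)) = 0"
  using phi_pos[of x] by (auto simp: complex_nonneg_Reals_iff)

lemma gns_norm_square: "x \<in> M \<Longrightarrow> (gns_norm \<phi> x)\<^sup>2 = Re (\<phi> (adj x o\<^sub>L x))"
  by (simp add: gns_norm_def Re_phi_pos)

lemma gns_norm_nonneg [simp]: "x \<in> M \<Longrightarrow> 0 \<le> gns_norm \<phi> x"
  by (simp add: gns_norm_def Re_phi_pos)

lemma gns_norm_eq_0: "x \<in> M \<Longrightarrow> gns_norm \<phi> x = 0 \<Longrightarrow> x = 0"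
  using phi_faithful[of x] gns_norm_square[of x] Im_phi_pos[of x] by (simp add: complex_eq_iff)

lemma gns_norm_id [simp]: "gns_norm \<phi> id_blinfun = 1"
  by (simp add: gns_norm_def)

text \<open>The real part of the GNS inner product. It is enough for the triangle inequality and the
  parallelogram law; phases are dealt with in \<open>phi_Cauchy_Schwarz\<close>.\<close>

definition ip :: "'h op \<Rightarrow> 'h op \<Rightarrow> real" where
  "ip a b = Re (\<phi> (adj b o\<^sub>L a))"

lemma ip_commute: "a \<in> M \<Longrightarrow> b \<in> M \<Longrightarrow> ip a b = ip b a"
  using phi_adj[of "adj b o\<^sub>L a"] by (simp add: ip_def adj_compose)

lemma ip_linear:
  assumes "a \<in> M" "b \<in> M" "c \<in> M"
  shows "ip (a + b) c = ip a c + ip b c" "ip c (a + b) = ip c a + ip c b"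
    "ip (a - b) c = ip a c - ip b c" "ip c (a - b) = ip c a - ip c b"
    "ip (r *\<^sub>R a) c = r * ip a c" "ip c (r *\<^sub>R a) = r * ip c a"
  using assms by (simp_all add: ip_def compose_bilinear adj_add adj_diff adj_scaleR phi_add phi_diff
      phi_scaleR)

lemma gns_norm_ip: "a \<in> M \<Longrightarrow> (gns_norm \<phi> a)\<^sup>2 = ip a a"
  by (simp add: ip_def gns_norm_square)

lemma ip_Cauchy_Schwarz:
  assumes "a \<in> M" "b \<in> M" shows "\<bar>ip a b\<bar> \<le> gns_norm \<phi> a * gns_norm \<phi> b"
proof (cases "gns_norm \<phi> b = 0")
  case True
  then have "b = 0" using assms gns_norm_eq_0 by blast
  then have "ip a b = 0" using ip_linear(6)[of b a a 0] assms by simp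
  then show ?thesis using assms by simp
next
  case False
  define t where "t = ip a b / ip b b"
  have bb: "0 < ip b b" using False assms gns_norm_ip[of b] by (metis zero_less_power2)
  have "0 \<le> ip (a - t *\<^sub>R b) (a - t *\<^sub>R b)"
    using assms by (metis gns_norm_ip zero_le_power2 diff_mem scaleR_mem)
  also have "\<dots> = ip a a - 2 * t * ip a b + t * t * ip b b"
    using assms ip_commute[of b a] by (simp add: ip_linear algebra_simps)
  also have "\<dots> = ip a a - (ip a b)\<^sup>2 / ip b b"
    using bb by (simp add: t_def power2_eq_square field_simps)
  finally have "(ip a b)\<^sup>2 \<le> ip a a * ip b b"
    using bb by (simp add: field_simps)
  then have "\<bar>ip a b\<bar>\<^sup>2 \<le> (gns_norm \<phi> a * gns_norm \<phi> b)\<^sup>2"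
    using assms by (simp add: power_mult_distrib gns_norm_ip)
  then show ?thesis
    using assms by (intro power2_le_imp_le[of "\<bar>ip a b\<bar>"]) auto
qed

lemma gns_norm_triangle:
  assumes "a \<in> M" "b \<in> M" shows "gns_norm \<phi> (a + b) \<le> gns_norm \<phi> a + gns_norm \<phi> b"
proof (rule power2_le_imp_le)
  have "(gns_norm \<phi> (a + b))\<^sup>2 = ip a a + 2 * ip a b + ip b b"
    using assms ip_commute[of b a] by (simp add: gns_norm_ip ip_linear)
  also have "\<dots> \<le> (gns_norm \<phi> a + gns_norm \<phi> b)\<^sup>2"
    using ip_Cauchy_Schwarz[OF assms] assms
    by (simp add: power2_sum gns_norm_ip)
  finally show "(gns_norm \<phi> (a + b))\<^sup>2 \<le> (gns_norm \<phi> a + gns_norm \<phi> b)\<^sup>2" .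
qed (use assms in simp)

lemma gns_norm_scaleR: "a \<in> M \<Longrightarrow> gns_norm \<phi> (r *\<^sub>R a) = \<bar>r\<bar> * gns_norm \<phi> a"
  by (simp add: gns_norm_def adj_scaleR compose_bilinear phi_scaleR real_sqrt_mult
      flip: real_sqrt_abs power2_eq_square mult.assoc)

lemma gns_norm_diff_commute: "a \<in> M \<Longrightarrow> b \<in> M \<Longrightarrow> gns_norm \<phi> (a - b) = gns_norm \<phi> (b - a)"
  using gns_norm_scaleR[of "b - a" "-1"] by simp

lemma gns_norm_diff_triangle:
  "a \<in> M \<Longrightarrow> b \<in> M \<Longrightarrow> c \<in> M \<Longrightarrow> gns_norm \<phi> (a - c) \<le> gns_norm \<phi> (a - b) + gns_norm \<phi> (b - c)"
  using gns_norm_triangle[of "a - b" "b - c"] by simp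

lemma gns_norm_parallelogram:
  assumes "a \<in> M" "b \<in> M"
  shows "(gns_norm \<phi> (a - b))\<^sup>2 =
    2 * (gns_norm \<phi> a)\<^sup>2 + 2 * (gns_norm \<phi> b)\<^sup>2 - 4 * (gns_norm \<phi> ((1/2) *\<^sub>R a + (1/2) *\<^sub>R b))\<^sup>2"
  using assms ip_commute[of b a] by (simp add: gns_norm_ip ip_linear field_simps)

lemma gns_norm_scalar:
  assumes "a \<in> M" shows "gns_norm \<phi> (scalar_op c o\<^sub>L a) = cmod c * gns_norm \<phi> a"
proof -
  have "adj (scalar_op c o\<^sub>L a) o\<^sub>L (scalar_op c o\<^sub>L a) = adj a o\<^sub>L (scalar_op (cnj c * c) o\<^sub>L a)"
    using assms by (simp add: adj_compose compose_assoc scalar_op_mult)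
  also have "cnj c * c = complex_of_real ((cmod c)\<^sup>2)"
    by (metis complex_norm_square mult.commute)
  also have "adj a o\<^sub>L (scalar_op (complex_of_real ((cmod c)\<^sup>2)) o\<^sub>L a) = (cmod c)\<^sup>2 *\<^sub>R (adj a o\<^sub>L a)"
    by (simp only: scalar_op_of_real compose_bilinear)
  finally show ?thesis
    using assms by (simp add: gns_norm_def phi_scaleR real_sqrt_mult)
qed

lemma phi_Cauchy_Schwarz:
  assumes "a \<in> M" "b \<in> M" shows "cmod (\<phi> (adj b o\<^sub>L a)) \<le> gns_norm \<phi> a * gns_norm \<phi> b"
proof (cases "\<phi> (adj b o\<^sub>L a) = 0")
  case False
  define z where "z = \<phi> (adj b o\<^sub>L a)"
  \<comment> \<open>A phase with w z = |z|, so that the real Cauchy-Schwarz inequality applies to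
    the rotated a.\<close>
  define w where "w = cnj z / complex_of_real (cmod z)"
  have w: "cmod w = 1" using False by (simp add: w_def z_def norm_divide)
  have wz: "w * z = complex_of_real (cmod z)"
    using False by (simp add: w_def z_def mult.commute[of "cnj _"] power2_eq_square
        flip: complex_norm_square)
  have "adj b o\<^sub>L (scalar_op w o\<^sub>L a) = scalar_op w o\<^sub>L (adj b o\<^sub>L a)"
    using assms scalar_op_commute[of "adj b" w] by (metis adj_bounded_ops bdd compose_assoc)
  then have "cmod z = ip (scalar_op w o\<^sub>L a) b"
    using assms wz by (simp add: ip_def phi_scalar flip: z_def)
  also have "\<dots> \<le> gns_norm \<phi> (scalar_op w o\<^sub>L a) * gns_norm \<phi> b"
    using ip_Cauchy_Schwarz[of "scalar_op w o\<^sub>L a" b] assms by auto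
  finally show ?thesis
    using assms w by (simp add: gns_norm_scalar flip: z_def)
qed (use assms in simp)

text \<open>With s a square root of 1 - r b, the squared trace norm of s y is the real part of
  \<phi>(y' y) - r \<phi>(y' b y), where y' is the adjoint of y. The factor r < 1 provides the
  strict norm bound that square roots need; finally r tends to 1.\<close>

lemma phi_conj_le:
  assumes b: "b \<in> M" "adj b = b" "norm b \<le> 1" and y: "y \<in> M"
  shows "Re (\<phi> (adj y o\<^sub>L (b o\<^sub>L y))) \<le> Re (\<phi> (adj y o\<^sub>L y))"
proof (rule field_le_mult_one_interval)
  fix r :: real assume r: "0 < r" "r < 1"
  have "norm (r *\<^sub>R b) \<le> r" using b(3) r mult_left_le[of "norm b" r] by simp
  then have "norm (r *\<^sub>R b) < 1" using r by linarith
  then obtain s where s: "s \<in> M" "adj s = s" "s o\<^sub>L s = id_blinfun - r *\<^sub>R b"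
    using sqrt_exists[of "r *\<^sub>R b"] b by (auto simp: adj_scaleR)
  have "adj (s o\<^sub>L y) o\<^sub>L (s o\<^sub>L y) = adj y o\<^sub>L ((s o\<^sub>L s) o\<^sub>L y)"
    using s(1,2) y by (simp add: adj_compose compose_assoc)
  also have "\<dots> = (adj y o\<^sub>L y) - r *\<^sub>R (adj y o\<^sub>L (b o\<^sub>L y))"
    by (simp add: s compose_bilinear)
  finally have "\<phi> (adj (s o\<^sub>L y) o\<^sub>L (s o\<^sub>L y)) = \<phi> (adj y o\<^sub>L y) - r * \<phi> (adj y o\<^sub>L (b o\<^sub>L y))"
    using y b by (simp add: phi_diff phi_scaleR)
  then show "r * Re (\<phi> (adj y o\<^sub>L (b o\<^sub>L y))) \<le> Re (\<phi> (adj y o\<^sub>L y))"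
    using Re_phi_pos[of "s o\<^sub>L y"] s y by simp
qed

lemma gns_norm_compose_le_1:
  assumes "a \<in> M" "norm a \<le> 1" "y \<in> M"
  shows "gns_norm \<phi> (a o\<^sub>L y) \<le> gns_norm \<phi> y"
proof -
  have n: "norm (adj a o\<^sub>L a) \<le> 1"
    using assms by (intro norm_compose_le_one) auto
  have "adj (a o\<^sub>L y) o\<^sub>L (a o\<^sub>L y) = adj y o\<^sub>L ((adj a o\<^sub>L a) o\<^sub>L y)"
    using assms by (simp add: adj_compose compose_assoc)
  then show ?thesis
    using phi_conj_le[of "adj a o\<^sub>L a" y] assms n
    by (simp add: gns_norm_def adj_compose)
qed

lemma gns_norm_compose_left:
  assumes "a \<in> M" "y \<in> M" shows "gns_norm \<phi> (a o\<^sub>L y) \<le> norm a * gns_norm \<phi> y"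
proof (cases "a = 0")
  case False
  have "gns_norm \<phi> (((1 / norm a) *\<^sub>R a) o\<^sub>L y) \<le> gns_norm \<phi> y"
    using assms False by (intro gns_norm_compose_le_1) auto
  then show ?thesis
    using assms False by (simp add: compose_bilinear gns_norm_scaleR field_simps)
next
  case True
  have "gns_norm \<phi> 0 = 0" using gns_norm_scaleR[of 0 0] by simp
  with True show ?thesis by simp
qed

lemma gns_norm_adj: "a \<in> M \<Longrightarrow> gns_norm \<phi> (adj a) = gns_norm \<phi> a"
  by (simp add: gns_norm_def phi_commute[of a "adj a"])

text \<open>Adjoints exchange left and right factors and, by the trace property, preserve the norm.
  For a state that is not tracial this bound fails in general.\<close>

lemma gns_norm_compose_right:
  assumes "a \<in> M" "y \<in> M" shows "gns_norm \<phi> (y o\<^sub>L a) \<le> gns_norm \<phi> y * norm a"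
  using gns_norm_compose_left[of "adj a" "adj y"] assms gns_norm_adj[of "y o\<^sub>L a"]
  by (simp add: adj_compose gns_norm_adj mult.commute)

lemma gns_norm_le_norm: "a \<in> M \<Longrightarrow> gns_norm \<phi> a \<le> norm a"
  using gns_norm_compose_left[of a id_blinfun] by simp

lemma phi_le_gns_norm: "a \<in> M \<Longrightarrow> cmod (\<phi> a) \<le> gns_norm \<phi> a"
  using phi_Cauchy_Schwarz[of a id_blinfun] by simp

lemma phi_le_norm: "a \<in> M \<Longrightarrow> cmod (\<phi> a) \<le> norm a"
  using phi_le_gns_norm gns_norm_le_norm order_trans by blast

text \<open>For 0 <= a <= 1 the norm of 1 - a is at most 1, and a state is contractive.
  \<open>phi_pos\<close> does not apply directly, because a will be a difference of two squares with
  no root at hand.\<close>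

lemma phi_positive:
  assumes a: "a \<in> M" "adj a = a"
    and pos: "\<And>v. 0 \<le> inner (blinfun_apply a v) v"
    and le: "\<And>v. inner (blinfun_apply a v) v \<le> (norm v)\<^sup>2"
  shows "0 \<le> Re (\<phi> a)"
proof -
  have "norm (id_blinfun - a) \<le> 1"
    using a pos le by (intro norm_le_one_of_positive)
      (auto simp: adj_diff minus_blinfun.rep_eq inner_diff_left dot_square_norm)
  then have "Re (\<phi> (id_blinfun - a)) \<le> 1"
    using phi_le_norm[of "id_blinfun - a"] complex_Re_le_cmod[of "\<phi> (id_blinfun - a)"] a by auto
  then show ?thesis using a by (simp add: phi_diff)
qed

end

section \<open>Weak cluster points and completeness in the trace norm\<close>

text \<open>Tychonoff's theorem for matrix coefficients: they live in a product of compact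
  intervals, and the Riesz theorem turns a cluster point into an operator. The limit runs along a
  filter \<open>F\<close> instead of a subsequence, as the Hilbert space is not assumed
  separable.\<close>

lemma weak_cluster_point:
  fixes X :: "nat \<Rightarrow> 'h::chilbert_space op"
  assumes X: "\<And>n. X n \<in> bounded_ops" "\<And>n. norm (X n) \<le> C"
  obtains F x where "F \<noteq> bot" "F \<le> sequentially" "x \<in> bounded_ops"
    "\<And>v w. ((\<lambda>n. inner (blinfun_apply (X n) v) w) \<longlongrightarrow> inner (blinfun_apply x v) w) F"
proof -
  define G where "G n = (\<lambda>p::'h \<times> 'h. inner (blinfun_apply (X n) (fst p)) (snd p))" for n
  define K where "K = Pi\<^sub>E UNIV (\<lambda>p::'h \<times> 'h. cball (0::real) (C * norm (fst p) * norm (snd p)))"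
  have "compactin (product_topology (\<lambda>_. euclidean) UNIV) K"
    unfolding K_def compactin_PiE by (simp add: compactin_euclidean_iff)
  then have "compact K"
    by (simp add: euclidean_product_topology compactin_euclidean_iff)
  have GK: "G n \<in> K" for n
  proof -
    have "\<bar>inner (blinfun_apply (X n) v) w\<bar> \<le> C * norm v * norm w" for v w
    proof -
      have "norm (blinfun_apply (X n) v) \<le> C * norm v"
        using norm_blinfun[of "X n" v] mult_right_mono[OF X(2)[of n] norm_ge_zero[of v]] by linarith
      then show ?thesis
        using Cauchy_Schwarz_ineq2[of "blinfun_apply (X n) v" w]
          mult_right_mono[OF _ norm_ge_zero[of w]] by fastforce
    qed
    then show ?thesis by (simp add: K_def G_def PiE_iff extensional_UNIV)
  qed
  obtain B where B: "B \<in> K" "inf (nhds B) (filtermap G sequentially) \<noteq> bot"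
    using \<open>compact K\<close>[unfolded compact_filter, rule_format, of "filtermap G sequentially"] GK
    by (auto simp: filtermap_bot_iff eventually_filtermap)
  \<comment> \<open>Neighbourhoods of the cluster point are pulled back to indices and combined with
    tails; the cluster property says precisely that this filter is proper.\<close>
  define F where "F = inf (filtercomap G (nhds B)) sequentially"
  have "F \<noteq> bot"
  proof
    assume "F = bot"
    then have "eventually (\<lambda>_. False) (inf (filtercomap G (nhds B)) sequentially)"
      by (simp add: F_def)
    then obtain P Q where PQ: "eventually P (filtercomap G (nhds B))" "eventually Q sequentially"
      "\<And>n. P n \<Longrightarrow> Q n \<Longrightarrow> False"
      by (auto simp: eventually_inf)
    then obtain P' where P': "eventually P' (nhds B)" "\<And>n. P' (G n) \<Longrightarrow> P n"
      by (auto simp: eventually_filtercomap)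
    have "eventually (\<lambda>y. \<not> P' y) (filtermap G sequentially)"
      unfolding eventually_filtermap by (rule eventually_mono[OF PQ(2)]) (use PQ(3) P'(2) in blast)
    then have "eventually (\<lambda>_. False) (inf (nhds B) (filtermap G sequentially))"
      unfolding eventually_inf using P'(1) by blast
    with B(2) show False by (simp add: eventually_False)
  qed
  have "filterlim G (nhds B) F"
    unfolding filterlim_def filtermap_le_iff_le_filtercomap F_def by simp
  then have "((\<lambda>n. G n p) \<longlongrightarrow> B p) F" for p
    by (rule continuous_on_tendsto_compose[OF continuous_on_product_coordinates[of p]]) auto
  then have lim: "((\<lambda>n. inner (blinfun_apply (X n) v) w) \<longlongrightarrow> B (v, w)) F" for v w
    by (force simp: G_def)
  note unique = tendsto_unique[OF \<open>F \<noteq> bot\<close>]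
  have bound: "\<bar>B (v, w)\<bar> \<le> C * norm v * norm w" for v w
    using B(1) by (auto simp: K_def PiE_iff dest!: spec[of _ "(v, w)"])
  have "bounded_linear (\<lambda>w. B (v, w))" for v
  proof
    show "B (v, a + b) = B (v, a) + B (v, b)" for a b
      by (rule unique[OF lim]) (unfold inner_add_right, intro tendsto_add lim)
    show "B (v, r *\<^sub>R a) = r *\<^sub>R B (v, a)" for r a
      by (rule unique[OF lim]) (unfold inner_scaleR_right real_scaleR_def, intro tendsto_mult_left lim)
    show "\<exists>K. \<forall>w. norm (B (v, w)) \<le> norm w * K"
      using bound[of v] by (intro exI[of _ "C * norm v"]) (simp add: mult.commute)
  qed
  then have "\<forall>v. \<exists>z. \<forall>w. B (v, w) = inner z w"
    using riesz_representation by blast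
  from choice[OF this] obtain g where g0: "\<forall>v w. B (v, w) = inner (g v) w"
    by (rule exE)
  have g: "B (v, w) = inner (g v) w" for v w
    by (rule g0[rule_format])
  have eqI: "a = b" if "\<And>w. inner a w = inner b w" for a b :: 'h
    using that vector_eq_rdot by blast
  note lim = lim[unfolded g]
  have "bounded_linear g"
  proof
    show "g (a + b) = g a + g b" for a b
      by (rule eqI, rule unique[OF lim])
        (unfold inner_add_left blinfun.add_right, intro tendsto_add lim)
    show "g (r *\<^sub>R a) = r *\<^sub>R g a" for r a
      by (rule eqI, rule unique[OF lim])
        (unfold inner_scaleR_left blinfun.scaleR_right, intro tendsto_mult_left lim)
    show "\<exists>K. \<forall>v. norm (g v) \<le> norm v * K"
    proof (intro exI allI)
      fix v
      have "norm (g v) * norm (g v) \<le> (C * norm v) * norm (g v)"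
        using bound[of v "g v"] by (simp add: g dot_square_norm power2_eq_square)
      moreover have "0 \<le> C" using X(2)[of 0] norm_ge_zero order_trans by blast
      ultimately show "norm (g v) \<le> norm v * C"
        by (cases "g v = 0") (auto simp: mult.commute)
    qed
  qed
  then have app: "blinfun_apply (Blinfun g) = g"
    by (rule bounded_linear_Blinfun_apply)
  have "g (\<i> *\<^sub>C v) = \<i> *\<^sub>C g v" for v
    by (rule eqI, rule unique[OF lim])
      (unfold inner_scaleC_i bounded_ops_scaleC[OF X(1)], intro tendsto_minus lim)
  then have "Blinfun g \<in> bounded_ops" by (simp add: bounded_ops_iff_i app)
  moreover have "F \<le> sequentially" by (simp add: F_def)
  ultimately show thesis
    using that[of F "Blinfun g"] lim \<open>F \<noteq> bot\<close> by (simp add: app)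
qed

text \<open>An operator s in the commutant can be moved to the other side of the inner product as
  \<open>adj s\<close>, so commutation with s survives weak limits; the bicommutant property does
  the rest.\<close>

lemma (in vn_algebra) weak_limit_mem:
  assumes "F \<noteq> bot" "x \<in> bounded_ops" "\<And>n. X n \<in> M"
    and lim: "\<And>v w. ((\<lambda>n. inner (blinfun_apply (X n) v) w) \<longlongrightarrow> inner (blinfun_apply x v) w) F"
  shows "x \<in> M"
proof -
  have "x o\<^sub>L s = s o\<^sub>L x" if s: "s \<in> commutant M" for s
  proof (rule blinfun_eqI)
    fix v
    have sb: "s \<in> bounded_ops" using s by (rule commutant_bounded_ops)
    have eq: "inner (blinfun_apply (x o\<^sub>L s) v) w = inner (blinfun_apply (s o\<^sub>L x) v) w" for w
    proof (rule tendsto_unique[OF assms(1)])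
      show "((\<lambda>n. inner (blinfun_apply (X n o\<^sub>L s) v) w) \<longlongrightarrow> inner (blinfun_apply (x o\<^sub>L s) v) w) F"
        using lim[of "blinfun_apply s v" w] by simp
      have "inner (blinfun_apply (X n o\<^sub>L s) v) w = inner (blinfun_apply (X n) v) (blinfun_apply (adj s) w)" for n
        using commutantD[OF s assms(3)[of n]] inner_adj[OF sb] by (metis blinfun_apply_blinfun_compose)
      moreover have "inner (blinfun_apply (s o\<^sub>L x) v) w = inner (blinfun_apply x v) (blinfun_apply (adj s) w)"
        using inner_adj[OF sb] by simp
      ultimately show "((\<lambda>n. inner (blinfun_apply (X n o\<^sub>L s) v) w) \<longlongrightarrow> inner (blinfun_apply (s o\<^sub>L x) v) w) F"
        using lim[of v "blinfun_apply (adj s) w"] by simp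
    qed
    show "blinfun_apply (x o\<^sub>L s) v = blinfun_apply (s o\<^sub>L x) v"
      using eq vector_eq_rdot by blast
  qed
  then have "x \<in> commutant (commutant M)"
    using assms(2) unfolding commutant_def by blast
  then show ?thesis by (simp add: bicommutant)
qed

section \<open>Normal traces: weak continuity on bounded sets and completeness\<close>

locale normal_tracial_state = tracial_state M \<phi>
  for M :: "'h::chilbert_space op set" and \<phi> +
  assumes normal: "\<phi> \<in> predual M"
begin

text \<open>Each term of the series that represents \<phi> converges, and boundedness supplies the
  domination for Tannery's theorem. The left factor y is there for inner products with a fixed
  element.\<close>

lemma phi_weak_limit:
  assumes F: "F \<noteq> bot" and x: "x \<in> M" and X: "\<And>n. X n \<in> M" "\<And>n. norm (X n) \<le> C" and y: "y \<in> M"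
    and lim: "\<And>v w. ((\<lambda>n. inner (blinfun_apply (X n) v) w) \<longlongrightarrow> inner (blinfun_apply x v) w) F"
  shows "((\<lambda>n. \<phi> (y o\<^sub>L X n)) \<longlongrightarrow> \<phi> (y o\<^sub>L x)) F"
proof -
  obtain \<xi> \<eta> where sm: "summable (\<lambda>k. (norm (\<xi> k))\<^sup>2)" "summable (\<lambda>k. (norm (\<eta> k))\<^sup>2)"
    and \<phi>: "\<And>x. x \<in> M \<Longrightarrow> \<phi> x = (\<Sum>k. cinner (blinfun_apply x (\<xi> k)) (\<eta> k))"
    using normal unfolding predual_def by blast
  have C: "0 \<le> C" using X(2)[of undefined] norm_ge_zero order_trans by blast
  \<comment> \<open>The factor 2 from estimating a modulus by real plus imaginary part is absorbed
    by 2 a b <= a^2 + b^2.\<close>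
  define B where "B k = norm y * C * ((norm (\<xi> k))\<^sup>2 + (norm (\<eta> k))\<^sup>2)" for k
  have cmod: "cmod (cinner v w) \<le> 2 * (norm v * norm w)" for v w :: 'h
  proof -
    have "cmod (cinner v w) \<le> \<bar>inner v w\<bar> + \<bar>inner v (\<i> *\<^sub>C w)\<bar>"
      using cmod_le[of "cinner v w"] by (simp add: Im_cinner Re_cinner)
    also have "\<dots> \<le> norm v * norm w + norm v * norm (\<i> *\<^sub>C w)"
      by (intro add_mono Cauchy_Schwarz_ineq2)
    finally show ?thesis by (simp add: norm_scaleC)
  qed
  have bound: "cmod (cinner (blinfun_apply (y o\<^sub>L X n) (\<xi> k)) (\<eta> k)) \<le> B k" for k n
  proof -
    have "norm (y o\<^sub>L X n) \<le> norm y * C"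
      using norm_blinfun_compose[of y "X n"] mult_left_mono[OF X(2)[of n] norm_ge_zero[of y]] by linarith
    then have "norm (blinfun_apply (y o\<^sub>L X n) (\<xi> k)) \<le> (norm y * C) * norm (\<xi> k)"
      by (intro order_trans[OF norm_blinfun] mult_right_mono) auto
    then have "norm (blinfun_apply (y o\<^sub>L X n) (\<xi> k)) * norm (\<eta> k) \<le> (norm y * C) * norm (\<xi> k) * norm (\<eta> k)"
      by (intro mult_right_mono) auto
    then have "cmod (cinner (blinfun_apply (y o\<^sub>L X n) (\<xi> k)) (\<eta> k)) \<le> (norm y * C) * (2 * norm (\<xi> k) * norm (\<eta> k))"
      using cmod[of "blinfun_apply (y o\<^sub>L X n) (\<xi> k)" "\<eta> k"] by simp
    also have "\<dots> \<le> B k"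
      unfolding B_def using C by (intro mult_left_mono sum_squares_bound) auto
    finally show ?thesis .
  qed
  have lim_term: "((\<lambda>n. cinner (blinfun_apply (y o\<^sub>L X n) (\<xi> k)) (\<eta> k))
      \<longlongrightarrow> cinner (blinfun_apply (y o\<^sub>L x) (\<xi> k)) (\<eta> k)) F" for k
    using lim y by (simp add: cinner_eq_Complex inner_adj[OF bdd] tendsto_Complex)
  have "((\<lambda>n. \<Sum>k. cinner (blinfun_apply (y o\<^sub>L X n) (\<xi> k)) (\<eta> k))
      \<longlongrightarrow> (\<Sum>k. cinner (blinfun_apply (y o\<^sub>L x) (\<xi> k)) (\<eta> k))) F"
  proof (rule tannerys_theorem[THEN conjunct2, THEN conjunct2])
    show "\<forall>\<^sub>F (k, n) in sequentially \<times>\<^sub>F F. norm (cinner (blinfun_apply (y o\<^sub>L X n) (\<xi> k)) (\<eta> k)) \<le> B k"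
      using bound by (intro always_eventually) auto
    show "summable B"
      unfolding B_def by (intro summable_mult summable_add sm)
  qed (use lim_term F in auto)
  then show ?thesis using X(1) x y by (simp add: \<phi>)
qed

text \<open>The weak cluster point is the limit: the distance to it is computed by pairing X n - X m
  with b = X n - x and letting m run along the filter. The last clause, semicontinuity of vector
  norms under weak limits, later bounds the limit of the products by each of them.\<close>

lemma bounded_Cauchy_convergent:
  assumes X: "\<And>n. X n \<in> M" "\<And>n. norm (X n) \<le> C"
    and Cauchy: "\<And>e. 0 < e \<Longrightarrow> \<exists>n0. \<forall>m\<ge>n0. \<forall>n\<ge>n0. gns_norm \<phi> (X m - X n) < e"
  obtains x where "x \<in> M" "(\<lambda>n. gns_norm \<phi> (X n - x)) \<longlonglongrightarrow> 0"
    "\<And>v c n0. (\<And>n. n0 \<le> n \<Longrightarrow> norm (blinfun_apply (X n) v) \<le> c) \<Longrightarrow> norm (blinfun_apply x v) \<le> c"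
proof -
  obtain F x where F: "F \<noteq> bot" "F \<le> sequentially" "x \<in> bounded_ops"
    and lim: "\<And>v w. ((\<lambda>n. inner (blinfun_apply (X n) v) w) \<longlongrightarrow> inner (blinfun_apply x v) w) F"
    using weak_cluster_point[of X C] X by auto
  have x: "x \<in> M" using weak_limit_mem[OF F(1,3) X(1) lim] .
  have ev: "eventually (\<lambda>n. n0 \<le> n) F" for n0
    using F(2) eventually_ge_at_top filter_leD by blast
  have "norm (blinfun_apply x v) \<le> c" if c: "\<And>n. n0 \<le> n \<Longrightarrow> norm (blinfun_apply (X n) v) \<le> c" for v c n0
  proof -
    have c0: "0 \<le> c" using c[of n0] norm_ge_zero order_trans by blast
    have "inner (blinfun_apply x v) (blinfun_apply x v) \<le> c * norm (blinfun_apply x v)"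
    proof (rule tendsto_upperbound[OF lim _ F(1)])
      show "\<forall>\<^sub>F n in F. inner (blinfun_apply (X n) v) (blinfun_apply x v) \<le> c * norm (blinfun_apply x v)"
      proof (rule eventually_mono[OF ev[of n0]])
        fix n assume "n0 \<le> n"
        then show "inner (blinfun_apply (X n) v) (blinfun_apply x v) \<le> c * norm (blinfun_apply x v)"
          by (intro order_trans[OF norm_cauchy_schwarz] mult_right_mono c) auto
      qed
    qed
    then show ?thesis
      using c0 by (cases "blinfun_apply x v = 0") (auto simp: dot_square_norm power2_eq_square)
  qed
  moreover have "(\<lambda>n. gns_norm \<phi> (X n - x)) \<longlonglongrightarrow> 0"
  proof (rule LIMSEQ_I)
    fix r :: real assume r: "0 < r"
    then obtain n0 where n0: "\<And>m n. n0 \<le> m \<Longrightarrow> n0 \<le> n \<Longrightarrow> gns_norm \<phi> (X m - X n) < r / 2"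
      using Cauchy[of "r/2"] by auto
    have "gns_norm \<phi> (X n - x) \<le> r / 2" if n: "n0 \<le> n" for n
    proof -
      define b where "b = X n - x"
      have b: "b \<in> M" using X x by (simp add: b_def)
      have "((\<lambda>m. \<phi> (adj b o\<^sub>L X n) - \<phi> (adj b o\<^sub>L X m)) \<longlongrightarrow> \<phi> (adj b o\<^sub>L X n) - \<phi> (adj b o\<^sub>L x)) F"
        using b by (intro tendsto_intros phi_weak_limit[OF F(1) x X _ lim]) auto
      then have "((\<lambda>m. cmod (\<phi> (adj b o\<^sub>L (X n - X m)))) \<longlongrightarrow> cmod (\<phi> (adj b o\<^sub>L b))) F"
        using b X x by (intro tendsto_norm) (simp add: compose_bilinear phi_diff b_def)
      moreover have "\<forall>\<^sub>F m in F. cmod (\<phi> (adj b o\<^sub>L (X n - X m))) \<le> (r / 2) * gns_norm \<phi> b"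
      proof (rule eventually_mono[OF ev[of n0]])
        fix m assume "n0 \<le> m"
        then have "gns_norm \<phi> (X n - X m) * gns_norm \<phi> b \<le> (r / 2) * gns_norm \<phi> b"
          using n n0[of n m] b by (intro mult_right_mono) auto
        then show "cmod (\<phi> (adj b o\<^sub>L (X n - X m))) \<le> (r / 2) * gns_norm \<phi> b"
          using phi_Cauchy_Schwarz[of "X n - X m" b] b X by fastforce
      qed
      ultimately have "cmod (\<phi> (adj b o\<^sub>L b)) \<le> (r / 2) * gns_norm \<phi> b"
        using F(1) tendsto_upperbound by blast
      then have "(gns_norm \<phi> b)\<^sup>2 \<le> (r / 2) * gns_norm \<phi> b"
        using gns_norm_square[OF b] complex_Re_le_cmod[of "\<phi> (adj b o\<^sub>L b)"] by linarith
      then show ?thesis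
        using r gns_norm_nonneg[OF b] unfolding b_def[symmetric]
        by (cases "gns_norm \<phi> b = 0") (auto simp: power2_eq_square)
    qed
    then show "\<exists>n0. \<forall>n\<ge>n0. norm (gns_norm \<phi> (X n - x) - 0) < r"
      using r X x by (intro exI[of _ n0]) fastforce
  qed
  ultimately show thesis using that x by blast
qed

end

section \<open>Averaging over the unitary group\<close>

text \<open>The convex hull of the unitary orbit of x, without closure. Generating it inductively
  makes each invariant an induction over conjugations and two-term combinations, without weighted
  finite sums.\<close>

inductive_set unitary_hull :: "'h::chilbert_space op set \<Rightarrow> 'h op \<Rightarrow> 'h op set" for M x where
  base: "x \<in> unitary_hull M x"
| conj: "y \<in> unitary_hull M x \<Longrightarrow> unitary_in M u \<Longrightarrow> u o\<^sub>L (y o\<^sub>L adj u) \<in> unitary_hull M x"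
| convex: "y \<in> unitary_hull M x \<Longrightarrow> z \<in> unitary_hull M x \<Longrightarrow> 0 \<le> r \<Longrightarrow> r \<le> 1 \<Longrightarrow>
    r *\<^sub>R y + (1 - r) *\<^sub>R z \<in> unitary_hull M x"

lemma unitary_hull_trans: "z \<in> unitary_hull M y \<Longrightarrow> y \<in> unitary_hull M x \<Longrightarrow> z \<in> unitary_hull M x"
  by (induction rule: unitary_hull.induct) (auto intro: unitary_hull.intros)

lemma norm_le_one_of_isometry:
  assumes "u \<in> bounded_ops" "adj u o\<^sub>L u = id_blinfun" shows "norm u \<le> 1"
proof (rule norm_blinfun_bound)
  fix v
  have "(norm (blinfun_apply u v))\<^sup>2 = (norm v)\<^sup>2"
    using assms by (simp only: norm_apply_square) (simp add: dot_square_norm)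
  then show "norm (blinfun_apply u v) \<le> 1 * norm v" by simp
qed simp

context vn_algebra begin

lemma unitary_inD:
  assumes "unitary_in M u"
  shows "u \<in> M" "adj u \<in> M" "adj u o\<^sub>L u = id_blinfun" "u o\<^sub>L adj u = id_blinfun"
    "norm u \<le> 1" "norm (adj u) \<le> 1"
  using assms norm_le_one_of_isometry[of u] by (auto simp: unitary_in_def)

lemma unitary_in_adj: "unitary_in M u \<Longrightarrow> unitary_in M (adj u)"
  by (auto simp: unitary_in_def)

lemma unitary_hull_mem: "y \<in> unitary_hull M x \<Longrightarrow> x \<in> M \<Longrightarrow> y \<in> M"
  by (induction rule: unitary_hull.induct) (auto simp: unitary_in_def)

lemma norm_unitary_conj:
  assumes "unitary_in M u" shows "norm (u o\<^sub>L (y o\<^sub>L adj u)) \<le> norm y"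
proof -
  have "norm (u o\<^sub>L (y o\<^sub>L adj u)) \<le> norm u * (norm y * norm (adj u))"
    by (intro order_trans[OF norm_blinfun_compose] mult_left_mono norm_blinfun_compose) simp
  also have "\<dots> \<le> 1 * (norm y * 1)"
    using unitary_inD[OF assms] by (intro mult_mono) auto
  finally show ?thesis by simp
qed

lemma unitary_hull_norm: "y \<in> unitary_hull M x \<Longrightarrow> x \<in> M \<Longrightarrow> norm y \<le> norm x"
proof (induction rule: unitary_hull.induct)
  case (conj y u)
  then show ?case using norm_unitary_conj order_trans by blast
next
  case (convex y z r)
  have "norm (r *\<^sub>R y + (1 - r) *\<^sub>R z) \<le> r * norm y + (1 - r) * norm z"
    using norm_triangle_ineq[of "r *\<^sub>R y" "(1 - r) *\<^sub>R z"] convex by simp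
  also have "\<dots> \<le> r * norm x + (1 - r) * norm x"
    using convex by (intro add_mono mult_left_mono) auto
  finally show ?case by (simp add: algebra_simps)
qed simp

lemma unitary_hull_selfadjoint:
  "y \<in> unitary_hull M x \<Longrightarrow> x \<in> M \<Longrightarrow> adj x = x \<Longrightarrow> adj y = y"
proof (induction rule: unitary_hull.induct)
  case (conj y u)
  then show ?case
    using unitary_inD[OF conj(2)] unitary_hull_mem[OF conj(1)] by (simp add: adj_compose compose_assoc)
next
  case (convex y z r)
  then show ?case
    using unitary_hull_mem[of y x] unitary_hull_mem[of z x] by (simp add: adj_add adj_scaleR)
qed simp

lemma selfadjoint_parts:
  assumes "a \<in> M"
  obtains p q where "p \<in> M" "q \<in> M" "adj p = p" "adj q = q" "a = p + (scalar_op \<i> o\<^sub>L q)"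
proof -
  \<comment> \<open>Half of -b is (a - adj a)/(2 i), the imaginary part of a.\<close>
  define b where "b = scalar_op \<i> o\<^sub>L (a - adj a)"
  have "adj b = (adj a - a) o\<^sub>L scalar_op (- \<i>)"
    using assms by (simp add: b_def adj_compose adj_diff)
  also have "\<dots> = b"
    using assms scalar_op_commute[of "a - adj a" \<i>]
    by (simp add: b_def scalar_op_minus compose_bilinear)
  finally have "adj b = b" .
  then have ab: "adj ((- 1/2) *\<^sub>R b) = (- 1/2) *\<^sub>R b"
    using assms by (simp only: adj_scaleR bdd b_def compose_mem diff_mem adj_mem scalar_mem)
  have bM: "(- 1/2) *\<^sub>R b \<in> M" and aM: "(1/2) *\<^sub>R (a + adj a) \<in> M"
    using assms by (auto simp: b_def)
  have aa: "adj ((1/2) *\<^sub>R (a + adj a)) = (1/2) *\<^sub>R (a + adj a)"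
    using assms by (simp add: adj_scaleR adj_add add.commute)
  have b: "scalar_op \<i> o\<^sub>L b = adj a - a"
    using scalar_op_of_real[of "-1" "a - adj a"] by (simp add: b_def flip: compose_assoc scalar_op_mult)
  have "(1/2) *\<^sub>R (a + adj a) + (- 1/2) *\<^sub>R (adj a - a) = (1/2) *\<^sub>R (a + a)"
    by (simp add: scaleR_add_right scaleR_diff_right)
  then have "a = (1/2) *\<^sub>R (a + adj a) + (scalar_op \<i> o\<^sub>L ((- 1/2) *\<^sub>R b))"
    by (simp only: blinfun_compose.scaleR_right b scaleR_half_double)
  then show thesis by (rule that[OF aM bM aa ab])
qed

text \<open>A selfadjoint contraction \<open>h\<close> is the real part of the unitary \<open>h + i \<surd>(1 - h\<^sup>2)\<close>.\<close>

lemma commutes_with_unitaries: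
  assumes c: "c \<in> bounded_ops" and comm: "\<And>u. unitary_in M u \<Longrightarrow> c o\<^sub>L u = u o\<^sub>L c"
  shows "c \<in> commutant M"
proof -
  have contr: "c o\<^sub>L h = h o\<^sub>L c" if h: "h \<in> M" "adj h = h" "norm h < 1" for h
  proof -
    have "norm (h o\<^sub>L h) \<le> norm h * norm h" by (rule norm_blinfun_compose)
    also have "\<dots> < 1"
      using h(3) mult_strict_mono[of "norm h" 1 "norm h" 1] by simp
    finally have "norm (h o\<^sub>L h) < 1" .
    moreover have "h o\<^sub>L h \<in> M" "adj (h o\<^sub>L h) = h o\<^sub>L h"
      using h by (simp_all add: adj_compose)
    ultimately obtain s where s: "s \<in> M" "adj s = s" "s o\<^sub>L s = id_blinfun - (h o\<^sub>L h)"
      and sc: "\<And>c. c o\<^sub>L (h o\<^sub>L h) = (h o\<^sub>L h) o\<^sub>L c \<Longrightarrow> c o\<^sub>L s = s o\<^sub>L c"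
      using sqrt_exists[of "h o\<^sub>L h"] by blast
    have hs: "h o\<^sub>L s = s o\<^sub>L h" by (rule sc) (simp add: compose_assoc)
    \<comment> \<open>With k = i s the operators h + k and h - k are adjoint to each other, and (h -
      k)(h + k) = h^2 - k^2 = 1 because h and s commute and k^2 = h^2 - 1. Their sum is 2 h.\<close>
    define k where "k = scalar_op \<i> o\<^sub>L s"
    have "adj k = s o\<^sub>L scalar_op (- \<i>)"
      using s(1,2) by (simp add: k_def adj_compose)
    then have k: "k \<in> M" "adj k = - k"
      using s(1) scalar_op_commute[of s \<i>] by (simp_all add: k_def scalar_op_minus compose_bilinear)
    have hk: "h o\<^sub>L k = k o\<^sub>L h"
      unfolding k_def using hs h s(1) by (metis bdd compose_assoc scalar_op_commute)
    have "k o\<^sub>L k = scalar_op (\<i> * \<i>) o\<^sub>L (s o\<^sub>L s)"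
      unfolding k_def scalar_op_mult using s(1) by (metis bdd compose_assoc scalar_op_commute)
    also have "\<dots> = (h o\<^sub>L h) - id_blinfun"
      using scalar_op_of_real[of "-1" "s o\<^sub>L s"] s(3) by simp
    finally have kk: "k o\<^sub>L k = (h o\<^sub>L h) - id_blinfun" .
    have ad: "adj (h + k) = h - k" using h k by (simp add: adj_add)
    have "unitary_in M (h + k)"
      unfolding unitary_in_def ad using h k by (simp add: compose_bilinear hk kk)
    note c1 = comm[OF this] comm[OF unitary_in_adj[OF this], unfolded ad]
    have "2 *\<^sub>R h = (h + k) + (h - k)" by (simp add: scaleR_2)
    then have "c o\<^sub>L (2 *\<^sub>R h) = (2 *\<^sub>R h) o\<^sub>L c"
      using c1 by (simp only: blinfun_compose.add_left blinfun_compose.add_right)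
    then show ?thesis by (simp add: compose_bilinear)
  qed
  have sa: "c o\<^sub>L h = h o\<^sub>L c" if h: "h \<in> M" "adj h = h" for h
  proof -
    define r where "r = 1 / (norm h + 1)"
    have r: "0 < r" by (simp add: r_def add_nonneg_pos)
    have "norm (r *\<^sub>R h) < 1" by (simp add: r_def add_nonneg_pos)
    then have "c o\<^sub>L (r *\<^sub>R h) = (r *\<^sub>R h) o\<^sub>L c"
      using h by (intro contr) (auto simp: adj_scaleR)
    then show ?thesis using r by (simp add: compose_bilinear)
  qed
  have "c o\<^sub>L a = a o\<^sub>L c" if a: "a \<in> M" for a
  proof -
    obtain p q where pq: "p \<in> M" "q \<in> M" "adj p = p" "adj q = q" and a_eq: "a = p + (scalar_op \<i> o\<^sub>L q)"
      using selfadjoint_parts[OF a] by blast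
    have "c o\<^sub>L (scalar_op \<i> o\<^sub>L q) = (scalar_op \<i> o\<^sub>L q) o\<^sub>L c"
      using sa[OF pq(2,4)] c by (metis compose_assoc scalar_op_commute)
    then show ?thesis
      unfolding a_eq using sa[OF pq(1,3)] by (simp only: blinfun_compose.add_left blinfun_compose.add_right)
  qed
  then show ?thesis using c by (simp add: commutant_def)
qed

end

context tracial_state begin

lemma phi_unitary_conj:
  assumes "unitary_in M u" "y \<in> M" shows "\<phi> (u o\<^sub>L (y o\<^sub>L adj u)) = \<phi> y"
proof -
  have "\<phi> (u o\<^sub>L (y o\<^sub>L adj u)) = \<phi> ((y o\<^sub>L adj u) o\<^sub>L u)"
    using assms unitary_inD by (intro phi_commute) auto
  then show ?thesis using unitary_inD[OF assms(1)] by (simp add: compose_assoc)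
qed

lemma phi_unitary_hull: "y \<in> unitary_hull M x \<Longrightarrow> x \<in> M \<Longrightarrow> \<phi> y = \<phi> x"
proof (induction rule: unitary_hull.induct)
  case (conj y u)
  then show ?case using phi_unitary_conj unitary_hull_mem by metis
next
  case (convex y z r)
  then have "y \<in> M" "z \<in> M" using unitary_hull_mem by auto
  with convex show ?case by (simp add: phi_add phi_scaleR flip: distrib_right)
qed simp

lemma gns_norm_unitary_conj:
  assumes "unitary_in M u" "y \<in> M" shows "gns_norm \<phi> (u o\<^sub>L (y o\<^sub>L adj u)) \<le> gns_norm \<phi> y"
proof -
  note u = unitary_inD[OF assms(1)]
  have "gns_norm \<phi> (u o\<^sub>L (y o\<^sub>L adj u)) \<le> gns_norm \<phi> (y o\<^sub>L adj u)"
    using u assms by (intro gns_norm_compose_le_1) auto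
  also have "\<dots> \<le> gns_norm \<phi> y * norm (adj u)"
    using u assms by (intro gns_norm_compose_right)
  also have "\<dots> \<le> gns_norm \<phi> y * 1"
    using u assms by (intro mult_left_mono) auto
  finally show ?thesis by simp
qed

text \<open>Scalars are fixed by unitary conjugation, and balls of the trace norm around them are
  convex and invariant. This protects one averaging from a later one.\<close>

lemma gns_norm_unitary_hull:
  assumes "y \<in> unitary_hull M x" "x \<in> M"
  shows "gns_norm \<phi> (y - scalar_op c) \<le> gns_norm \<phi> (x - scalar_op c)"
  using assms
proof (induction rule: unitary_hull.induct)
  case (conj y u)
  have y: "y \<in> M" using conj unitary_hull_mem by blast
  note u = unitary_inD[OF conj(2)]
  have "u o\<^sub>L (scalar_op c o\<^sub>L adj u) = scalar_op c o\<^sub>L (u o\<^sub>L adj u)"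
    using u by (metis bdd compose_assoc scalar_op_commute)
  then have "(u o\<^sub>L (y o\<^sub>L adj u)) - scalar_op c = u o\<^sub>L ((y - scalar_op c) o\<^sub>L adj u)"
    using u by (simp add: compose_bilinear)
  then show ?case
    using gns_norm_unitary_conj[OF conj(2), of "y - scalar_op c"] y conj by auto
next
  case (convex y z r)
  have yz: "y \<in> M" "z \<in> M" using convex unitary_hull_mem by auto
  have "r *\<^sub>R y + (1 - r) *\<^sub>R z - scalar_op c = r *\<^sub>R (y - scalar_op c) + (1 - r) *\<^sub>R (z - scalar_op c)"
    by (simp add: algebra_simps)
  then have "gns_norm \<phi> (r *\<^sub>R y + (1 - r) *\<^sub>R z - scalar_op c)
      \<le> r * gns_norm \<phi> (y - scalar_op c) + (1 - r) * gns_norm \<phi> (z - scalar_op c)"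
    using gns_norm_triangle[of "r *\<^sub>R (y - scalar_op c)" "(1 - r) *\<^sub>R (z - scalar_op c)"] yz convex
    by (simp add: gns_norm_scaleR)
  also have "\<dots> \<le> r * gns_norm \<phi> (x - scalar_op c) + (1 - r) * gns_norm \<phi> (x - scalar_op c)"
    using convex by (intro add_mono mult_left_mono) auto
  finally show ?case by (simp add: algebra_simps)
qed simp

text \<open>Dixmier's averaging property in the trace norm. It is a predicate because it is proved
  from completeness for a normal trace, but transported along an isomorphism for a pulled-back
  one.\<close>

definition averaging :: bool where
  "averaging \<longleftrightarrow> (\<forall>x\<in>M. \<forall>e>0. \<exists>c\<in>unitary_hull M x. gns_norm \<phi> (c - scalar_op (\<phi> x)) < e)"

end

text \<open>The limit c of a minimizing sequence commutes with unitaries, since conjugation does not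
  raise the trace norm and nearly minimal elements of the hull are close together.\<close>

lemma (in normal_tracial_state) factor_averaging:
  assumes factor: "M \<inter> commutant M = range scalar_op"
  shows averaging
  unfolding averaging_def
proof safe
  fix x and e :: real assume x: "x \<in> M" and e: "0 < e"
  define S where "S = unitary_hull M x"
  have SM: "y \<in> M" if "y \<in> S" for y using that x unitary_hull_mem by (auto simp: S_def)
  obtain Y m where Y: "\<And>n. Y n \<in> S" "\<And>n. (gns_norm \<phi> (Y n))\<^sup>2 < m + 1 / real (Suc n)"
    and close: "\<And>e. 0 < e \<Longrightarrow> \<exists>n0. \<forall>k\<ge>n0. \<forall>l\<ge>n0. \<forall>a\<in>S. \<forall>b\<in>S.
      (gns_norm \<phi> a)\<^sup>2 \<le> (gns_norm \<phi> (Y k))\<^sup>2 \<longrightarrow> (gns_norm \<phi> b)\<^sup>2 \<le> (gns_norm \<phi> (Y l))\<^sup>2 \<longrightarrow>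
      gns_norm \<phi> (a - b) < e"
  proof (rule minimizing_Cauchy_sequence[of S "\<lambda>a. (gns_norm \<phi> a)\<^sup>2" "\<lambda>a b. gns_norm \<phi> (a - b)"])
    show "S \<noteq> {}" using unitary_hull.base by (auto simp: S_def)
    show "bdd_below ((\<lambda>a. (gns_norm \<phi> a)\<^sup>2) ` S)" by (rule bdd_belowI[of _ 0]) auto
    fix a b assume ab: "a \<in> S" "b \<in> S"
    then have "(1/2) *\<^sub>R a + (1/2) *\<^sub>R b \<in> S"
      using unitary_hull.convex[of a M x b "1/2"] by (simp add: S_def)
    with gns_norm_parallelogram[OF ab[THEN SM]]
    show "\<exists>c\<in>S. (gns_norm \<phi> (a - b))\<^sup>2 \<le>
        2 * (gns_norm \<phi> a)\<^sup>2 + 2 * (gns_norm \<phi> b)\<^sup>2 - 4 * (gns_norm \<phi> c)\<^sup>2"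
      by force
  qed blast
  obtain c where c: "c \<in> M" "(\<lambda>n. gns_norm \<phi> (Y n - c)) \<longlonglongrightarrow> 0"
  proof (rule bounded_Cauchy_convergent[of Y "norm x"])
    show "Y n \<in> M" for n using Y SM by blast
    show "norm (Y n) \<le> norm x" for n using Y x unitary_hull_norm by (auto simp: S_def)
    show "\<exists>n0. \<forall>m\<ge>n0. \<forall>n\<ge>n0. gns_norm \<phi> (Y m - Y n) < e" if "0 < e" for e
      using close[OF that] Y(1) by blast
  qed blast
  have "c o\<^sub>L u = u o\<^sub>L c" if un: "unitary_in M u" for u
  proof -
    note u = unitary_inD[OF un]
    define d where "d = (u o\<^sub>L (c o\<^sub>L adj u)) - c"
    have d: "d \<in> M" using u c by (simp add: d_def)
    have "gns_norm \<phi> d \<le> 0"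
    proof (rule field_le_epsilon)
      fix \<epsilon> :: real assume "0 < \<epsilon>"
      obtain n0 where n0: "\<And>k a b. n0 \<le> k \<Longrightarrow> a \<in> S \<Longrightarrow> b \<in> S \<Longrightarrow>
          (gns_norm \<phi> a)\<^sup>2 \<le> (gns_norm \<phi> (Y k))\<^sup>2 \<Longrightarrow> (gns_norm \<phi> b)\<^sup>2 \<le> (gns_norm \<phi> (Y k))\<^sup>2 \<Longrightarrow>
          gns_norm \<phi> (a - b) < \<epsilon> / 3"
        using close[of "\<epsilon> / 3"] \<open>0 < \<epsilon>\<close> by (metis zero_less_divide_iff zero_less_numeral)
      obtain n1 where n1: "\<And>n. n1 \<le> n \<Longrightarrow> \<bar>gns_norm \<phi> (Y n - c)\<bar> < \<epsilon> / 3"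
        using LIMSEQ_D[OF c(2), of "\<epsilon> / 3"] \<open>0 < \<epsilon>\<close> by auto
      define y where "y = Y (max n0 n1)"
      define z where "z = u o\<^sub>L (y o\<^sub>L adj u)"
      have y: "y \<in> S" using Y(1) by (simp add: y_def)
      have z: "z \<in> S"
        unfolding z_def S_def by (rule unitary_hull.conj[OF y[unfolded S_def] un])
      note yzM = SM[OF y] SM[OF z]
      have "gns_norm \<phi> z \<le> gns_norm \<phi> y"
        unfolding z_def using gns_norm_unitary_conj un yzM by blast
      \<comment> \<open>z competes with y at no larger norm, so the strong form of closeness for
        \<open>Y\<close> applies to the pair.\<close>
      then have 1: "gns_norm \<phi> (z - y) < \<epsilon> / 3"
        using n0[of "max n0 n1" z y] y z yzM by (simp add: y_def power_mono)
      have 2: "gns_norm \<phi> (y - c) < \<epsilon> / 3" using n1[of "max n0 n1"] unfolding y_def by simp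
      have "(u o\<^sub>L (c o\<^sub>L adj u)) - z = u o\<^sub>L ((c - y) o\<^sub>L adj u)"
        by (simp add: z_def compose_bilinear)
      then have 3: "gns_norm \<phi> ((u o\<^sub>L (c o\<^sub>L adj u)) - z) < \<epsilon> / 3"
        using gns_norm_unitary_conj[OF un, of "c - y"] 2 c yzM gns_norm_diff_commute[of c y] by auto
      have "gns_norm \<phi> d \<le> gns_norm \<phi> ((u o\<^sub>L (c o\<^sub>L adj u)) - z) + gns_norm \<phi> (z - c)"
        unfolding d_def using u c yzM by (intro gns_norm_diff_triangle) auto
      also have "gns_norm \<phi> (z - c) \<le> gns_norm \<phi> (z - y) + gns_norm \<phi> (y - c)"
        using c yzM by (intro gns_norm_diff_triangle) auto
      finally show "gns_norm \<phi> d \<le> 0 + \<epsilon>" using 1 2 3 by linarith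
    qed
    then have "d = 0" using gns_norm_eq_0[OF d] gns_norm_nonneg[OF d] by linarith
    then have "(u o\<^sub>L (c o\<^sub>L adj u)) o\<^sub>L u = c o\<^sub>L u" by (simp add: d_def)
    then show ?thesis using u by (simp add: compose_assoc)
  qed
  then have "c \<in> commutant M" using c commutes_with_unitaries by blast
  then obtain z where z: "c = scalar_op z" using factor c(1) by blast
  \<comment> \<open>\<phi> is constant on the hull and continuous for its own norm, so the scalar
    can only be \<phi> x.\<close>
  have "\<phi> x = z"
  proof -
    have "cmod (\<phi> x - z) \<le> gns_norm \<phi> (Y n - c)" for n
    proof -
      have "\<phi> x - z = \<phi> (Y n - c)"
        using phi_unitary_hull[of "Y n" x] Y x c SM by (simp add: phi_diff z phi_scalar_op S_def)
      then show ?thesis using phi_le_gns_norm[of "Y n - c"] Y SM c by simp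
    qed
    then have "cmod (\<phi> x - z) \<le> 0"
      using c(2) LIMSEQ_le_const by blast
    then show ?thesis by simp
  qed
  moreover obtain n where "gns_norm \<phi> (Y n - c) < e"
    using LIMSEQ_D[OF c(2) e] by (auto simp: abs_less_iff)
  ultimately show "\<exists>c\<in>unitary_hull M x. gns_norm \<phi> (c - scalar_op (\<phi> x)) < e"
    using Y(1) z by (auto simp: S_def)
qed

section \<open>Uniqueness of the trace\<close>

text \<open>Deliberately asymmetric: \<tau> supplies the limits, while \<phi> stands for the
  pulled-back trace, for which averaging takes the place of normality.\<close>

locale trace_pair = T: normal_tracial_state M \<tau> + F: tracial_state M \<phi>
  for M :: "'h::chilbert_space op set" and \<tau> \<phi> +
  assumes avg_tau: "T.averaging" and avg_phi: "F.averaging"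
begin

text \<open>Average for \<tau> first, then average the result for \<phi>: the second round cannot
  increase the distance to \<tau> x, and the first did not change the value of \<phi>.\<close>

lemma simultaneous_average:
  assumes "x \<in> M" "0 < e"
  obtains d where "d \<in> unitary_hull M x" "gns_norm \<tau> (d - scalar_op (\<tau> x)) < e"
    "gns_norm \<phi> (d - scalar_op (\<phi> x)) < e"
proof -
  obtain c where c: "c \<in> unitary_hull M x" "gns_norm \<tau> (c - scalar_op (\<tau> x)) < e"
    using avg_tau assms unfolding T.averaging_def by blast
  have cM: "c \<in> M" using c assms T.unitary_hull_mem by blast
  obtain d where d: "d \<in> unitary_hull M c" "gns_norm \<phi> (d - scalar_op (\<phi> c)) < e"
    using avg_phi assms cM unfolding F.averaging_def by blast
  have "gns_norm \<tau> (d - scalar_op (\<tau> x)) < e"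
    using T.gns_norm_unitary_hull[OF d(1) cM, of "\<tau> x"] c(2) by linarith
  moreover have "\<phi> c = \<phi> x" using F.phi_unitary_hull c assms by blast
  ultimately show thesis
    using that[of d] unitary_hull_trans[OF d(1) c(1)] d(2) by simp
qed

text \<open>If \<open>\<tau> x \<noteq> \<phi> x\<close>, averages of \<open>x\<close> yield \<open>e n \<ge> 0\<close> tending fast to 0 for \<open>\<tau>\<close> and to
  a positive scalar for \<open>\<phi>\<close>. The products of the contractions \<open>1 - e n\<close> then
  converge to a nonzero operator \<open>q\<close> for \<open>\<tau>\<close>, while \<open>\<phi> (q\<^sup>* q) = 0\<close> because the squares
  of the partial products decrease.\<close>

lemma traces_agree_selfadjoint_small:
  assumes x: "x \<in> M" "adj x = x" "norm x \<le> 1/4"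
  shows "\<tau> x = \<phi> x"
proof (rule ccontr)
  assume ne: "\<tau> x \<noteq> \<phi> x"
  define s t where "s = Re (\<tau> x)" and "t = Re (\<phi> x)"
  have st: "\<tau> x = complex_of_real s" "\<phi> x = complex_of_real t"
    using T.phi_adj[OF x(1)] F.phi_adj[OF x(1)] x(2) by (auto simp: complex_eq_iff s_def t_def)
  have abs_st: "\<bar>s\<bar> \<le> 1/4" "\<bar>t\<bar> \<le> 1/4"
    using T.phi_le_norm[OF x(1)] F.phi_le_norm[OF x(1)] x(3) by (simp_all add: st)
  \<comment> \<open>The scalar that \<open>e n\<close> approaches for \<phi>; for \<tau> it
    approaches 0.\<close>
  define r where "r = (t - s)\<^sup>2"
  have r0: "0 < r" using ne by (simp add: r_def st)
  have abs_ts: "\<bar>t - s\<bar> \<le> 1/2" using abs_st by linarith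
  then have "\<bar>t - s\<bar>\<^sup>2 \<le> (1/2)\<^sup>2" by (intro power_mono) auto
  then have r1: "r \<le> 1/4" by (simp add: r_def power_divide)
  \<comment> \<open>These errors sum to 1/2, so the products below stay within 1/2 of the identity
    in the \<tau>-norm.\<close>
  define \<epsilon> :: "nat \<Rightarrow> real" where "\<epsilon> n = (1/2) ^ (n + 2)" for n
  have "\<exists>d. d \<in> unitary_hull M x \<and> gns_norm \<tau> (d - scalar_op (\<tau> x)) < \<epsilon> n \<and>
      gns_norm \<phi> (d - scalar_op (\<phi> x)) < \<epsilon> n" for n
    using simultaneous_average[OF x(1), of "\<epsilon> n"] by (auto simp: \<epsilon>_def)
  then obtain d where d: "\<And>n. d n \<in> unitary_hull M x"
    "\<And>n. gns_norm \<tau> (d n - scalar_op (\<tau> x)) < \<epsilon> n" "\<And>n. gns_norm \<phi> (d n - scalar_op (\<phi> x)) < \<epsilon> n"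
    by metis
  \<comment> \<open>Subtracting the \<tau>-value s leaves something small for \<tau> and close to t
    - s for \<phi>. Squaring it in \<open>e\<close> gives positivity whatever the sign of t - s. The
    bound 1/4 on x, hence on s, keeps the norm of \<open>f n\<close> at most 1/2.\<close>
  define f where "f n = d n - s *\<^sub>R id_blinfun" for n
  have sc: "scalar_op (complex_of_real c) = c *\<^sub>R id_blinfun" for c
    using scalar_op_of_real[of c id_blinfun] by simp
  have dM: "d n \<in> M" for n using T.unitary_hull_mem d x by blast
  have fM: "f n \<in> M" for n using dM by (simp add: f_def)
  have fa: "adj (f n) = f n" for n
    using T.unitary_hull_selfadjoint[OF d(1) x(1,2)] dM by (simp add: f_def adj_diff adj_scaleR)
  have fn: "norm (f n) \<le> 1/2" for n
  proof -
    have "norm (f n) \<le> norm (d n) + \<bar>s\<bar> * norm (id_blinfun :: 'h op)"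
      using norm_triangle_ineq4[of "d n" "s *\<^sub>R id_blinfun"] by (simp add: f_def)
    also have "\<dots> \<le> 1/4 + (1/4) * 1"
      using T.unitary_hull_norm[OF d(1) x(1), of n] x(3) abs_st norm_blinfun_id_le
      by (intro add_mono mult_mono) auto
    finally show ?thesis by simp
  qed
  define e where "e n = f n o\<^sub>L f n" for n
  have eM: "e n \<in> M" for n using fM by (simp add: e_def)
  have e\<tau>: "gns_norm \<tau> (e n) \<le> \<epsilon> n" for n
  proof -
    have "gns_norm \<tau> (e n) \<le> norm (f n) * gns_norm \<tau> (f n)"
      unfolding e_def using fM by (intro T.gns_norm_compose_left)
    also have "\<dots> \<le> 1 * \<epsilon> n"
      using fn[of n] d(2)[of n] fM by (intro mult_mono) (auto simp: f_def st sc)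
    finally show ?thesis by simp
  qed
  have e\<phi>: "gns_norm \<phi> (e n - r *\<^sub>R id_blinfun) \<le> \<epsilon> n" for n
  proof -
    \<comment> \<open>Since f n = g + (t - s) with g small for \<phi>, one gets e n - r = f n g + (t
      - s) g; both coefficients are at most 1/2, so the error does not grow.\<close>
    define g where "g = d n - t *\<^sub>R id_blinfun"
    have g: "g \<in> M" "gns_norm \<phi> g \<le> \<epsilon> n" "0 \<le> gns_norm \<phi> g"
      using d(3)[of n] dM by (auto simp: g_def st sc)
    have fg: "f n = g + (t - s) *\<^sub>R id_blinfun" by (simp add: f_def g_def algebra_simps)
    have "e n = (f n o\<^sub>L g) + (t - s) *\<^sub>R f n"
      unfolding e_def by (subst (2) fg) (simp add: compose_bilinear)
    also have "\<dots> = (f n o\<^sub>L g) + ((t - s) *\<^sub>R g + r *\<^sub>R id_blinfun)"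
      by (subst (2) fg) (simp add: r_def power2_eq_square scaleR_add_right)
    finally have "e n - r *\<^sub>R id_blinfun = (f n o\<^sub>L g) + (t - s) *\<^sub>R g" by simp
    then have "gns_norm \<phi> (e n - r *\<^sub>R id_blinfun) \<le> gns_norm \<phi> (f n o\<^sub>L g) + \<bar>t - s\<bar> * gns_norm \<phi> g"
      using F.gns_norm_triangle[of "f n o\<^sub>L g" "(t - s) *\<^sub>R g"] fM g by (simp add: F.gns_norm_scaleR)
    also have "\<dots> \<le> norm (f n) * gns_norm \<phi> g + \<bar>t - s\<bar> * gns_norm \<phi> g"
      using fM g by (intro add_right_mono F.gns_norm_compose_left)
    also have "\<dots> \<le> (1/2) * gns_norm \<phi> g + (1/2) * gns_norm \<phi> g"
      using fn[of n] abs_ts g by (intro add_mono mult_right_mono) auto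
    finally show ?thesis using g by simp
  qed
  \<comment> \<open>|v - f f v|^2 = |v|^2 - 2 |f v|^2 + |f f v|^2, and the last term is at most |f
    v|^2 as \<open>f n\<close> is a contraction.\<close>
  have contr: "norm (blinfun_apply (id_blinfun - e n) v) \<le> norm v" for n v
  proof -
    define w where "w = blinfun_apply (f n) v"
    have "inner v (blinfun_apply (f n) w) = inner w w"
      using inner_adj[OF T.bdd[OF fM[of n]], of v w] fa by (simp add: w_def)
    then have "(norm (v - blinfun_apply (f n) w))\<^sup>2
        = (norm v)\<^sup>2 - 2 * (norm w)\<^sup>2 + (norm (blinfun_apply (f n) w))\<^sup>2"
      by (simp add: dot_square_norm[symmetric] inner_diff_left inner_diff_right inner_commute)
    moreover have "norm (blinfun_apply (f n) w) \<le> 1 * norm w"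
      using fn[of n] by (intro order_trans[OF norm_blinfun] mult_right_mono) auto
    then have "(norm (blinfun_apply (f n) w))\<^sup>2 \<le> (norm w)\<^sup>2" by (intro power_mono) auto
    ultimately have "(norm (v - blinfun_apply (f n) w))\<^sup>2 \<le> (norm v)\<^sup>2"
      using zero_le_power2[of "norm w"] by linarith
    then have "norm (v - blinfun_apply (f n) w) \<le> norm v" by (rule power2_le_imp_le) simp
    then show ?thesis by (simp add: e_def w_def minus_blinfun.rep_eq)
  qed
  \<comment> \<open>New factors enter on the left, so that |p n v| decreases in n for each vector v;
    this gives the order relation between the squares.\<close>
  define p where "p = rec_nat id_blinfun (\<lambda>n q. (id_blinfun - e n) o\<^sub>L q)"
  have p0: "p 0 = id_blinfun" and pS: "p (Suc n) = (id_blinfun - e n) o\<^sub>L p n" for n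
    by (simp_all add: p_def)
  have pM: "p n \<in> M" for n by (induction n) (use eM in \<open>auto simp: p0 pS\<close>)
  have pdec: "norm (blinfun_apply (p l) v) \<le> norm (blinfun_apply (p n) v)" if "n \<le> l" for n l v
    using that
  proof (induction rule: dec_induct)
    case (step l)
    then show ?case using contr[of l "blinfun_apply (p l) v"] by (simp add: pS)
  qed simp
  have pn: "norm (p n) \<le> 1" for n
    using pdec[of 0 n] by (intro norm_blinfun_bound) (auto simp: p0)
  \<comment> \<open>The exact partial geometric sum of \<epsilon>, kept as a difference for the sake
    of the induction; the full tail from n is (1/2)^(n + 1).\<close>
  have p\<tau>: "gns_norm \<tau> (p (n + j) - p n) \<le> (1/2) ^ (n + 1) - (1/2) ^ (n + j + 1)" for n j
  proof (induction j)
    case 0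
    have "gns_norm \<tau> 0 = 0" using T.gns_norm_scaleR[of 0 0] by simp
    then show ?case by simp
  next
    case (Suc j)
    have "p (n + Suc j) - p (n + j) = (-1) *\<^sub>R (e (n + j) o\<^sub>L p (n + j))"
      by (simp add: pS compose_bilinear)
    then have "gns_norm \<tau> (p (n + Suc j) - p (n + j)) = gns_norm \<tau> (e (n + j) o\<^sub>L p (n + j))"
      using T.gns_norm_scaleR[of "e (n + j) o\<^sub>L p (n + j)" "-1"] eM pM by simp
    also have "\<dots> \<le> gns_norm \<tau> (e (n + j)) * norm (p (n + j))"
      using eM pM by (intro T.gns_norm_compose_right)
    also have "\<dots> \<le> \<epsilon> (n + j) * 1"
      using e\<tau> pn eM by (intro mult_mono) (auto simp: \<epsilon>_def)
    finally have "gns_norm \<tau> (p (n + Suc j) - p n) \<le> \<epsilon> (n + j) + gns_norm \<tau> (p (n + j) - p n)"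
      using T.gns_norm_diff_triangle[of "p (n + Suc j)" "p (n + j)" "p n"] pM by fastforce
    with Suc show ?case by (simp add: \<epsilon>_def)
  qed
  obtain q where q: "q \<in> M" "(\<lambda>n. gns_norm \<tau> (p n - q)) \<longlonglongrightarrow> 0"
    and q_le: "\<And>v c n0. (\<And>n. n0 \<le> n \<Longrightarrow> norm (blinfun_apply (p n) v) \<le> c) \<Longrightarrow> norm (blinfun_apply q v) \<le> c"
  proof (rule T.bounded_Cauchy_convergent[OF pM pn])
    fix e' :: real assume "0 < e'"
    then obtain n0 where n0: "(1/2) ^ n0 < e'" using real_arch_pow_inv[of e' "1/2"] by auto
    have le: "gns_norm \<tau> (p m - p n) < e'" if nm: "n0 \<le> n" "n \<le> m" for m n
    proof -
      obtain j where m: "m = n + j" using le_Suc_ex[OF nm(2)] by blast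
      have "gns_norm \<tau> (p m - p n) \<le> (1/2) ^ (n + 1)"
      proof -
        have "0 \<le> (1/2 :: real) ^ (n + j + 1)" by simp
        then show ?thesis using p\<tau>[of n j] unfolding m by linarith
      qed
      also have "\<dots> \<le> (1/2 :: real) ^ n0"
        by (rule power_decreasing) (use that in auto)
      finally show ?thesis using n0 by linarith
    qed
    have "gns_norm \<tau> (p m - p n) < e'" if "n0 \<le> n" "n0 \<le> m" for m n
      using le[of n m] le[of m n] that T.gns_norm_diff_commute[OF pM pM, of m n] by (cases "n \<le> m") auto
    then show "\<exists>n0. \<forall>m\<ge>n0. \<forall>n\<ge>n0. gns_norm \<tau> (p m - p n) < e'" by blast
  qed blast
  \<comment> \<open>A rate strictly between 1 - r and 1, and at least 1/2 so that its powers
    dominate \<epsilon>. The constant 2 / r in \<open>p\<phi>\<close> is chosen to satisfy (1 - r)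
    (2 / r) + 1 = (2 / r) \<kappa>.\<close>
  define \<kappa> where "\<kappa> = 1 - r / 2"
  have \<kappa>: "1/2 \<le> \<kappa>" "\<kappa> < 1" using r0 r1 by (auto simp: \<kappa>_def)
  have p\<phi>: "gns_norm \<phi> (p n) \<le> (2 / r) * \<kappa> ^ n" for n
  proof (induction n)
    case 0
    then show ?case using r0 r1 by (simp add: p0 field_simps)
  next
    case (Suc n)
    have "p (Suc n) = (1 - r) *\<^sub>R p n + (-1) *\<^sub>R ((e n - r *\<^sub>R id_blinfun) o\<^sub>L p n)"
      by (simp add: pS compose_bilinear algebra_simps)
    then have "gns_norm \<phi> (p (Suc n)) \<le> gns_norm \<phi> ((1 - r) *\<^sub>R p n) + gns_norm \<phi> ((-1) *\<^sub>R ((e n - r *\<^sub>R id_blinfun) o\<^sub>L p n))"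
      using eM pM by (simp only:) (intro F.gns_norm_triangle T.scaleR_mem T.compose_mem T.diff_mem T.id_mem)
    also have "\<dots> = (1 - r) * gns_norm \<phi> (p n) + gns_norm \<phi> ((e n - r *\<^sub>R id_blinfun) o\<^sub>L p n)"
      using eM pM r1 by (subst (1 2) F.gns_norm_scaleR) auto
    also have "\<dots> \<le> (1 - r) * gns_norm \<phi> (p n) + gns_norm \<phi> (e n - r *\<^sub>R id_blinfun) * norm (p n)"
      using eM pM by (intro add_left_mono F.gns_norm_compose_right) auto
    also have "\<dots> \<le> (1 - r) * ((2 / r) * \<kappa> ^ n) + \<epsilon> n * 1"
      using Suc r1 e\<phi> pn eM by (intro add_mono mult_left_mono mult_mono) (auto simp: \<epsilon>_def)
    also have "\<epsilon> n \<le> \<kappa> ^ n"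
    proof -
      have "\<epsilon> n \<le> (1/2) ^ n" by (simp add: \<epsilon>_def)
      also have "\<dots> \<le> \<kappa> ^ n" using \<kappa> by (intro power_mono) auto
      finally show ?thesis .
    qed
    finally have "gns_norm \<phi> (p (Suc n)) \<le> (1 - r) * ((2 / r) * \<kappa> ^ n) + \<kappa> ^ n" by simp
    also have "\<dots> = (2 / r) * \<kappa> ^ Suc n"
      using r0 by (simp add: \<kappa>_def field_simps)
    finally show ?case .
  qed
  \<comment> \<open>\<phi> is not known to be continuous along the convergence of p n to q, so q is
    compared with p n as an operator: |q v| <= |p n v| makes the difference \<open>a\<close> of the
    squares positive.\<close>
  have "gns_norm \<phi> q \<le> (2 / r) * \<kappa> ^ n" for n
  proof -
    have qp: "norm (blinfun_apply q v) \<le> norm (blinfun_apply (p n) v)" for v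
      using q_le[of n v] pdec by blast
    have pv: "norm (blinfun_apply (p n) v) \<le> norm v" for v
      using pdec[of 0 n v] by (simp add: p0)
    define a where "a = (adj (p n) o\<^sub>L p n) - (adj q o\<^sub>L q)"
    have av: "inner (blinfun_apply a v) v = (norm (blinfun_apply (p n) v))\<^sup>2 - (norm (blinfun_apply q v))\<^sup>2" for v
      using pM q by (simp only: a_def norm_apply_square T.bdd) (simp add: minus_blinfun.rep_eq inner_diff_left)
    have "0 \<le> Re (\<phi> a)"
    proof (rule F.phi_positive)
      show "a \<in> M" "adj a = a" using pM q by (auto simp: a_def adj_diff adj_compose)
      show "0 \<le> inner (blinfun_apply a v) v" for v
        unfolding av using power_mono[OF qp, of v 2] by simp
      show "inner (blinfun_apply a v) v \<le> (norm v)\<^sup>2" for v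
        unfolding av using power_mono[OF pv norm_ge_zero, of v 2] zero_le_power2[of "norm (blinfun_apply q v)"]
        by linarith
    qed
    then have "(gns_norm \<phi> q)\<^sup>2 \<le> (gns_norm \<phi> (p n))\<^sup>2"
      using pM q by (simp add: a_def F.phi_diff F.gns_norm_square)
    then have "gns_norm \<phi> q \<le> gns_norm \<phi> (p n)"
      by (rule power2_le_imp_le) (use pM in simp)
    with p\<phi>[of n] show ?thesis by linarith
  qed
  moreover have "(\<lambda>n. (2 / r) * \<kappa> ^ n) \<longlonglongrightarrow> (2 / r) * 0"
    using \<kappa> by (intro tendsto_mult_left LIMSEQ_realpow_zero) auto
  ultimately have "gns_norm \<phi> q \<le> 0"
    using LIMSEQ_le_const by fastforce
  then have "q = 0" using F.gns_norm_eq_0[OF q(1)] F.gns_norm_nonneg[OF q(1)] by linarith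
  obtain n where "\<bar>gns_norm \<tau> (p n - q)\<bar> < 1/2"
    using LIMSEQ_D[OF q(2), of "1/2"] by auto
  then have n: "gns_norm \<tau> (p n - q) < 1/2" by linarith
  \<comment> \<open>With q = 0 the product \<open>p n\<close> has \<tau>-norm below 1/2, although it
    stays within 1/2 of the identity, which has norm 1.\<close>
  have "1 \<le> gns_norm \<tau> (id_blinfun - p n) + gns_norm \<tau> (p n)"
    using T.gns_norm_triangle[of "id_blinfun - p n" "p n"] pM by simp
  moreover have "gns_norm \<tau> (id_blinfun - p n) \<le> 1/2"
  proof -
    have "gns_norm \<tau> (p n - id_blinfun) \<le> (1/2) ^ (0 + 1) - (1/2) ^ (0 + n + 1)"
      using p\<tau>[of 0 n] by (simp only: p0 add_0)
    also have "\<dots> \<le> 1/2" by simp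
    finally have "gns_norm \<tau> (p n - id_blinfun) \<le> 1/2" .
    then show ?thesis using T.gns_norm_diff_commute[OF pM T.id_mem, of n] by simp
  qed
  ultimately show False using n \<open>q = 0\<close> by simp
qed

lemma traces_agree:
  assumes x: "x \<in> M" shows "\<tau> x = \<phi> x"
proof -
  have sa: "\<tau> h = \<phi> h" if h: "h \<in> M" "adj h = h" for h
  proof -
    define r where "r = 1 / (4 * (norm h + 1))"
    have r: "0 < r" by (simp add: r_def add_nonneg_pos)
    have "norm h / (4 * (norm h + 1)) \<le> 1/4"
      by (subst pos_divide_le_eq) (simp_all add: add_nonneg_pos)
    then have "norm (r *\<^sub>R h) \<le> 1/4" by (simp add: r_def)
    then have "\<tau> (r *\<^sub>R h) = \<phi> (r *\<^sub>R h)"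
      using h by (intro traces_agree_selfadjoint_small) (auto simp: adj_scaleR)
    then show ?thesis using h r by (simp add: T.phi_scaleR F.phi_scaleR)
  qed
  obtain p q where "p \<in> M" "q \<in> M" "adj p = p" "adj q = q" "x = p + (scalar_op \<i> o\<^sub>L q)"
    using T.selfadjoint_parts[OF x] by blast
  then show ?thesis
    using sa by (simp add: T.phi_add F.phi_add T.phi_scalar F.phi_scalar)
qed

end

section \<open>Isomorphisms preserve the trace\<close>

locale vn_iso = M: vn_algebra M + N: vn_algebra N
  for M :: "'h::chilbert_space op set" and N :: "'k::chilbert_space op set" +
  fixes \<theta> :: "'h op \<Rightarrow> 'k op"
  assumes iso: "star_iso M N \<theta>"
begin

lemma hom: "star_hom M N \<theta>" and bij: "bij_betw \<theta> M N"
  using iso by (auto simp: star_iso_def)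

lemmas theta_simps = M.star_hom_simps[OF hom]

lemma theta_mem: "x \<in> M \<Longrightarrow> \<theta> x \<in> N"
  using theta_simps(6) by blast

lemma surj: "y \<in> N \<Longrightarrow> \<exists>x\<in>M. \<theta> x = y"
  using bij by (metis bij_betw_def imageE)

lemma inj: "x \<in> M \<Longrightarrow> y \<in> M \<Longrightarrow> \<theta> x = \<theta> y \<Longrightarrow> x = y"
  using bij by (auto simp: bij_betw_def inj_on_def)

text \<open>\<open>star_hom\<close> does not postulate the unit. Surjectivity yields e with \<theta>
  e = 1, and then \<theta> 1 = (\<theta> 1) (\<theta> e) = \<theta> e.\<close>

lemma theta_id: "\<theta> id_blinfun = id_blinfun"
proof -
  obtain e where e: "e \<in> M" "\<theta> e = id_blinfun" using surj[OF N.id_mem] by blast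
  have "\<theta> (id_blinfun o\<^sub>L e) = \<theta> id_blinfun o\<^sub>L \<theta> e" using e by (intro theta_simps) auto
  with e show ?thesis by simp
qed

lemma theta_scalar: "\<theta> (scalar_op c) = scalar_op c"
proof -
  have "\<theta> (scalar_op c o\<^sub>L id_blinfun) = scalar_op c o\<^sub>L \<theta> id_blinfun"
    using hom M.id_mem unfolding star_hom_def by blast
  then show ?thesis by (simp add: theta_id)
qed

lemma inverse_iso: "star_iso N M (inv_into M \<theta>)"
proof -
  have inv: "inv_into M \<theta> y \<in> M" "\<theta> (inv_into M \<theta> y) = y" if "y \<in> N" for y
    using that bij by (auto simp: bij_betw_def inv_into_into f_inv_into_f)
  have left: "inv_into M \<theta> (\<theta> x) = x" if "x \<in> M" for x
    using that bij by (simp add: bij_betw_def)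
  have "star_hom N M (inv_into M \<theta>)"
    unfolding star_hom_def
  proof (intro conjI ballI allI)
    fix x y c assume x: "x \<in> N"
    show "inv_into M \<theta> x \<in> M" using inv x by blast
    show "inv_into M \<theta> (adj x) = adj (inv_into M \<theta> x)"
      using inv[OF x] left[of "adj (inv_into M \<theta> x)"] by (simp add: theta_simps)
    show "inv_into M \<theta> (scalar_op c o\<^sub>L x) = scalar_op c o\<^sub>L inv_into M \<theta> x"
      using inv[OF x] left[of "scalar_op c o\<^sub>L inv_into M \<theta> x"] by (simp add: theta_simps theta_scalar)
    assume y: "y \<in> N"
    show "inv_into M \<theta> (x + y) = inv_into M \<theta> x + inv_into M \<theta> y"
      using inv[OF x] inv[OF y] left[of "inv_into M \<theta> x + inv_into M \<theta> y"] by (simp add: theta_simps)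
    show "inv_into M \<theta> (x o\<^sub>L y) = inv_into M \<theta> x o\<^sub>L inv_into M \<theta> y"
      using inv[OF x] inv[OF y] left[of "inv_into M \<theta> x o\<^sub>L inv_into M \<theta> y"] by (simp add: theta_simps)
  qed
  moreover have "bij_betw (inv_into M \<theta>) N M"
    using bij by (rule bij_betw_inv_into)
  ultimately show ?thesis by (simp add: star_iso_def)
qed

lemma norm_theta:
  assumes x: "x \<in> M" shows "norm (\<theta> x) = norm x"
proof (rule antisym)
  show "norm (\<theta> x) \<le> norm x"
    using x theta_id by (intro M.star_hom_contractive[OF hom]) auto
  have left: "inv_into M \<theta> (\<theta> x) = x" if "x \<in> M" for x
    using that bij by (simp add: bij_betw_def)
  have "norm (inv_into M \<theta> (\<theta> x)) \<le> norm (\<theta> x)"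
  proof (rule N.star_hom_contractive)
    show "star_hom N M (inv_into M \<theta>)" using inverse_iso by (simp add: star_iso_def)
    show "inv_into M \<theta> id_blinfun = id_blinfun"
      using left[OF M.id_mem] by (simp add: theta_id)
  qed (use x theta_simps in auto)
  then show "norm x \<le> norm (\<theta> x)" using left x by simp
qed

text \<open>Unitaries of N lift through \<theta> to unitaries of M by injectivity, so averages
  formed in N are realized in M.\<close>

lemma unitary_hull_theta:
  assumes "y \<in> unitary_hull N (\<theta> x)" "x \<in> M"
  shows "\<exists>z\<in>unitary_hull M x. \<theta> z = y"
  using assms
proof (induction rule: unitary_hull.induct)
  case base
  then show ?case using unitary_hull.base by blast
next
  case (conj y u)
  then obtain z where z: "z \<in> unitary_hull M x" "\<theta> z = y" by blast
  have zM: "z \<in> M" using z conj M.unitary_hull_mem by blast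
  obtain w where w: "w \<in> M" "\<theta> w = u" using surj conj N.unitary_inD by metis
  have "\<theta> (adj w o\<^sub>L w) = \<theta> id_blinfun" "\<theta> (w o\<^sub>L adj w) = \<theta> id_blinfun"
    using w conj N.unitary_inD by (simp_all add: theta_simps theta_id)
  then have "unitary_in M w"
    using w unfolding unitary_in_def by (metis M.adj_mem M.compose_mem M.id_mem inj)
  then have "w o\<^sub>L (z o\<^sub>L adj w) \<in> unitary_hull M x"
    by (rule unitary_hull.conj[OF z(1)])
  moreover have "\<theta> (w o\<^sub>L (z o\<^sub>L adj w)) = u o\<^sub>L (y o\<^sub>L adj u)"
    using w z zM by (simp add: theta_simps)
  ultimately show ?case by blast
next
  case (convex y1 y2 r)
  then obtain z1 z2 where z: "z1 \<in> unitary_hull M x" "\<theta> z1 = y1" "z2 \<in> unitary_hull M x" "\<theta> z2 = y2"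
    by blast
  have zM: "z1 \<in> M" "z2 \<in> M" using z convex M.unitary_hull_mem by blast+
  have "r *\<^sub>R z1 + (1 - r) *\<^sub>R z2 \<in> unitary_hull M x"
    by (rule unitary_hull.convex[OF z(1,3) convex(3,4)])
  moreover have "\<theta> (r *\<^sub>R z1 + (1 - r) *\<^sub>R z2) = r *\<^sub>R y1 + (1 - r) *\<^sub>R y2"
    using z zM M.scaleR_mem by (simp add: theta_simps)
  ultimately show ?case by blast
qed

lemma pullback_tracial_state:
  assumes "tracial_state N \<sigma>" shows "tracial_state M (\<lambda>x. \<sigma> (\<theta> x))"
proof -
  interpret S: tracial_state N \<sigma> by fact
  show ?thesis
  proof
    fix x y c assume x: "x \<in> M"
    show "\<sigma> (\<theta> (scalar_op c o\<^sub>L x)) = c * \<sigma> (\<theta> x)"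
      using x by (simp add: theta_simps theta_scalar S.phi_scalar)
    show "\<sigma> (\<theta> (adj x o\<^sub>L x)) \<in> \<real>\<^sub>\<ge>\<^sub>0"
      using x S.phi_pos[of "\<theta> x"] by (simp add: theta_simps)
    show "x = 0" if "\<sigma> (\<theta> (adj x o\<^sub>L x)) = 0"
    proof -
      have "\<theta> x = 0" using that x S.phi_faithful[of "\<theta> x"] by (simp add: theta_simps)
      then show ?thesis using norm_theta[OF x] by simp
    qed
    assume y: "y \<in> M"
    show "\<sigma> (\<theta> (x + y)) = \<sigma> (\<theta> x) + \<sigma> (\<theta> y)"
      using x y by (simp add: theta_simps S.phi_add)
    show "\<sigma> (\<theta> (x o\<^sub>L y)) = \<sigma> (\<theta> (y o\<^sub>L x))"
      using x y by (simp add: theta_simps S.phi_commute[of "\<theta> x" "\<theta> y"])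
  qed (simp add: theta_id)
qed

text \<open>\<theta> is isometric from the pulled-back trace norm to that of \<sigma>, so the
  averaging property crosses over without weak continuity of \<theta>.\<close>

lemma pullback_averaging:
  assumes "tracial_state N \<sigma>" "tracial_state.averaging N \<sigma>"
  shows "tracial_state.averaging M (\<lambda>x. \<sigma> (\<theta> x))"
proof -
  interpret S: tracial_state N \<sigma> by fact
  interpret P: tracial_state M "\<lambda>x. \<sigma> (\<theta> x)" by (rule pullback_tracial_state) fact
  show ?thesis
    unfolding P.averaging_def
  proof (intro ballI allI impI)
    fix x and e :: real assume x: "x \<in> M" "0 < e"
    obtain c where c: "c \<in> unitary_hull N (\<theta> x)" "gns_norm \<sigma> (c - scalar_op (\<sigma> (\<theta> x))) < e"
      using assms(2)[unfolded S.averaging_def, rule_format, OF theta_mem[OF x(1)] x(2)] by blast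
    then obtain z where z: "z \<in> unitary_hull M x" "\<theta> z = c" using unitary_hull_theta x by blast
    have zM: "z \<in> M" using z x M.unitary_hull_mem by blast
    have "gns_norm (\<lambda>x. \<sigma> (\<theta> x)) (z - scalar_op (\<sigma> (\<theta> x))) = gns_norm \<sigma> (c - scalar_op (\<sigma> (\<theta> x)))"
      using zM z by (simp add: gns_norm_def theta_simps theta_scalar)
    also have "\<dots> < e" by (rule c(2))
    finally show "\<exists>c\<in>unitary_hull M x. gns_norm (\<lambda>x. \<sigma> (\<theta> x)) (c - scalar_op (\<sigma> (\<theta> x))) < e"
      using z(1) by blast
  qed
qed

lemma trace_theta:
  assumes "normal_tracial_state M \<tau>" "M \<inter> commutant M = range scalar_op"
    and "normal_tracial_state N \<sigma>" "N \<inter> commutant N = range scalar_op" and x: "x \<in> M"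
  shows "\<sigma> (\<theta> x) = \<tau> x"
proof -
  interpret T: normal_tracial_state M \<tau> by fact
  interpret S: normal_tracial_state N \<sigma> by fact
  interpret P: tracial_state M "\<lambda>x. \<sigma> (\<theta> x)"
    by (rule pullback_tracial_state) (rule S.tracial_state_axioms)
  interpret trace_pair M \<tau> "\<lambda>x. \<sigma> (\<theta> x)"
  proof
    show "T.averaging" by (rule T.factor_averaging) fact
    show "P.averaging"
      by (rule pullback_averaging) (rule S.tracial_state_axioms, rule S.factor_averaging, fact)
  qed
  show ?thesis using traces_agree[OF x] by simp
qed

end

lemma faithful_normal_tracial_state_locale:
  assumes "von_neumann_algebra M" "faithful_normal_tracial_state M \<tau>"
  shows "normal_tracial_state M \<tau>"
  using assms unfolding faithful_normal_tracial_state_def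
  by unfold_locales (auto simp: von_neumann_algebra_def)

section \<open>The semiflow of an \<open>E\<^sub>0\<close>-semigroup\<close>

locale vn_semigroup = vn_algebra M for M :: "'h::chilbert_space op set" +
  fixes \<alpha> :: "real \<Rightarrow> 'h op \<Rightarrow> 'h op"
  assumes E0: "E0_semigroup M \<alpha>"
begin

lemma alpha_hom: "0 \<le> t \<Longrightarrow> star_hom M M (\<alpha> t)"
  and alpha_id: "0 \<le> t \<Longrightarrow> \<alpha> t id_blinfun = id_blinfun"
  and alpha_alpha: "0 \<le> s \<Longrightarrow> 0 \<le> t \<Longrightarrow> x \<in> M \<Longrightarrow> \<alpha> s (\<alpha> t x) = \<alpha> (s + t) x"
  using E0 by (auto simp: E0_semigroup_def normal_unital_endo_def)

lemmas alpha_simps = star_hom_simps[OF alpha_hom]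

lemma alpha_mem: "0 \<le> t \<Longrightarrow> x \<in> M \<Longrightarrow> \<alpha> t x \<in> M"
  by (rule alpha_simps(6))

lemma norm_alpha: "0 \<le> t \<Longrightarrow> x \<in> M \<Longrightarrow> norm (\<alpha> t x) \<le> norm x"
  by (rule star_hom_contractive[OF alpha_hom alpha_id]) auto

lemma tendsto_alpha:
  assumes "X \<longlonglongrightarrow> x" "\<And>n. X n \<in> M" "x \<in> M" "0 \<le> t"
  shows "(\<lambda>n. \<alpha> t (X n)) \<longlonglongrightarrow> \<alpha> t x"
proof -
  have le: "norm (\<alpha> t (X n) - \<alpha> t x) \<le> norm (X n - x)" for n
    using norm_alpha[OF assms(4), of "X n - x"] alpha_simps(5)[OF assms(4) assms(2)[of n] assms(3)] assms
    by simp
  have "(\<lambda>n. norm (X n - x)) \<longlonglongrightarrow> 0" by (rule tendsto_norm_zero[OF LIM_zero[OF assms(1)]])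
  then have "(\<lambda>n. \<alpha> t (X n) - \<alpha> t x) \<longlonglongrightarrow> 0"
    by (rule Lim_null_comparison[rotated]) (simp add: le)
  then show ?thesis by (rule LIM_zero_cancel)
qed

lemma relative_commutant_iff:
  "0 \<le> t \<Longrightarrow> x \<in> relative_commutant M \<alpha> t \<longleftrightarrow> x \<in> M \<and> (\<forall>y\<in>M. x o\<^sub>L \<alpha> t y = \<alpha> t y o\<^sub>L x)"
  by (auto simp: relative_commutant_def commutant_def)

text \<open>The ranges shrink: the range of \<alpha> t is the image under \<alpha> s of that of
  \<alpha> (t - s), so the commutants grow.\<close>

lemma relative_commutant_mono:
  assumes "0 \<le> s" "s \<le> t" shows "relative_commutant M \<alpha> s \<subseteq> relative_commutant M \<alpha> t"
proof -
  have "\<alpha> t ` M \<subseteq> \<alpha> s ` M"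
  proof safe
    fix y assume y: "y \<in> M"
    have "\<alpha> t y = \<alpha> s (\<alpha> (t - s) y)" using assms y alpha_alpha[of s "t - s" y] by simp
    then show "\<alpha> t y \<in> \<alpha> s ` M" using assms y alpha_mem[of "t - s" y] by auto
  qed
  then show ?thesis by (auto simp: relative_commutant_def commutant_def)
qed

text \<open>Applying \<alpha> s to the commutation relation at time t gives the one at time s + t;
  hence the semigroup maps the union of the relative commutants into itself.\<close>

lemma alpha_relative_commutant:
  assumes "0 \<le> s" "0 \<le> t" "x \<in> relative_commutant M \<alpha> t"
  shows "\<alpha> s x \<in> relative_commutant M \<alpha> (s + t)"
proof -
  have x: "x \<in> M" "\<And>y. y \<in> M \<Longrightarrow> x o\<^sub>L \<alpha> t y = \<alpha> t y o\<^sub>L x"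
    using assms by (auto simp: relative_commutant_iff)
  have "\<alpha> s x o\<^sub>L \<alpha> (s + t) y = \<alpha> (s + t) y o\<^sub>L \<alpha> s x" if y: "y \<in> M" for y
  proof -
    have ty: "\<alpha> t y \<in> M" using assms y alpha_mem by blast
    have "\<alpha> s (x o\<^sub>L \<alpha> t y) = \<alpha> s (\<alpha> t y o\<^sub>L x)" using x y by simp
    then show ?thesis
      using alpha_simps(2)[OF assms(1) x(1) ty] alpha_simps(2)[OF assms(1) ty x(1)]
        alpha_alpha[OF assms(1,2) y] by simp
  qed
  then show ?thesis
    using x(1) assms alpha_mem by (simp add: relative_commutant_iff)
qed

definition local_algebra :: "'h op set" where
  "local_algebra = (\<Union>t\<in>{0..}. relative_commutant M \<alpha> t)"

lemma semiflow_algebra_eq: "semiflow_algebra M \<alpha> = closure local_algebra"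
  by (simp add: semiflow_algebra_def local_algebra_def)

lemma semiflow_algebraI:
  "X \<longlonglongrightarrow> x \<Longrightarrow> (\<And>n. X n \<in> local_algebra) \<Longrightarrow> x \<in> semiflow_algebra M \<alpha>"
  unfolding semiflow_algebra_eq closure_sequential by (intro exI[of _ X]) simp

lemma semiflow_algebra_obtain:
  assumes "x \<in> semiflow_algebra M \<alpha>"
  obtains X where "\<And>n. X n \<in> local_algebra" "X \<longlonglongrightarrow> x"
  using assms unfolding semiflow_algebra_eq closure_sequential by metis

text \<open>Integer times suffice by monotonicity, which matches the sequence of integer times in
  the definition of \<gamma>.\<close>

lemma local_algebra_obtain:
  assumes "x \<in> local_algebra"
  obtains n :: nat where "x \<in> relative_commutant M \<alpha> (real n)"
proof -
  obtain t where t: "0 \<le> t" "x \<in> relative_commutant M \<alpha> t"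
    using assms by (auto simp: local_algebra_def)
  obtain n :: nat where "t \<le> real n" using real_arch_simple by blast
  with t show thesis using that relative_commutant_mono by blast
qed

lemma local_algebraI: "0 \<le> t \<Longrightarrow> x \<in> relative_commutant M \<alpha> t \<Longrightarrow> x \<in> local_algebra"
  by (auto simp: local_algebra_def)

lemma local_algebra_subset: "local_algebra \<subseteq> M"
  by (auto simp: local_algebra_def relative_commutant_def)

lemma semiflow_algebra_subset: "semiflow_algebra M \<alpha> \<subseteq> M"
  unfolding semiflow_algebra_eq by (rule closure_minimal[OF local_algebra_subset closed_algebra])

lemma local_algebra_closed:
  assumes "x \<in> local_algebra" "y \<in> local_algebra"
  shows "x + y \<in> local_algebra" "x o\<^sub>L y \<in> local_algebra" "adj x \<in> local_algebra"
proof -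
  obtain m n :: nat where mn: "x \<in> relative_commutant M \<alpha> (real m)" "y \<in> relative_commutant M \<alpha> (real n)"
    using assms local_algebra_obtain by metis
  define k where "k = real (max m n)"
  have k: "0 \<le> k" "real m \<le> k" "real n \<le> k" by (auto simp: k_def)
  have xy: "x \<in> relative_commutant M \<alpha> k" "y \<in> relative_commutant M \<alpha> k"
    using mn k relative_commutant_mono[of "real m" k] relative_commutant_mono[of "real n" k] by auto
  have im: "\<alpha> k ` M \<subseteq> bounded_ops" using alpha_mem[OF k(1)] by auto
  have im_adj: "adj s \<in> \<alpha> k ` M" if s: "s \<in> \<alpha> k ` M" for s
  proof -
    obtain z where z: "z \<in> M" "s = \<alpha> k z" using s by (rule imageE)
    then have "adj s = \<alpha> k (adj z)" using alpha_simps(3)[OF k(1) z(1) z(1)] by simp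
    then show ?thesis using z by blast
  qed
  have "x + y \<in> relative_commutant M \<alpha> k" "x o\<^sub>L y \<in> relative_commutant M \<alpha> k"
    using xy by (auto simp: relative_commutant_def intro: commutant_add commutant_compose)
  moreover have "adj x \<in> relative_commutant M \<alpha> k"
    using xy commutant_adj[OF _ im im_adj] by (simp add: relative_commutant_def)
  ultimately show "x + y \<in> local_algebra" "x o\<^sub>L y \<in> local_algebra" "adj x \<in> local_algebra"
    using local_algebraI[OF k(1)] by blast+
qed

lemma scalar_local_algebra: "scalar_op c \<in> local_algebra"
proof (rule local_algebraI[of 0])
  show "scalar_op c \<in> relative_commutant M \<alpha> 0"
    using alpha_mem[of 0] by (auto simp: relative_commutant_iff scalar_op_commute)
qed simp

lemma semiflow_algebra_closed:
  assumes "x \<in> semiflow_algebra M \<alpha>" "y \<in> semiflow_algebra M \<alpha>"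
  shows "x + y \<in> semiflow_algebra M \<alpha>" "x o\<^sub>L y \<in> semiflow_algebra M \<alpha>" "adj x \<in> semiflow_algebra M \<alpha>"
proof -
  obtain X Y where X: "\<And>n. X n \<in> local_algebra" "X \<longlonglongrightarrow> x" and Y: "\<And>n. Y n \<in> local_algebra" "Y \<longlonglongrightarrow> y"
    using semiflow_algebra_obtain[OF assms(1)] semiflow_algebra_obtain[OF assms(2)] by metis
  have "(\<lambda>n. X n + Y n) \<longlonglongrightarrow> x + y" "(\<lambda>n. X n o\<^sub>L Y n) \<longlonglongrightarrow> (x o\<^sub>L y)"
    by (intro tendsto_intros X Y)+
  moreover have "(\<lambda>n. adj (X n)) \<longlonglongrightarrow> adj x"
    using X local_algebra_subset assms semiflow_algebra_subset by (intro tendsto_adj) auto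
  ultimately show "x + y \<in> semiflow_algebra M \<alpha>" "x o\<^sub>L y \<in> semiflow_algebra M \<alpha>" "adj x \<in> semiflow_algebra M \<alpha>"
    using local_algebra_closed[OF X(1) Y(1)] by (auto intro!: semiflow_algebraI)
qed

lemma scalar_semiflow_algebra: "scalar_op c \<in> semiflow_algebra M \<alpha>"
  unfolding semiflow_algebra_eq using scalar_local_algebra closure_subset by blast

lemma alpha_semiflow_algebra:
  assumes s: "0 \<le> s" and x: "x \<in> semiflow_algebra M \<alpha>"
  shows "\<alpha> s x \<in> semiflow_algebra M \<alpha>"
proof -
  obtain X where X: "\<And>n. X n \<in> local_algebra" "X \<longlonglongrightarrow> x"
    using semiflow_algebra_obtain[OF x] by metis
  have "\<alpha> s (X n) \<in> local_algebra" for n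
    using X(1)[of n] alpha_relative_commutant[OF s] s local_algebraI local_algebra_obtain
    by (metis add_nonneg_nonneg of_nat_0_le_iff)
  moreover have "(\<lambda>n. \<alpha> s (X n)) \<longlonglongrightarrow> \<alpha> s x"
    using X x local_algebra_subset semiflow_algebra_subset by (intro tendsto_alpha s) auto
  ultimately show ?thesis by (intro semiflow_algebraI)
qed

end

section \<open>The isomorphism of semiflows induced by a cocycle conjugacy\<close>

lemma star_iso_compose: "star_iso A B f \<Longrightarrow> star_iso B C g \<Longrightarrow> star_iso A C (g \<circ> f)"
  unfolding star_iso_def by (auto simp: star_hom_def intro: bij_betw_trans)

locale cocycle_conjugacy = vn_iso M N \<theta> + SM: vn_semigroup M \<alpha> + SN: vn_semigroup N \<beta>
  for M :: "'h::chilbert_space op set" and N :: "'k::chilbert_space op set" and \<theta> \<alpha> \<beta> +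
  fixes U :: "real \<Rightarrow> 'h op"
  assumes coc: "cocycle M \<alpha> U"
    and conj: "\<forall>t\<ge>0. \<forall>y\<in>N. \<beta> t y = \<theta> (perturb \<alpha> U t (inv_into M \<theta> y))"
begin

lemma U_unitary: "0 \<le> t \<Longrightarrow> unitary_in M (U t)"
  using coc by (simp add: cocycle_def)

lemma U_cocycle: "0 \<le> s \<Longrightarrow> 0 \<le> t \<Longrightarrow> U (s + t) = U s o\<^sub>L \<alpha> s (U t)"
  using coc by (simp add: cocycle_def)

text \<open>\<theta> after conjugation by U t: an isomorphism of all of M onto N, whose values on
  the relative commutant at time t no longer change at later times.\<close>

definition \<kappa> :: "real \<Rightarrow> 'h op \<Rightarrow> 'k op" where
  "\<kappa> t x = \<theta> (U t o\<^sub>L (x o\<^sub>L adj (U t)))"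

lemma kappa_iso:
  assumes t: "0 \<le> t" shows "star_iso M N (\<kappa> t)"
proof -
  note u = M.unitary_inD[OF U_unitary[OF t]]
  define \<nu> where "\<nu> x = U t o\<^sub>L (x o\<^sub>L adj (U t))" for x
  have cancel: "adj (U t) o\<^sub>L (U t o\<^sub>L z) = z" "U t o\<^sub>L (adj (U t) o\<^sub>L z) = z" for z :: "'h op"
    using u by (auto intro: compose_cancel)
  have \<nu>M: "\<nu> x \<in> M" if "x \<in> M" for x using that u by (simp add: \<nu>_def)
  have "star_hom M M \<nu>"
    unfolding star_hom_def
  proof (intro conjI ballI allI)
    fix x y c assume x: "x \<in> M"
    show "\<nu> x \<in> M" using \<nu>M x .
    show "\<nu> (adj x) = adj (\<nu> x)"
      using x u by (simp add: \<nu>_def adj_compose compose_assoc)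
    have comm: "scalar_op c o\<^sub>L U t = U t o\<^sub>L scalar_op c"
      using u by (intro scalar_op_commute) auto
    have "\<nu> (scalar_op c o\<^sub>L x) = (U t o\<^sub>L scalar_op c) o\<^sub>L (x o\<^sub>L adj (U t))"
      by (simp only: \<nu>_def compose_assoc)
    also have "\<dots> = scalar_op c o\<^sub>L \<nu> x"
      by (simp only: \<nu>_def compose_assoc flip: comm)
    finally show "\<nu> (scalar_op c o\<^sub>L x) = scalar_op c o\<^sub>L \<nu> x" .
    assume y: "y \<in> M"
    show "\<nu> (x + y) = \<nu> x + \<nu> y" by (simp add: \<nu>_def compose_bilinear)
    show "\<nu> (x o\<^sub>L y) = \<nu> x o\<^sub>L \<nu> y" by (simp add: \<nu>_def compose_assoc cancel)
  qed
  moreover have "bij_betw \<nu> M M"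
  proof (rule bij_betw_byWitness[where f' = "\<lambda>x. adj (U t) o\<^sub>L (x o\<^sub>L U t)"])
    show "\<forall>a\<in>M. adj (U t) o\<^sub>L (\<nu> a o\<^sub>L U t) = a"
      using u by (simp add: \<nu>_def compose_assoc cancel)
    show "\<forall>a\<in>M. \<nu> (adj (U t) o\<^sub>L (a o\<^sub>L U t)) = a"
      using u by (simp add: \<nu>_def compose_assoc cancel)
    show "\<nu> ` M \<subseteq> M" using \<nu>M by blast
    show "(\<lambda>x. adj (U t) o\<^sub>L (x o\<^sub>L U t)) ` M \<subseteq> M" using u by auto
  qed
  ultimately have "star_iso M N (\<theta> \<circ> \<nu>)"
    using iso star_iso_def star_iso_compose by blast
  moreover have "\<theta> \<circ> \<nu> = \<kappa> t" by (auto simp: \<kappa>_def \<nu>_def)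
  ultimately show ?thesis by simp
qed

lemma vn_iso_kappa: "0 \<le> t \<Longrightarrow> vn_iso M N (\<kappa> t)"
  using kappa_iso by unfold_locales

text \<open>The conjugacy relation freed of the inverse of \<theta>; all later facts about \<beta>
  rest on this form.\<close>

lemma beta_theta:
  assumes "0 \<le> t" "z \<in> M" shows "\<beta> t (\<theta> z) = \<kappa> t (\<alpha> t z)"
proof -
  have "inv_into M \<theta> (\<theta> z) = z" using assms bij by (simp add: bij_betw_def)
  then have "\<beta> t (\<theta> z) = \<theta> (perturb \<alpha> U t z)"
    using conj assms theta_mem by metis
  then show ?thesis by (simp add: perturb_def \<kappa>_def compose_assoc)
qed

text \<open>\<open>U\<^sub>t = U\<^sub>s \<alpha>\<^sub>s(U\<^bsub>t-s\<^esub>)\<close>, and the second factor commutes with \<open>\<alpha>\<^sub>s(M)'\<close>.\<close>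

lemma kappa_eq:
  assumes st: "0 \<le> s" "s \<le> t" and x: "x \<in> relative_commutant M \<alpha> s"
  shows "\<kappa> t x = \<kappa> s x"
proof -
  define w where "w = \<alpha> s (U (t - s))"
  note u = M.unitary_inD[OF U_unitary[of "t - s"]]
  have ts: "0 \<le> t - s" using st by simp
  have xM: "x \<in> M" and "x o\<^sub>L \<alpha> s (U (t - s)) = \<alpha> s (U (t - s)) o\<^sub>L x"
    using x st u[OF ts] by (auto simp: SM.relative_commutant_iff)
  then have comm: "w o\<^sub>L x = x o\<^sub>L w" by (simp add: w_def)
  have wM: "w \<in> M" unfolding w_def by (rule SM.alpha_mem[OF st(1) u(1)[OF ts]])
  have "\<alpha> s (U (t - s) o\<^sub>L adj (U (t - s))) = id_blinfun"
    using u[OF ts] st SM.alpha_id by simp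
  then have ww: "w o\<^sub>L adj w = id_blinfun"
    using SM.alpha_simps(2)[OF st(1) u(1)[OF ts] u(2)[OF ts]] SM.alpha_simps(3)[OF st(1) u(1)[OF ts] u(1)[OF ts]]
    by (simp add: w_def)
  have us: "U s \<in> M" using M.unitary_inD U_unitary st by blast
  have "U t = U s o\<^sub>L w" using U_cocycle[OF st(1) ts] by (simp add: w_def)
  then have "U t o\<^sub>L (x o\<^sub>L adj (U t)) = U s o\<^sub>L ((w o\<^sub>L x) o\<^sub>L (adj w o\<^sub>L adj (U s)))"
    using us wM by (simp add: adj_compose compose_assoc)
  also have "\<dots> = U s o\<^sub>L (x o\<^sub>L ((w o\<^sub>L adj w) o\<^sub>L adj (U s)))"
    unfolding comm by (simp only: compose_assoc)
  also have "\<dots> = U s o\<^sub>L (x o\<^sub>L adj (U s))" by (simp add: ww)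
  finally show ?thesis by (simp add: \<kappa>_def)
qed

text \<open>By \<open>beta_theta\<close> the range of \<beta> t is the image under \<kappa> t of the
  range of \<alpha> t, and an isomorphism carries relative commutants to relative
  commutants.\<close>

lemma kappa_image:
  assumes t: "0 \<le> t" and x: "x \<in> M"
  shows "\<kappa> t x \<in> relative_commutant N \<beta> t \<longleftrightarrow> x \<in> relative_commutant M \<alpha> t"
proof -
  interpret K: vn_iso M N "\<kappa> t" using vn_iso_kappa t .
  have eq: "(\<kappa> t x o\<^sub>L \<beta> t (\<theta> z) = \<beta> t (\<theta> z) o\<^sub>L \<kappa> t x) \<longleftrightarrow> (x o\<^sub>L \<alpha> t z = \<alpha> t z o\<^sub>L x)"
    if z: "z \<in> M" for z
  proof -
    have az: "\<alpha> t z \<in> M" using SM.alpha_mem t z by blast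
    have "(\<kappa> t x o\<^sub>L \<beta> t (\<theta> z) = \<beta> t (\<theta> z) o\<^sub>L \<kappa> t x) \<longleftrightarrow> \<kappa> t (x o\<^sub>L \<alpha> t z) = \<kappa> t (\<alpha> t z o\<^sub>L x)"
      using K.theta_simps(2)[OF x az] K.theta_simps(2)[OF az x] beta_theta[OF t z] by simp
    also have "\<dots> \<longleftrightarrow> x o\<^sub>L \<alpha> t z = \<alpha> t z o\<^sub>L x"
      using K.inj az x M.compose_mem by metis
    finally show ?thesis .
  qed
  have "(\<forall>y\<in>N. \<kappa> t x o\<^sub>L \<beta> t y = \<beta> t y o\<^sub>L \<kappa> t x) \<longleftrightarrow> (\<forall>z\<in>M. \<kappa> t x o\<^sub>L \<beta> t (\<theta> z) = \<beta> t (\<theta> z) o\<^sub>L \<kappa> t x)"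
    using surj theta_mem by metis
  then show ?thesis
    using t x K.theta_mem eq by (simp add: SM.relative_commutant_iff SN.relative_commutant_iff)
qed

text \<open>By the cocycle identity, conjugation by U (s + t) after \<alpha> s equals conjugation by
  U s after \<alpha> s after conjugation by U t. The time shift disappears on local elements, where
  \<kappa> is eventually constant in time.\<close>

lemma kappa_intertwines:
  assumes st: "0 \<le> s" "0 \<le> t" and x: "x \<in> M"
  shows "\<kappa> (s + t) (\<alpha> s x) = \<beta> s (\<kappa> t x)"
proof -
  note ut = M.unitary_inD[OF U_unitary[OF st(2)]]
  note us = M.unitary_inD[OF U_unitary[OF st(1)]]
  have wM: "U t o\<^sub>L (x o\<^sub>L adj (U t)) \<in> M" using ut x by auto
  have "\<beta> s (\<kappa> t x) = \<kappa> s (\<alpha> s (U t o\<^sub>L (x o\<^sub>L adj (U t))))"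
    using beta_theta[OF st(1) wM] by (simp add: \<kappa>_def[of t])
  also have "\<alpha> s (U t o\<^sub>L (x o\<^sub>L adj (U t))) = \<alpha> s (U t) o\<^sub>L (\<alpha> s x o\<^sub>L adj (\<alpha> s (U t)))"
    using ut x st by (simp add: SM.alpha_simps)
  finally show ?thesis
    using us ut st x SM.alpha_mem by (simp add: \<kappa>_def U_cocycle adj_compose compose_assoc)
qed

text \<open>On a local element the sequence is eventually constant, and isometry of each \<kappa>
  makes it Cauchy on the norm closure. A limit covers both cases at once, in place of an extension
  from a dense subalgebra.\<close>

definition \<gamma> :: "'h op \<Rightarrow> 'k op" where
  "\<gamma> x = lim (\<lambda>n. \<kappa> (real n) x)"

lemma kappa_tendsto_gamma:
  assumes x: "x \<in> semiflow_algebra M \<alpha>"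
  shows "(\<lambda>n. \<kappa> (real n) x) \<longlonglongrightarrow> \<gamma> x"
proof -
  have xM: "x \<in> M" using x SM.semiflow_algebra_subset by blast
  have "Cauchy (\<lambda>n. \<kappa> (real n) x)"
  proof (rule CauchyI)
    fix e :: real assume "0 < e"
    then obtain y where y: "y \<in> SM.local_algebra" "norm (x - y) < e / 2"
      using x unfolding SM.semiflow_algebra_eq closure_approachable
      by (metis dist_commute dist_norm half_gt_zero)
    have yM: "y \<in> M" using y SM.local_algebra_subset by blast
    obtain n0 :: nat where n0: "y \<in> relative_commutant M \<alpha> (real n0)"
      using SM.local_algebra_obtain y by blast
    have near: "norm (\<kappa> (real n) x - \<kappa> (real n0) y) < e / 2" if n: "n0 \<le> n" for n
    proof -
      interpret K: vn_iso M N "\<kappa> (real n)" by (rule vn_iso_kappa) simp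
      have "\<kappa> (real n) x - \<kappa> (real n0) y = \<kappa> (real n) (x - y)"
        using kappa_eq[OF _ _ n0, of "real n"] n K.theta_simps(5)[OF xM yM] by simp
      then show ?thesis using K.norm_theta[of "x - y"] xM yM y by simp
    qed
    have "norm (\<kappa> (real m) x - \<kappa> (real n) x) < e" if "n0 \<le> m" "n0 \<le> n" for m n
      using norm_diff_triangle_less[OF near[OF that(1)], of "\<kappa> (real n) x" "e / 2"] near[OF that(2)]
      by (simp add: norm_minus_commute)
    then show "\<exists>M. \<forall>m\<ge>M. \<forall>n\<ge>M. norm (\<kappa> (real m) x - \<kappa> (real n) x) < e" by blast
  qed
  then show ?thesis
    unfolding \<gamma>_def by (simp add: Cauchy_convergent_iff convergent_LIMSEQ_iff)
qed

lemma gamma_local: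
  assumes t: "0 \<le> t" and x: "x \<in> relative_commutant M \<alpha> t"
  shows "\<gamma> x = \<kappa> t x"
proof -
  obtain n0 :: nat where n0: "t \<le> real n0" using real_arch_simple by blast
  have "(\<lambda>n. \<kappa> (real n) x) \<longlonglongrightarrow> \<kappa> t x"
  proof (rule tendsto_eventually, rule eventually_sequentiallyI[of n0])
    fix n assume "n0 \<le> n"
    then have "t \<le> real n" using n0 by linarith
    then show "\<kappa> (real n) x = \<kappa> t x" by (rule kappa_eq[OF t _ x])
  qed
  then show ?thesis unfolding \<gamma>_def by (rule limI)
qed

lemma gamma_limits:
  assumes x: "x \<in> semiflow_algebra M \<alpha>" and y: "y \<in> semiflow_algebra M \<alpha>"
  shows "\<gamma> (x + y) = \<gamma> x + \<gamma> y" "\<gamma> (x o\<^sub>L y) = \<gamma> x o\<^sub>L \<gamma> y" "\<gamma> (adj x) = adj (\<gamma> x)"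
    "\<gamma> (scalar_op c o\<^sub>L x) = scalar_op c o\<^sub>L \<gamma> x" "norm (\<gamma> x - \<gamma> y) = norm (x - y)" "\<gamma> x \<in> N"
proof -
  have xy: "x \<in> M" "y \<in> M" using x y SM.semiflow_algebra_subset by auto
  note lims = kappa_tendsto_gamma[OF x] kappa_tendsto_gamma[OF y]
  have K: "vn_iso M N (\<kappa> (real n))" for n by (rule vn_iso_kappa) simp
  note ks = vn_iso.theta_simps[OF K xy] vn_iso.theta_mem[OF K xy(1)]
  show N: "\<gamma> x \<in> N"
    by (rule closed_sequentially[OF N.closed_algebra ks(7) lims(1)])
  show "\<gamma> (x + y) = \<gamma> x + \<gamma> y"
    by (rule LIMSEQ_unique[OF kappa_tendsto_gamma[OF SM.semiflow_algebra_closed(1)[OF x y]]])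
      (unfold ks, intro tendsto_intros lims)
  show "\<gamma> (x o\<^sub>L y) = \<gamma> x o\<^sub>L \<gamma> y"
    by (rule LIMSEQ_unique[OF kappa_tendsto_gamma[OF SM.semiflow_algebra_closed(2)[OF x y]]])
      (unfold ks, intro tendsto_intros lims)
  show "\<gamma> (adj x) = adj (\<gamma> x)"
    by (rule LIMSEQ_unique[OF kappa_tendsto_gamma[OF SM.semiflow_algebra_closed(3)[OF x y]]])
      (unfold ks, intro tendsto_adj lims N.bdd ks N)
  have "\<kappa> (real n) (scalar_op c o\<^sub>L x) = scalar_op c o\<^sub>L \<kappa> (real n) x" for n
    using vn_iso.theta_simps(2)[OF K M.scalar_mem xy(1)] vn_iso.theta_scalar[OF K] by simp
  note kc = this
  show "\<gamma> (scalar_op c o\<^sub>L x) = scalar_op c o\<^sub>L \<gamma> x"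
    by (rule LIMSEQ_unique[OF kappa_tendsto_gamma[OF SM.semiflow_algebra_closed(2)[OF SM.scalar_semiflow_algebra x]]])
      (unfold kc, intro tendsto_intros lims)
  have "norm (\<kappa> (real n) x - \<kappa> (real n) y) = norm (x - y)" for n
    using vn_iso.norm_theta[OF K M.diff_mem[OF xy]] by (simp add: ks)
  then have "(\<lambda>n. norm (\<kappa> (real n) x - \<kappa> (real n) y)) \<longlonglongrightarrow> norm (x - y)" by simp
  moreover have "(\<lambda>n. norm (\<kappa> (real n) x - \<kappa> (real n) y)) \<longlonglongrightarrow> norm (\<gamma> x - \<gamma> y)"
    by (intro tendsto_intros lims)
  ultimately show "norm (\<gamma> x - \<gamma> y) = norm (x - y)" using LIMSEQ_unique by blast
qed

lemma tendsto_gamma: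
  assumes "X \<longlonglongrightarrow> x" "\<And>n. X n \<in> semiflow_algebra M \<alpha>" "x \<in> semiflow_algebra M \<alpha>"
  shows "(\<lambda>n. \<gamma> (X n)) \<longlonglongrightarrow> \<gamma> x"
proof -
  have "(\<lambda>n. norm (X n - x)) \<longlonglongrightarrow> 0" by (rule tendsto_norm_zero[OF LIM_zero[OF assms(1)]])
  then have "(\<lambda>n. norm (\<gamma> (X n) - \<gamma> x)) \<longlonglongrightarrow> 0"
    unfolding gamma_limits(5)[OF assms(2,3)] .
  then show ?thesis by (rule LIM_zero_cancel[OF tendsto_norm_zero_cancel])
qed

lemma local_subset: "SM.local_algebra \<subseteq> semiflow_algebra M \<alpha>"
  unfolding SM.semiflow_algebra_eq by (rule closure_subset)

lemma gamma_image_local: "\<gamma> ` SM.local_algebra = SN.local_algebra"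
proof
  show "\<gamma> ` SM.local_algebra \<subseteq> SN.local_algebra"
  proof safe
    fix x assume "x \<in> SM.local_algebra"
    then obtain n :: nat where n: "x \<in> relative_commutant M \<alpha> (real n)"
      using SM.local_algebra_obtain by blast
    moreover from n have "x \<in> M" by (simp add: relative_commutant_def)
    ultimately show "\<gamma> x \<in> SN.local_algebra"
      using kappa_image[of "real n" x] gamma_local[of "real n" x] SN.local_algebraI[of "real n"] by simp
  qed
  show "SN.local_algebra \<subseteq> \<gamma> ` SM.local_algebra"
  proof
    fix y assume "y \<in> SN.local_algebra"
    then obtain n :: nat where n: "y \<in> relative_commutant N \<beta> (real n)"
      using SN.local_algebra_obtain by blast
    interpret K: vn_iso M N "\<kappa> (real n)" by (rule vn_iso_kappa) simp
    have "y \<in> N" using n by (simp add: relative_commutant_def)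
    then obtain x where x: "x \<in> M" "\<kappa> (real n) x = y" using K.surj by blast
    then have "x \<in> relative_commutant M \<alpha> (real n)" using n kappa_image[of "real n" x] by simp
    then show "y \<in> \<gamma> ` SM.local_algebra"
      using gamma_local[of "real n" x] x SM.local_algebraI[of "real n" x] by auto
  qed
qed

lemma gamma_iso: "star_iso (semiflow_algebra M \<alpha>) (semiflow_algebra N \<beta>) \<gamma>"
proof -
  have mem: "\<gamma> x \<in> semiflow_algebra N \<beta>" if x: "x \<in> semiflow_algebra M \<alpha>" for x
  proof -
    obtain X where X: "\<And>n. X n \<in> SM.local_algebra" "X \<longlonglongrightarrow> x"
      using SM.semiflow_algebra_obtain[OF x] by metis
    have "(\<lambda>n. \<gamma> (X n)) \<longlonglongrightarrow> \<gamma> x"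
      using X local_subset x by (intro tendsto_gamma) auto
    moreover have "\<gamma> (X n) \<in> SN.local_algebra" for n using gamma_image_local X by blast
    ultimately show ?thesis by (intro SN.semiflow_algebraI)
  qed
  have onto: "y \<in> \<gamma> ` semiflow_algebra M \<alpha>" if y: "y \<in> semiflow_algebra N \<beta>" for y
  proof -
    obtain Y where Y: "\<And>n. Y n \<in> SN.local_algebra" "Y \<longlonglongrightarrow> y"
      using SN.semiflow_algebra_obtain[OF y] by metis
    have "\<exists>x. x \<in> SM.local_algebra \<and> \<gamma> x = Y n" for n
      using Y(1)[of n] unfolding gamma_image_local[symmetric] by auto
    then obtain X where X: "\<And>n. X n \<in> SM.local_algebra" "\<And>n. \<gamma> (X n) = Y n" by metis
    have XA: "X n \<in> semiflow_algebra M \<alpha>" for n using X(1) local_subset by blast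
    \<comment> \<open>Closed range: preimages of a convergent sequence are Cauchy because \<gamma>
      is isometric, and their limit stays in the closure.\<close>
    have "Cauchy Y" using Y(2) by (rule LIMSEQ_imp_Cauchy)
    then have "Cauchy X"
      using gamma_limits(5)[OF XA XA] by (simp add: Cauchy_def dist_norm X(2))
    then obtain x where x: "X \<longlonglongrightarrow> x" using Cauchy_convergent convergent_def by blast
    then have xA: "x \<in> semiflow_algebra M \<alpha>"
      using X(1) by (rule SM.semiflow_algebraI)
    have "(\<lambda>n. \<gamma> (X n)) \<longlonglongrightarrow> \<gamma> x" by (rule tendsto_gamma[OF x XA xA])
    then have "\<gamma> x = y" using Y(2) LIMSEQ_unique unfolding X(2) by blast
    then show ?thesis using xA by blast
  qed
  have "inj_on \<gamma> (semiflow_algebra M \<alpha>)"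
    using gamma_limits(5) by (intro inj_onI) (metis norm_eq_zero right_minus_eq)
  then have "bij_betw \<gamma> (semiflow_algebra M \<alpha>) (semiflow_algebra N \<beta>)"
    using mem onto by (auto simp: bij_betw_def)
  then show ?thesis
    using mem gamma_limits unfolding star_iso_def star_hom_def by blast
qed

lemma gamma_intertwines:
  assumes s: "0 \<le> s" and x: "x \<in> semiflow_algebra M \<alpha>"
  shows "\<gamma> (\<alpha> s x) = \<beta> s (\<gamma> x)"
proof -
  obtain X where X: "\<And>n. X n \<in> SM.local_algebra" "X \<longlonglongrightarrow> x"
    using SM.semiflow_algebra_obtain[OF x] by metis
  have XA: "X n \<in> semiflow_algebra M \<alpha>" for n using X(1) local_subset by blast
  have eq: "\<gamma> (\<alpha> s (X k)) = \<beta> s (\<gamma> (X k))" for k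
  proof -
    obtain n :: nat where n: "X k \<in> relative_commutant M \<alpha> (real n)"
      using SM.local_algebra_obtain X(1) by blast
    then have "X k \<in> M" by (simp add: relative_commutant_def)
    then show ?thesis
      using gamma_local[OF _ n] gamma_local[OF _ SM.alpha_relative_commutant[OF s _ n]]
        kappa_intertwines[OF s, of "real n" "X k"] s by simp
  qed
  have "(\<lambda>k. \<gamma> (\<alpha> s (X k))) \<longlonglongrightarrow> \<gamma> (\<alpha> s x)"
    using X(2) XA x s SM.semiflow_algebra_subset
    by (intro tendsto_gamma SM.tendsto_alpha SM.alpha_semiflow_algebra) auto
  moreover have "(\<lambda>k. \<beta> s (\<gamma> (X k))) \<longlonglongrightarrow> \<beta> s (\<gamma> x)"
    using gamma_limits(6)[OF XA XA] gamma_limits(6)[OF x x] tendsto_gamma[OF X(2) XA x] s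
    by (intro SN.tendsto_alpha) auto
  ultimately show ?thesis using LIMSEQ_unique unfolding eq by blast
qed

text \<open>Uniqueness of the trace applies to \<kappa> at each integer time, itself an isomorphism
  of M onto N; norm continuity of the trace passes this to the limit.\<close>

lemma trace_gamma:
  assumes "normal_tracial_state M \<tau>" "M \<inter> commutant M = range scalar_op"
    and "normal_tracial_state N \<sigma>" "N \<inter> commutant N = range scalar_op"
    and x: "x \<in> semiflow_algebra M \<alpha>"
  shows "\<sigma> (\<gamma> x) = \<tau> x"
proof -
  interpret S: normal_tracial_state N \<sigma> by fact
  have xM: "x \<in> M" using x SM.semiflow_algebra_subset by blast
  have K: "vn_iso M N (\<kappa> (real n))" for n by (rule vn_iso_kappa) simp
  have kN: "\<kappa> (real n) x \<in> N" for n by (rule vn_iso.theta_mem[OF K xM])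
  have gN: "\<gamma> x \<in> N" by (rule gamma_limits(6)[OF x x])
  have "cmod (\<tau> x - \<sigma> (\<gamma> x)) \<le> norm (\<kappa> (real n) x - \<gamma> x)" for n
  proof -
    have "\<tau> x - \<sigma> (\<gamma> x) = \<sigma> (\<kappa> (real n) x - \<gamma> x)"
      using vn_iso.trace_theta[OF K assms(1-4) xM] kN gN by (simp add: S.phi_diff)
    then show ?thesis using S.phi_le_norm[of "\<kappa> (real n) x - \<gamma> x"] kN gN by simp
  qed
  moreover have "(\<lambda>n. norm (\<kappa> (real n) x - \<gamma> x)) \<longlonglongrightarrow> 0"
    by (rule tendsto_norm_zero[OF LIM_zero[OF kappa_tendsto_gamma[OF x]]])
  ultimately have "cmod (\<tau> x - \<sigma> (\<gamma> x)) \<le> 0" using LIMSEQ_le_const by blast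
  then show ?thesis by simp
qed

end

section \<open>The induced unitary of the GNS spaces\<close>

text \<open>The semiflow algebra enters only as a *-subalgebra; the estimates for the trace norm
  come from the surrounding von Neumann algebra M.\<close>

locale tracial_subalgebra = tracial_state M \<phi> for M :: "'h::chilbert_space op set" and \<phi> +
  fixes A :: "'h op set"
  assumes subset: "A \<subseteq> M"
    and A_add: "x \<in> A \<Longrightarrow> y \<in> A \<Longrightarrow> x + y \<in> A"
    and A_compose: "x \<in> A \<Longrightarrow> y \<in> A \<Longrightarrow> x o\<^sub>L y \<in> A"
    and A_adj: "x \<in> A \<Longrightarrow> adj x \<in> A"
    and A_scalar: "scalar_op c \<in> A"
begin

lemma A_mem: "x \<in> A \<Longrightarrow> x \<in> M"
  using subset by blast

lemma A_diff: "x \<in> A \<Longrightarrow> y \<in> A \<Longrightarrow> x - y \<in> A"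
  using A_add[of x "scalar_op (-1) o\<^sub>L y"] A_compose[OF A_scalar, of y "-1"]
  by (simp add: scalar_op_minus compose_bilinear)

lemma gns_CauchyD: "X \<in> gns_Cauchy A \<phi> \<Longrightarrow> X n \<in> A"
  by (simp add: gns_Cauchy_def)

lemma gns_relD:
  "(X, Y) \<in> gns_rel A \<phi> \<Longrightarrow> X \<in> gns_Cauchy A \<phi>" "(X, Y) \<in> gns_rel A \<phi> \<Longrightarrow> Y \<in> gns_Cauchy A \<phi>"
  "(X, Y) \<in> gns_rel A \<phi> \<Longrightarrow> (\<lambda>n. gns_norm \<phi> (X n - Y n)) \<longlonglongrightarrow> 0"
  by (auto simp: gns_rel_def)

lemma equiv_gns_rel: "equiv (gns_Cauchy A \<phi>) (gns_rel A \<phi>)"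
proof (rule equivI)
  show "gns_rel A \<phi> \<subseteq> gns_Cauchy A \<phi> \<times> gns_Cauchy A \<phi>" by (auto simp: gns_rel_def)
  show "refl_on (gns_Cauchy A \<phi>) (gns_rel A \<phi>)"
  proof -
    have "gns_norm \<phi> 0 = 0" using gns_norm_scaleR[of 0 0] by simp
    then show ?thesis by (auto simp: refl_on_def gns_rel_def)
  qed
  show "sym (gns_rel A \<phi>)"
  proof (rule symI)
    fix X Y assume XY: "(X, Y) \<in> gns_rel A \<phi>"
    have "gns_norm \<phi> (Y n - X n) = gns_norm \<phi> (X n - Y n)" for n
      using XY gns_relD gns_CauchyD A_mem gns_norm_diff_commute by meson
    then show "(Y, X) \<in> gns_rel A \<phi>" using XY by (simp add: gns_rel_def)
  qed
  show "trans (gns_rel A \<phi>)"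
  proof (rule transI)
    fix X Y Z assume XY: "(X, Y) \<in> gns_rel A \<phi>" and YZ: "(Y, Z) \<in> gns_rel A \<phi>"
    note mem = A_mem[OF gns_CauchyD[OF gns_relD(1)[OF XY]]] A_mem[OF gns_CauchyD[OF gns_relD(1)[OF YZ]]]
      A_mem[OF gns_CauchyD[OF gns_relD(2)[OF YZ]]]
    have "(\<lambda>n. gns_norm \<phi> (X n - Z n)) \<longlonglongrightarrow> 0"
    proof (rule tendsto_sandwich[OF _ _ tendsto_const])
      show "\<forall>\<^sub>F n in sequentially. 0 \<le> gns_norm \<phi> (X n - Z n)"
        using mem by simp
      show "\<forall>\<^sub>F n in sequentially. gns_norm \<phi> (X n - Z n) \<le> gns_norm \<phi> (X n - Y n) + gns_norm \<phi> (Y n - Z n)"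
        using mem by (intro always_eventually allI gns_norm_diff_triangle)
      show "(\<lambda>n. gns_norm \<phi> (X n - Y n) + gns_norm \<phi> (Y n - Z n)) \<longlonglongrightarrow> 0"
        using tendsto_add[OF gns_relD(3)[OF XY] gns_relD(3)[OF YZ]] by simp
    qed
    then show "(X, Z) \<in> gns_rel A \<phi>" using gns_relD(1)[OF XY] gns_relD(2)[OF YZ] by (simp add: gns_rel_def)
  qed
qed

lemma gns_class_in_space: "X \<in> gns_Cauchy A \<phi> \<Longrightarrow> gns_class A \<phi> X \<in> gns_space A \<phi>"
  by (simp add: gns_class_def gns_space_def quotientI)

lemma gns_class_eqI: "(X, Y) \<in> gns_rel A \<phi> \<Longrightarrow> gns_class A \<phi> X = gns_class A \<phi> Y"
  unfolding gns_class_def using equiv_class_eq[OF equiv_gns_rel] .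

lemma gns_class_eqD:
  "gns_class A \<phi> X = gns_class A \<phi> Y \<Longrightarrow> Y \<in> gns_Cauchy A \<phi> \<Longrightarrow> (X, Y) \<in> gns_rel A \<phi>"
  unfolding gns_class_def by (rule eq_equiv_class[OF _ equiv_gns_rel])

lemma repr_props:
  assumes "\<xi> \<in> gns_space A \<phi>"
  shows "repr \<xi> \<in> gns_Cauchy A \<phi>" "gns_class A \<phi> (repr \<xi>) = \<xi>"
proof -
  obtain X where X: "X \<in> gns_Cauchy A \<phi>" "\<xi> = gns_rel A \<phi> `` {X}"
    using assms unfolding gns_space_def by (rule quotientE)
  have "X \<in> \<xi>" using X equiv_class_self[OF equiv_gns_rel] by simp
  then have "repr \<xi> \<in> \<xi>" unfolding repr_def by (rule someI[of "\<lambda>X. X \<in> \<xi>"])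
  then have rel: "(X, repr \<xi>) \<in> gns_rel A \<phi>" using X(2) by simp
  then show "repr \<xi> \<in> gns_Cauchy A \<phi>" by (rule gns_relD)
  show "gns_class A \<phi> (repr \<xi>) = \<xi>"
    using gns_class_eqI[OF rel] X(2) by (simp add: gns_class_def)
qed

text \<open>The operations on classes act on chosen representatives. This relation reduces
  statements about them to statements up to null sequences.\<close>

lemma repr_class_rel:
  "X \<in> gns_Cauchy A \<phi> \<Longrightarrow> (repr (gns_class A \<phi> X), X) \<in> gns_rel A \<phi>"
  by (rule gns_class_eqD) (simp_all add: repr_props gns_class_in_space)

lemma gns_Cauchy_add:
  assumes X: "X \<in> gns_Cauchy A \<phi>" and Y: "Y \<in> gns_Cauchy A \<phi>"
  shows "(\<lambda>n. X n + Y n) \<in> gns_Cauchy A \<phi>"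
  unfolding gns_Cauchy_def
proof safe
  show "X n + Y n \<in> A" for n using X Y A_add gns_CauchyD by blast
  fix e :: real assume "0 < e"
  then have "0 < e / 2" by simp
  obtain n1 where n1: "\<forall>m\<ge>n1. \<forall>n\<ge>n1. gns_norm \<phi> (X m - X n) < e / 2"
    using X \<open>0 < e / 2\<close> unfolding gns_Cauchy_def by blast
  obtain n2 where n2: "\<forall>m\<ge>n2. \<forall>n\<ge>n2. gns_norm \<phi> (Y m - Y n) < e / 2"
    using Y \<open>0 < e / 2\<close> unfolding gns_Cauchy_def by blast
  have "gns_norm \<phi> (X m + Y m - (X n + Y n)) < e" if "max n1 n2 \<le> m" "max n1 n2 \<le> n" for m n
  proof -
    have "X m + Y m - (X n + Y n) = (X m - X n) + (Y m - Y n)" by simp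
    also have "gns_norm \<phi> \<dots> \<le> gns_norm \<phi> (X m - X n) + gns_norm \<phi> (Y m - Y n)"
      using A_mem[OF gns_CauchyD[OF X]] A_mem[OF gns_CauchyD[OF Y]] by (intro gns_norm_triangle) auto
    also have "\<dots> < e / 2 + e / 2" using n1 n2 that by (intro add_strict_mono) auto
    finally show ?thesis by simp
  qed
  then show "\<exists>n0. \<forall>m\<ge>n0. \<forall>n\<ge>n0. gns_norm \<phi> (X m + Y m - (X n + Y n)) < e" by blast
qed

lemma gns_rel_add:
  assumes X: "(X, X') \<in> gns_rel A \<phi>" and Y: "(Y, Y') \<in> gns_rel A \<phi>"
  shows "((\<lambda>n. X n + Y n), (\<lambda>n. X' n + Y' n)) \<in> gns_rel A \<phi>"
proof -
  note C = gns_relD(1,2)[OF X] gns_relD(1,2)[OF Y]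
  note mem = C[THEN gns_CauchyD, THEN A_mem]
  have "(\<lambda>n. gns_norm \<phi> (X n + Y n - (X' n + Y' n))) \<longlonglongrightarrow> 0"
  proof (rule tendsto_sandwich[OF _ _ tendsto_const])
    show "\<forall>\<^sub>F n in sequentially. 0 \<le> gns_norm \<phi> (X n + Y n - (X' n + Y' n))"
      using mem by simp
    have "gns_norm \<phi> (X n + Y n - (X' n + Y' n)) \<le> gns_norm \<phi> (X n - X' n) + gns_norm \<phi> (Y n - Y' n)" for n
    proof -
      have "X n + Y n - (X' n + Y' n) = (X n - X' n) + (Y n - Y' n)" by simp
      also have "gns_norm \<phi> \<dots> \<le> gns_norm \<phi> (X n - X' n) + gns_norm \<phi> (Y n - Y' n)"
        using mem by (intro gns_norm_triangle) auto
      finally show ?thesis .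
    qed
    then show "\<forall>\<^sub>F n in sequentially. gns_norm \<phi> (X n + Y n - (X' n + Y' n))
        \<le> gns_norm \<phi> (X n - X' n) + gns_norm \<phi> (Y n - Y' n)" by simp
    show "(\<lambda>n. gns_norm \<phi> (X n - X' n) + gns_norm \<phi> (Y n - Y' n)) \<longlonglongrightarrow> 0"
      using tendsto_add[OF gns_relD(3)[OF X] gns_relD(3)[OF Y]] by simp
  qed
  then show ?thesis using C gns_Cauchy_add by (simp add: gns_rel_def)
qed

lemma gns_Cauchy_compose:
  assumes X: "X \<in> gns_Cauchy A \<phi>" and a: "a \<in> A"
  shows "(\<lambda>n. a o\<^sub>L X n) \<in> gns_Cauchy A \<phi>"
  unfolding gns_Cauchy_def
proof safe
  show "a o\<^sub>L X n \<in> A" for n using X A_compose a gns_CauchyD by blast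
  fix e :: real assume "0 < e"
  define \<delta> where "\<delta> = e / (norm a + 1)"
  have pos: "0 < norm a + 1" by (simp add: add_nonneg_pos)
  have "0 < \<delta>" using \<open>0 < e\<close> pos by (simp add: \<delta>_def)
  then obtain n1 where n1: "\<forall>m\<ge>n1. \<forall>n\<ge>n1. gns_norm \<phi> (X m - X n) < \<delta>"
    using X unfolding gns_Cauchy_def by blast
  have "gns_norm \<phi> ((a o\<^sub>L X m) - (a o\<^sub>L X n)) < e" if "n1 \<le> m" "n1 \<le> n" for m n
  proof -
    have d: "X m - X n \<in> M" using A_mem[OF gns_CauchyD[OF X]] by simp
    have "gns_norm \<phi> (a o\<^sub>L (X m - X n)) \<le> norm a * gns_norm \<phi> (X m - X n)"
      by (rule gns_norm_compose_left[OF A_mem[OF a] d])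
    also have "\<dots> \<le> norm a * \<delta>" using n1 that by (intro mult_left_mono) (auto intro: less_imp_le)
    also have "\<dots> < (norm a + 1) * \<delta>" using \<open>0 < \<delta>\<close> by simp
    also have "\<dots> = e" using pos by (simp add: \<delta>_def)
    finally show ?thesis by (simp add: compose_bilinear)
  qed
  then show "\<exists>n0. \<forall>m\<ge>n0. \<forall>n\<ge>n0. gns_norm \<phi> ((a o\<^sub>L X m) - (a o\<^sub>L X n)) < e" by blast
qed

lemma gns_rel_compose:
  assumes X: "(X, X') \<in> gns_rel A \<phi>" and a: "a \<in> A"
  shows "((\<lambda>n. a o\<^sub>L X n), (\<lambda>n. a o\<^sub>L X' n)) \<in> gns_rel A \<phi>"
proof -
  note C = gns_relD(1,2)[OF X]
  note mem = C[THEN gns_CauchyD, THEN A_mem] A_mem[OF a]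
  have "(\<lambda>n. gns_norm \<phi> ((a o\<^sub>L X n) - (a o\<^sub>L X' n))) \<longlonglongrightarrow> 0"
  proof (rule tendsto_sandwich[OF _ _ tendsto_const])
    show "\<forall>\<^sub>F n in sequentially. 0 \<le> gns_norm \<phi> ((a o\<^sub>L X n) - (a o\<^sub>L X' n))"
      using mem by simp
    show "\<forall>\<^sub>F n in sequentially. gns_norm \<phi> ((a o\<^sub>L X n) - (a o\<^sub>L X' n)) \<le> norm a * gns_norm \<phi> (X n - X' n)"
      using gns_norm_compose_left[OF mem(3), of "X _ - X' _"] mem by (simp add: compose_bilinear)
    show "(\<lambda>n. norm a * gns_norm \<phi> (X n - X' n)) \<longlonglongrightarrow> 0"
      using tendsto_mult_right_zero[OF gns_relD(3)[OF X]] by simp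
  qed
  then show ?thesis using C a gns_Cauchy_compose by (simp add: gns_rel_def)
qed

lemma gns_Cauchy_bounded:
  assumes X: "X \<in> gns_Cauchy A \<phi>"
  shows "\<exists>K n0. \<forall>n\<ge>n0. gns_norm \<phi> (X n) \<le> K"
proof -
  obtain n0 where n0: "\<forall>m\<ge>n0. \<forall>n\<ge>n0. gns_norm \<phi> (X m - X n) < 1"
    using X unfolding gns_Cauchy_def using zero_less_one by blast
  have "gns_norm \<phi> (X n) \<le> 1 + gns_norm \<phi> (X n0)" if "n0 \<le> n" for n
  proof -
    have "gns_norm \<phi> (X n - X n0) < 1" using n0 that by blast
    then show ?thesis
      using gns_norm_triangle[of "X n - X n0" "X n0"] A_mem[OF gns_CauchyD[OF X]] by simp
  qed
  then show ?thesis by blast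
qed

text \<open>The usual splitting of a difference of products, with Cauchy sequences eventually
  bounded. It compares two sequences of inner products without asserting that either converges,
  which suits \<open>lim_cong_null\<close>.\<close>

lemma gns_inner_rel:
  assumes X: "(X, X') \<in> gns_rel A \<phi>" and Y: "(Y, Y') \<in> gns_rel A \<phi>"
  shows "(\<lambda>n. \<phi> (adj (Y n) o\<^sub>L X n) - \<phi> (adj (Y' n) o\<^sub>L X' n)) \<longlonglongrightarrow> 0"
proof -
  note C = gns_relD(1,2)[OF X] gns_relD(1,2)[OF Y]
  note mem = C[THEN gns_CauchyD, THEN A_mem]
  obtain K n1 where K: "\<forall>n\<ge>n1. gns_norm \<phi> (Y n) \<le> K" using gns_Cauchy_bounded C(3) by blast
  obtain L n2 where L: "\<forall>n\<ge>n2. gns_norm \<phi> (X' n) \<le> L" using gns_Cauchy_bounded C(2) by blast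
  have bound: "cmod (\<phi> (adj (Y n) o\<^sub>L X n) - \<phi> (adj (Y' n) o\<^sub>L X' n))
      \<le> gns_norm \<phi> (X n - X' n) * K + L * gns_norm \<phi> (Y n - Y' n)" if n: "max n1 n2 \<le> n" for n
  proof -
    have "\<phi> (adj (Y n) o\<^sub>L X n) - \<phi> (adj (Y' n) o\<^sub>L X' n)
        = \<phi> (adj (Y n) o\<^sub>L (X n - X' n)) + \<phi> (adj (Y n - Y' n) o\<^sub>L X' n)"
      using mem by (simp add: compose_bilinear phi_diff adj_diff)
    also have "cmod \<dots> \<le> cmod (\<phi> (adj (Y n) o\<^sub>L (X n - X' n))) + cmod (\<phi> (adj (Y n - Y' n) o\<^sub>L X' n))"
      by (rule norm_triangle_ineq)
    also have "\<dots> \<le> gns_norm \<phi> (X n - X' n) * gns_norm \<phi> (Y n) + gns_norm \<phi> (X' n) * gns_norm \<phi> (Y n - Y' n)"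
      using mem by (intro add_mono phi_Cauchy_Schwarz) auto
    also have "\<dots> \<le> gns_norm \<phi> (X n - X' n) * K + L * gns_norm \<phi> (Y n - Y' n)"
      using mem K L n by (intro add_mono mult_left_mono mult_right_mono) auto
    finally show ?thesis .
  qed
  have lim: "(\<lambda>n. gns_norm \<phi> (X n - X' n) * K + L * gns_norm \<phi> (Y n - Y' n)) \<longlonglongrightarrow> 0"
    using tendsto_add[OF tendsto_mult_left_zero[OF gns_relD(3)[OF X]] tendsto_mult_right_zero[OF gns_relD(3)[OF Y]]]
    by simp
  show ?thesis
    by (rule Lim_null_comparison[OF _ lim], rule eventually_sequentiallyI[of "max n1 n2"], rule bound)
qed

end

text \<open>No convergence is needed: \<open>lim\<close> is determined by the set of limits.\<close>

lemma lim_cong_null: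
  fixes f g :: "nat \<Rightarrow> 'a::real_normed_vector"
  assumes "(\<lambda>n. f n - g n) \<longlonglongrightarrow> 0" shows "lim f = lim g"
proof -
  have "f \<longlonglongrightarrow> l \<longleftrightarrow> g \<longlonglongrightarrow> l" for l
    using tendsto_diff[OF _ assms, of f l] tendsto_add[OF _ assms, of g l] by auto
  then show ?thesis unfolding lim_def by simp
qed

section \<open>The unitary induced by a trace-preserving isomorphism\<close>

locale trace_preserving_iso = A: tracial_subalgebra M \<tau> A + B: tracial_subalgebra N \<sigma> B
  for M :: "'h::chilbert_space op set" and \<tau> A and N :: "'k::chilbert_space op set" and \<sigma> B +
  fixes \<gamma> :: "'h op \<Rightarrow> 'k op"
  assumes iso: "star_iso A B \<gamma>" and trace: "x \<in> A \<Longrightarrow> \<sigma> (\<gamma> x) = \<tau> x"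
begin

lemma gamma_mem: "x \<in> A \<Longrightarrow> \<gamma> x \<in> B"
  and gamma_add: "x \<in> A \<Longrightarrow> y \<in> A \<Longrightarrow> \<gamma> (x + y) = \<gamma> x + \<gamma> y"
  and gamma_scalar: "x \<in> A \<Longrightarrow> \<gamma> (scalar_op c o\<^sub>L x) = scalar_op c o\<^sub>L \<gamma> x"
  and gamma_compose: "x \<in> A \<Longrightarrow> y \<in> A \<Longrightarrow> \<gamma> (x o\<^sub>L y) = \<gamma> x o\<^sub>L \<gamma> y"
  and gamma_adj: "x \<in> A \<Longrightarrow> \<gamma> (adj x) = adj (\<gamma> x)"
  and gamma_bij: "bij_betw \<gamma> A B"
  using iso by (auto simp: star_iso_def star_hom_def)

lemma gamma_diff: "x \<in> A \<Longrightarrow> y \<in> A \<Longrightarrow> \<gamma> (x - y) = \<gamma> x - \<gamma> y"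
  using gamma_add[of "x - y" y] A.A_diff by simp

lemma gns_norm_gamma: "x \<in> A \<Longrightarrow> gns_norm \<sigma> (\<gamma> x) = gns_norm \<tau> x"
  using trace[of "adj x o\<^sub>L x"] A.A_adj A.A_compose by (simp add: gns_norm_def gamma_adj gamma_compose)

lemma gns_norm_gamma_diff: "x \<in> A \<Longrightarrow> y \<in> A \<Longrightarrow> gns_norm \<sigma> (\<gamma> x - \<gamma> y) = gns_norm \<tau> (x - y)"
  using gns_norm_gamma[of "x - y"] A.A_diff by (simp add: gamma_diff)

lemma gamma_Cauchy: "X \<in> gns_Cauchy A \<tau> \<Longrightarrow> (\<lambda>n. \<gamma> (X n)) \<in> gns_Cauchy B \<sigma>"
  by (simp add: gns_Cauchy_def gns_norm_gamma_diff gamma_mem)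

lemma gamma_rel_iff:
  assumes "X \<in> gns_Cauchy A \<tau>" "Y \<in> gns_Cauchy A \<tau>"
  shows "((\<lambda>n. \<gamma> (X n)), (\<lambda>n. \<gamma> (Y n))) \<in> gns_rel B \<sigma> \<longleftrightarrow> (X, Y) \<in> gns_rel A \<tau>"
  using assms gns_norm_gamma_diff[OF A.gns_CauchyD[OF assms(1)] A.gns_CauchyD[OF assms(2)]]
  by (simp add: gns_rel_def gamma_Cauchy)

text \<open>The extension of \<gamma> by continuity, applied entrywise to a representing Cauchy
  sequence.\<close>

definition W :: "'h gns_vector \<Rightarrow> 'k gns_vector" where
  "W \<xi> = gns_class B \<sigma> (\<lambda>n. \<gamma> (repr \<xi> n))"

lemma W_class: "X \<in> gns_Cauchy A \<tau> \<Longrightarrow> W (gns_class A \<tau> X) = gns_class B \<sigma> (\<lambda>n. \<gamma> (X n))"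
  unfolding W_def
  by (intro B.gns_class_eqI) (simp add: gamma_rel_iff A.repr_class_rel A.repr_props A.gns_class_in_space)

lemma W_in_space: "\<xi> \<in> gns_space A \<tau> \<Longrightarrow> W \<xi> \<in> gns_space B \<sigma>"
  unfolding W_def by (intro B.gns_class_in_space gamma_Cauchy A.repr_props)

lemma repr_W: "\<xi> \<in> gns_space A \<tau> \<Longrightarrow> (repr (W \<xi>), \<lambda>n. \<gamma> (repr \<xi> n)) \<in> gns_rel B \<sigma>"
  unfolding W_def by (intro B.repr_class_rel gamma_Cauchy A.repr_props)

lemma W_bij: "bij_betw W (gns_space A \<tau>) (gns_space B \<sigma>)"
  unfolding bij_betw_def
proof
  show "inj_on W (gns_space A \<tau>)"
  proof (rule inj_onI)
    fix \<xi> \<eta> assume \<xi>: "\<xi> \<in> gns_space A \<tau>" and \<eta>: "\<eta> \<in> gns_space A \<tau>" and eq: "W \<xi> = W \<eta>"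
    have "((\<lambda>n. \<gamma> (repr \<xi> n)), (\<lambda>n. \<gamma> (repr \<eta> n))) \<in> gns_rel B \<sigma>"
      by (rule B.gns_class_eqD[OF eq[unfolded W_def] gamma_Cauchy[OF A.repr_props(1)[OF \<eta>]]])
    then have "(repr \<xi>, repr \<eta>) \<in> gns_rel A \<tau>"
      using gamma_rel_iff A.repr_props(1) \<xi> \<eta> by blast
    then show "\<xi> = \<eta>"
      using A.gns_class_eqI A.repr_props(2)[OF \<xi>] A.repr_props(2)[OF \<eta>] by metis
  qed
  show "W ` gns_space A \<tau> = gns_space B \<sigma>"
  proof safe
    fix \<eta> assume \<eta>: "\<eta> \<in> gns_space B \<sigma>"
    define Y where "Y = repr \<eta>"
    have Y: "Y \<in> gns_Cauchy B \<sigma>" "gns_class B \<sigma> Y = \<eta>" using B.repr_props[OF \<eta>] by (auto simp: Y_def)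
    \<comment> \<open>A preimage is taken entrywise; since \<gamma> preserves the trace norms, the
      lifted sequence is again Cauchy.\<close>
    define X where "X n = inv_into A \<gamma> (Y n)" for n
    have "\<gamma> ` A = B" using gamma_bij by (simp add: bij_betw_def)
    then have X: "X n \<in> A" "\<gamma> (X n) = Y n" for n
      using B.gns_CauchyD[OF Y(1), of n] unfolding X_def by (auto intro: inv_into_into f_inv_into_f)
    have "gns_norm \<tau> (X m - X n) = gns_norm \<sigma> (Y m - Y n)" for m n
      using gns_norm_gamma_diff[OF X(1) X(1), of m n] by (simp add: X(2))
    then have XC: "X \<in> gns_Cauchy A \<tau>"
      using Y(1) X(1) by (simp add: gns_Cauchy_def)
    have "W (gns_class A \<tau> X) = \<eta>" using W_class[OF XC] X(2) Y(2) by simp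
    then show "\<eta> \<in> W ` gns_space A \<tau>" using A.gns_class_in_space[OF XC] by blast
  qed (rule W_in_space)
qed

lemma W_add:
  assumes \<xi>: "\<xi> \<in> gns_space A \<tau>" and \<eta>: "\<eta> \<in> gns_space A \<tau>"
  shows "W (gns_add A \<tau> \<xi> \<eta>) = gns_add B \<sigma> (W \<xi>) (W \<eta>)"
proof -
  note C = A.repr_props(1)[OF \<xi>] A.repr_props(1)[OF \<eta>]
  have "W (gns_add A \<tau> \<xi> \<eta>) = gns_class B \<sigma> (\<lambda>n. \<gamma> (repr \<xi> n) + \<gamma> (repr \<eta> n))"
    using W_class[OF A.gns_Cauchy_add[OF C]] C[THEN A.gns_CauchyD] by (simp add: gns_add_def gamma_add)
  also have "\<dots> = gns_add B \<sigma> (W \<xi>) (W \<eta>)"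
    unfolding gns_add_def
    by (rule B.gns_class_eqI[OF B.gns_rel_add[OF repr_W[OF \<xi>] repr_W[OF \<eta>]], symmetric])
  finally show ?thesis .
qed

text \<open>Used twice: for scalar a it gives compatibility with \<open>gns_scale\<close>, for
  general a the implementing relation.\<close>

lemma W_compose:
  assumes \<xi>: "\<xi> \<in> gns_space A \<tau>" and a: "a \<in> A"
  shows "W (gns_class A \<tau> (\<lambda>n. a o\<^sub>L repr \<xi> n)) = gns_class B \<sigma> (\<lambda>n. \<gamma> a o\<^sub>L repr (W \<xi>) n)"
proof -
  note C = A.repr_props(1)[OF \<xi>]
  have "W (gns_class A \<tau> (\<lambda>n. a o\<^sub>L repr \<xi> n)) = gns_class B \<sigma> (\<lambda>n. \<gamma> a o\<^sub>L \<gamma> (repr \<xi> n))"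
    using W_class[OF A.gns_Cauchy_compose[OF C a]] C[THEN A.gns_CauchyD] a by (simp add: gamma_compose)
  also have "\<dots> = gns_class B \<sigma> (\<lambda>n. \<gamma> a o\<^sub>L repr (W \<xi>) n)"
    by (rule B.gns_class_eqI[OF B.gns_rel_compose[OF repr_W[OF \<xi>] gamma_mem[OF a]], symmetric])
  finally show ?thesis .
qed

lemma gamma_scalar_op: "\<gamma> (scalar_op c) = scalar_op c"
proof -
  have id: "id_blinfun \<in> A" "id_blinfun \<in> B" using A.A_scalar[of 1] B.A_scalar[of 1] by simp_all
  obtain e where e: "e \<in> A" "\<gamma> e = id_blinfun"
    using gamma_bij id(2) unfolding bij_betw_def by (metis imageE)
  have "\<gamma> id_blinfun = id_blinfun"
    using gamma_compose[OF id(1) e(1)] e(2) by simp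
  then show ?thesis using gamma_scalar[OF id(1), of c] by simp
qed

lemma W_inner:
  assumes \<xi>: "\<xi> \<in> gns_space A \<tau>" and \<eta>: "\<eta> \<in> gns_space A \<tau>"
  shows "gns_inner \<sigma> (W \<xi>) (W \<eta>) = gns_inner \<tau> \<xi> \<eta>"
proof -
  note C = A.repr_props(1)[OF \<xi>, THEN A.gns_CauchyD] A.repr_props(1)[OF \<eta>, THEN A.gns_CauchyD]
  have "gns_inner \<sigma> (W \<xi>) (W \<eta>) = lim (\<lambda>n. \<sigma> (adj (\<gamma> (repr \<eta> n)) o\<^sub>L \<gamma> (repr \<xi> n)))"
    unfolding gns_inner_def by (rule lim_cong_null[OF B.gns_inner_rel[OF repr_W[OF \<xi>] repr_W[OF \<eta>]]])
  moreover have "\<sigma> (adj (\<gamma> (repr \<eta> n)) o\<^sub>L \<gamma> (repr \<xi> n)) = \<tau> (adj (repr \<eta> n) o\<^sub>L repr \<xi> n)" for n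
    using trace[OF A.A_compose[OF A.A_adj[OF C(2)] C(1)], of n n]
    by (simp add: gamma_compose[OF A.A_adj[OF C(2)] C(1)] gamma_adj[OF C(2)])
  ultimately show ?thesis by (simp add: gns_inner_def)
qed

lemma W_unitary: "gns_unitary A \<tau> B \<sigma> W"
  unfolding gns_unitary_def gns_scale_def
  using W_bij W_add W_compose[OF _ A.A_scalar] W_inner by (simp add: gamma_scalar_op)

lemma W_implements: "implemented_by A \<tau> B \<sigma> \<gamma> W"
  unfolding implemented_by_def
proof (intro ballI)
  fix a \<eta> assume a: "a \<in> A" and \<eta>: "\<eta> \<in> gns_space B \<sigma>"
  define \<xi> where "\<xi> = inv_into (gns_space A \<tau>) W \<eta>"
  have "W ` gns_space A \<tau> = gns_space B \<sigma>" using W_bij by (simp add: bij_betw_def)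
  then have \<xi>: "\<xi> \<in> gns_space A \<tau>" "W \<xi> = \<eta>"
    using \<eta> inv_into_into[of \<eta> W "gns_space A \<tau>"] f_inv_into_f[of \<eta> W "gns_space A \<tau>"]
    by (simp_all add: \<xi>_def)
  show "W (gns_rep A \<tau> a (inv_into (gns_space A \<tau>) W \<eta>)) = gns_rep B \<sigma> (\<gamma> a) \<eta>"
    using W_compose[OF \<xi>(1) a] by (simp add: gns_rep_def \<xi>(2) flip: \<xi>_def)
qed

end

theorem proposition9p3:
  fixes M :: "'h::chilbert_space op set" and N :: "'k::chilbert_space op set"
    and \<alpha> :: "real \<Rightarrow> 'h op \<Rightarrow> 'h op" and \<beta> :: "real \<Rightarrow> 'k op \<Rightarrow> 'k op"
    and \<tau>\<^sub>M :: "'h op \<Rightarrow> complex" and \<tau>\<^sub>N :: "'k op \<Rightarrow> complex"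
  assumes "II1_factor M" and "faithful_normal_tracial_state M \<tau>\<^sub>M" and "E0_semigroup M \<alpha>"
    and "II1_factor N" and "faithful_normal_tracial_state N \<tau>\<^sub>N" and "E0_semigroup N \<beta>"
    and "cocycle_conjugate M \<alpha> N \<beta>"
  shows "\<exists>\<gamma>. semiflow_conjugacy (semiflow_algebra M \<alpha>) \<alpha> (semiflow_algebra N \<beta>) \<beta> \<gamma> \<and>
           (\<exists>U\<^sub>\<gamma>. gns_unitary (semiflow_algebra M \<alpha>) \<tau>\<^sub>M (semiflow_algebra N \<beta>) \<tau>\<^sub>N U\<^sub>\<gamma> \<and>
                 implemented_by (semiflow_algebra M \<alpha>) \<tau>\<^sub>M (semiflow_algebra N \<beta>) \<tau>\<^sub>N \<gamma> U\<^sub>\<gamma>)"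
proof -
  have vn: "von_neumann_algebra M" "von_neumann_algebra N"
    and fac: "M \<inter> commutant M = range scalar_op" "N \<inter> commutant N = range scalar_op"
    using assms by (auto simp: II1_factor_def factor_def)
  obtain U \<theta> where U: "cocycle M \<alpha> U" and \<theta>: "star_iso M N \<theta>"
    and conj: "\<forall>t\<ge>0. \<forall>y\<in>N. \<beta> t y = \<theta> (perturb \<alpha> U t (inv_into M \<theta> y))"
    using assms(7) unfolding cocycle_conjugate_def conjugate_def by blast
  interpret C: cocycle_conjugacy M N \<theta> \<alpha> \<beta> U
    by unfold_locales (fact vn \<theta> assms U conj)+
  interpret TM: normal_tracial_state M \<tau>\<^sub>M
    using faithful_normal_tracial_state_locale vn assms by blast
  interpret TN: normal_tracial_state N \<tau>\<^sub>N
    using faithful_normal_tracial_state_locale vn assms by blast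
  interpret G: trace_preserving_iso M \<tau>\<^sub>M "semiflow_algebra M \<alpha>" N \<tau>\<^sub>N "semiflow_algebra N \<beta>" C.\<gamma>
  proof unfold_locales
    show "star_iso (semiflow_algebra M \<alpha>) (semiflow_algebra N \<beta>) C.\<gamma>" by (rule C.gamma_iso)
    show "\<tau>\<^sub>N (C.\<gamma> x) = \<tau>\<^sub>M x" if "x \<in> semiflow_algebra M \<alpha>" for x
      by (rule C.trace_gamma[OF TM.normal_tracial_state_axioms fac(1) TN.normal_tracial_state_axioms fac(2) that])
  qed (fact C.SM.semiflow_algebra_subset C.SN.semiflow_algebra_subset
      C.SM.scalar_semiflow_algebra C.SN.scalar_semiflow_algebra |
      rule C.SM.semiflow_algebra_closed C.SN.semiflow_algebra_closed; assumption)+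
  have "semiflow_conjugacy (semiflow_algebra M \<alpha>) \<alpha> (semiflow_algebra N \<beta>) \<beta> C.\<gamma>"
    unfolding semiflow_conjugacy_def using C.gamma_iso C.gamma_intertwines by blast
  then show ?thesis using G.W_unitary G.W_implements by blast
qed

end
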